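(* Let $X=\{X(t):t\in\mathbb R\}$ be a centered Gaussian process with stationary increments, $X(0)=0$, continuous sample paths and variance function $\sigma^2(t)=\operatorname{Var}X(t)$. Suppose that (i) there is some $\varepsilon>0$ such that $\sigma^2(t)\,|\log|t||^{1+\varepsilon}$ has a finite limit as $t\to0$, and (ii) $\sigma$ is regularly varying at infinity with parameter $\alpha\in(0,1)$. With $\delta(c):=\inf\{x>0: x/\sigma(x)=1/c\}$, $$\frac{Q^{(c)}_X(\delta(c)\,\cdot)}{\sigma(\delta(c))}\xrightarrow{d} Q^{(1)}_{B_\alpha}(\cdot)\quad\text{as } c\to0,$$ in $C[0,\infty)$, where $B_\alpha$ is fractional Brownian motion with Hurst parameter $\alpha$.
   Context: Regular variation: a non-negative measurable function $f$ on $[0,\infty)$ is regularly varying at infinity with parameter $\alpha$ if $f(tx)/f(x)\to t^\alpha$ as $x\to\infty$ for all $t>0$. For a centered Gaussian process $Y=\{Y(t):t\in\mathbb R\}$ with stationary increments, $Y(0)=0$ and continuous sample paths, and for $c>0$, the stationary buffer content process is $$Q_Y^{(c)}(t)=\sup_{-\infty<s\le t}\bigl(Y(t)-Y(s)-c(t-s)\bigr),\qquad t\ge0.$$ Fractional Brownian motion $B_H=\{B_H(t):t\in\mathbb R\}$ with Hurst parameter $H\in(0,1)$ is the centered Gaussian process with stationary increments, continuous sample paths, $B_H(0)=0$ and covariance $\mathrm{Cov}(B_H(t),B_H(s))=\tfrac12(|s|^{2H}+|t|^{2H}-|t-s|^{2H})$. The function $\delta$ satisfies $c\,\delta(c)/\sigma(\delta(c))=1$;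 it is considered for those $c>0$ for which the set $\{x>0:x/\sigma(x)=1/c\}$ is nonempty, which is the case for all sufficiently small $c$. $C[0,\infty)$ is the space of continuous functions $[0,\infty)\to\mathbb R$ with the topology of uniform convergence on compact intervals $[0,T]$, $T>0$; $\xrightarrow{d}$ denotes weak convergence (convergence in distribution) of random elements of this space. *)

theory Defs
  imports "HOL-Probability.Probability"
begin

definition regularly_varying :: "(real \<Rightarrow> real) \<Rightarrow> real \<Rightarrow> bool" where
  "regularly_varying f \<alpha> \<longleftrightarrow>
     (\<forall>x\<ge>0. f x \<ge> 0) \<and> f \<in> borel_measurable (restrict_space borel {0..}) \<and>
     (\<forall>t>0. ((\<lambda>x. f (t * x) / f x) \<longlongrightarrow> t powr \<alpha>) at_top)"

text \<open>Point masses count as Gaussian, so that degenerate finite-dimensional distributions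
  are allowed.\<close>

definition gaussian_rv :: "'a measure \<Rightarrow> ('a \<Rightarrow> real) \<Rightarrow> bool" where
  "gaussian_rv M Y \<longleftrightarrow> Y \<in> borel_measurable M \<and>
     (\<exists>\<mu>. (AE \<omega> in M. Y \<omega> = \<mu>) \<or> (\<exists>s>0. distributed M lborel Y (normal_density \<mu> s)))"

definition gaussian_process :: "'a measure \<Rightarrow> (real \<Rightarrow> 'a \<Rightarrow> real) \<Rightarrow> bool" where
  "gaussian_process M X \<longleftrightarrow>
     (\<forall>J a. finite J \<longrightarrow> gaussian_rv M (\<lambda>\<omega>. \<Sum>t\<in>J. a t * X t \<omega>))"

definition centered :: "'a measure \<Rightarrow> (real \<Rightarrow> 'a \<Rightarrow> real) \<Rightarrow> bool" where
  "centered M X \<longleftrightarrow> (\<forall>t. prob_space.expectation M (X t) = 0)"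

definition stationary_increments :: "'a measure \<Rightarrow> (real \<Rightarrow> 'a \<Rightarrow> real) \<Rightarrow> bool" where
  "stationary_increments M X \<longleftrightarrow>
     (\<forall>h J. finite J \<longrightarrow>
        distr M (\<Pi>\<^sub>M t\<in>J. borel) (\<lambda>\<omega>. \<lambda>t\<in>J. X (t + h) \<omega> - X h \<omega>) =
        distr M (\<Pi>\<^sub>M t\<in>J. borel) (\<lambda>\<omega>. \<lambda>t\<in>J. X t \<omega> - X 0 \<omega>))"

definition continuous_paths :: "'a measure \<Rightarrow> (real \<Rightarrow> 'a \<Rightarrow> real) \<Rightarrow> bool" where
  "continuous_paths M X \<longleftrightarrow> (\<forall>\<omega>\<in>space M. continuous_on UNIV (\<lambda>t. X t \<omega>))"

definition centered_gaussian_si :: "'a measure \<Rightarrow> (real \<Rightarrow> 'a \<Rightarrow> real) \<Rightarrow> bool" where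
  "centered_gaussian_si M X \<longleftrightarrow>
     gaussian_process M X \<and> centered M X \<and> stationary_increments M X \<and>
     (\<forall>\<omega>\<in>space M. X 0 \<omega> = 0) \<and> continuous_paths M X"

definition covariance :: "'a measure \<Rightarrow> ('a \<Rightarrow> real) \<Rightarrow> ('a \<Rightarrow> real) \<Rightarrow> real" where
  "covariance M Y Z = prob_space.expectation M
     (\<lambda>\<omega>. (Y \<omega> - prob_space.expectation M Y) * (Z \<omega> - prob_space.expectation M Z))"

definition fractional_brownian_motion ::
    "real \<Rightarrow> 'a measure \<Rightarrow> (real \<Rightarrow> 'a \<Rightarrow> real) \<Rightarrow> bool" where
  "fractional_brownian_motion H M B \<longleftrightarrow>
     0 < H \<and> H < 1 \<and> centered_gaussian_si M B \<and>
     (\<forall>t s. covariance M (B t) (B s) =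
        (\<bar>s\<bar> powr (2 * H) + \<bar>t\<bar> powr (2 * H) - \<bar>t - s\<bar> powr (2 * H)) / 2)"

definition std_dev :: "'a measure \<Rightarrow> (real \<Rightarrow> 'a \<Rightarrow> real) \<Rightarrow> real \<Rightarrow> real" where
  "std_dev M X t = sqrt (prob_space.variance M (X t))"

text \<open>The supremum is finite only almost surely, so it is taken in the extended reals.\<close>

definition buffer :: "(real \<Rightarrow> 'a \<Rightarrow> real) \<Rightarrow> real \<Rightarrow> real \<Rightarrow> 'a \<Rightarrow> ereal" where
  "buffer Y c t \<omega> = (SUP s\<in>{..t}. ereal (Y t \<omega> - Y s \<omega> - c * (t - s)))"

text \<open>Since \<open>x / 0 = 0\<close>, points where \<open>\<sigma>\<close> vanishes never belong to the set below
  when \<open>c > 0\<close>.\<close>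

definition time_scale :: "(real \<Rightarrow> real) \<Rightarrow> real \<Rightarrow> real" where
  "time_scale \<sigma> c = Inf {x. x > 0 \<and> x / \<sigma> x = 1 / c}"

typedef cpath = "{f :: real \<Rightarrow> real. f \<in> extensional {0..} \<and> continuous_on {0..} f}"
  morphisms eval_cpath Abs_cpath
  by (rule exI[of _ "\<lambda>t\<in>{0..}. 0"]) (auto intro: continuous_on_eq[OF continuous_on_const])

text \<open>Elements represent \<open>C[0,\<infinity>)\<close>, with the topology of uniform convergence on compact intervals
  \<open>[0,T]\<close>.\<close>

instantiation cpath :: topological_space
begin

definition open_cpath :: "cpath set \<Rightarrow> bool" where
  "open_cpath U \<longleftrightarrow>
     (\<forall>f\<in>U. \<exists>T>0. \<exists>e>0. \<forall>g.
        (\<forall>t\<in>{0..T}. dist (eval_cpath g t) (eval_cpath f t) < e) \<longrightarrow> g \<in> U)"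

instance
proof
  show "open (UNIV :: cpath set)"
    unfolding open_cpath_def by (auto intro: exI[of _ 1])
next
  fix S T :: "cpath set"
  assume S: "open S" and T: "open T"
  show "open (S \<inter> T)"
    unfolding open_cpath_def
  proof
    fix f assume f: "f \<in> S \<inter> T"
    obtain T1 e1 where S1: "T1 > 0" "e1 > 0"
      "\<And>g. (\<forall>t\<in>{0..T1}. dist (eval_cpath g t) (eval_cpath f t) < e1) \<Longrightarrow> g \<in> S"
      using S f unfolding open_cpath_def by blast
    obtain T2 e2 where T2: "T2 > 0" "e2 > 0"
      "\<And>g. (\<forall>t\<in>{0..T2}. dist (eval_cpath g t) (eval_cpath f t) < e2) \<Longrightarrow> g \<in> T"
      using T f unfolding open_cpath_def by blast
    show "\<exists>T'>0. \<exists>e>0. \<forall>g.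
        (\<forall>t\<in>{0..T'}. dist (eval_cpath g t) (eval_cpath f t) < e) \<longrightarrow> g \<in> S \<inter> T"
    proof (rule exI[of _ "max T1 T2"], intro conjI, goal_cases)
      case 2
      show ?case
      proof (rule exI[of _ "min e1 e2"], intro conjI allI impI)
        fix g
        assume *: "\<forall>t\<in>{0..max T1 T2}. dist (eval_cpath g t) (eval_cpath f t) < min e1 e2"
        have "g \<in> S" by (rule S1(3)) (use * in auto)
        moreover have "g \<in> T" by (rule T2(3)) (use * in auto)
        ultimately show "g \<in> S \<inter> T" ..
      qed (use S1(2) T2(2) in auto)
    qed (use S1(1) in auto)
  qed
next
  fix K :: "cpath set set"
  assume K: "\<forall>S\<in>K. open S"
  show "open (\<Union>K)"
    unfolding open_cpath_def
  proof
    fix f assume "f \<in> \<Union>K"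
    then obtain S where S: "S \<in> K" "f \<in> S" by blast
    with K have "open S" by blast
    with S(2) obtain T e where "T > 0" "e > 0"
      "\<forall>g. (\<forall>t\<in>{0..T}. dist (eval_cpath g t) (eval_cpath f t) < e) \<longrightarrow> g \<in> S"
      unfolding open_cpath_def by blast
    with S(1) show "\<exists>T>0. \<exists>e>0. \<forall>g.
        (\<forall>t\<in>{0..T}. dist (eval_cpath g t) (eval_cpath f t) < e) \<longrightarrow> g \<in> \<Union>K"
      by (metis UnionI)
  qed
qed

end

definition is_cpath :: "(real \<Rightarrow> ereal) \<Rightarrow> bool" where
  "is_cpath x \<longleftrightarrow>
     (\<forall>t\<ge>0. \<bar>x t\<bar> \<noteq> \<infinity>) \<and> continuous_on {0..} (\<lambda>t. real_of_ereal (x t))"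

text \<open>Trajectories outside \<open>C[0,\<infinity>)\<close> are replaced by the zero path; convergence below
  demands that they form a null set.\<close>

definition to_cpath :: "(real \<Rightarrow> ereal) \<Rightarrow> cpath" where
  "to_cpath x = Abs_cpath (\<lambda>t\<in>{0..}. if is_cpath x then real_of_ereal (x t) else 0)"

definition random_cpath :: "'a measure \<Rightarrow> (real \<Rightarrow> 'a \<Rightarrow> ereal) \<Rightarrow> bool" where
  "random_cpath M \<xi> \<longleftrightarrow>
     (AE \<omega> in M. is_cpath (\<lambda>t. \<xi> t \<omega>)) \<and>
     (\<lambda>\<omega>. to_cpath (\<lambda>t. \<xi> t \<omega>)) \<in> M \<rightarrow>\<^sub>M borel"

definition conv_in_distr_cpath ::
    "'a measure \<Rightarrow> ('i \<Rightarrow> real \<Rightarrow> 'a \<Rightarrow> ereal) \<Rightarrow>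
     'b measure \<Rightarrow> (real \<Rightarrow> 'b \<Rightarrow> ereal) \<Rightarrow> 'i filter \<Rightarrow> bool" where
  "conv_in_distr_cpath M \<xi> N \<eta> F \<longleftrightarrow>
     (\<forall>\<^sub>F i in F. random_cpath M (\<xi> i)) \<and> random_cpath N \<eta> \<and>
     (\<forall>\<phi> :: cpath \<Rightarrow> real. continuous_on UNIV \<phi> \<longrightarrow> bounded (range \<phi>) \<longrightarrow>
        ((\<lambda>i. prob_space.expectation M (\<lambda>\<omega>. \<phi> (to_cpath (\<lambda>t. \<xi> i t \<omega>)))) \<longlongrightarrow>
           prob_space.expectation N (\<lambda>\<omega>. \<phi> (to_cpath (\<lambda>t. \<eta> t \<omega>)))) F)"

end

theory Submission
  imports Defs "HOL-Real_Asymp.Real_Asymp"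
begin

text \<open>
  Write \<open>queue f t = sup\<^bsub>s \<le> t\<^esub> (f t - f s - (t - s))\<close> for the content of a buffer with unit drain rate fed
  by a path \<open>f\<close>, and \<open>X\<^sub>u t = X (u * t) / \<sigma> u\<close>. Substituting in the supremum, and using
  \<open>c * \<delta> c = \<sigma> (\<delta> c)\<close>, identifies the rescaled buffer content with \<open>queue X\<^sub>u\<close> for \<open>u = \<delta> c\<close>
  (\<open>buffer_rescale\<close>). As \<open>\<delta> c\<close> tends to infinity when \<open>c\<close> tends to 0 (\<open>time_scale_properties\<close>), the claim is that
  \<open>queue X\<^sub>u\<close> converges in distribution to \<open>queue B\<close> as \<open>u\<close> tends to infinity (\<open>queue_convergence\<close>).

  The finite-dimensional distributions of \<open>X\<^sub>u\<close> converge to those of \<open>B\<close>, because a centered Gaussian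
  process with stationary increments is determined by its variance function and
  \<open>\<sigma> (u * t) / \<sigma> u\<close> tends to \<open>\<bar>t\<bar> powr \<alpha>\<close>. In the form needed here, expectations of bounded Lipschitz
  functions of finitely many coordinates converge; this is deduced from the characteristic functions
  by smoothing one coordinate after the other with a Gaussian kernel, itself a superposition of
  exponentials (\<open>char_convergence_imp_mixed_convergence\<close>).

  To compare \<open>queue X\<^sub>u\<close> with a function of finitely many values of \<open>X\<^sub>u\<close>, two estimates uniform in
  large \<open>u\<close> are needed: far to the left \<open>\<bar>X\<^sub>u s\<bar> \<le> \<bar>s\<bar>\<close>, so that the supremum is attained in a bounded window
  (\<open>scaled_linear_growth\<close>), and \<open>X\<^sub>u\<close> oscillates little on the cells of a fine grid
  (\<open>scaled_modulus\<close>). Both follow from a tail bound for the excursions of \<open>X\<close> over an interval of length \<open>v\<close>,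
  measured in units of \<open>\<sigma> v\<close> (\<open>scaled_tail\<close>). It is proved by repeatedly halving the interval, where
  regular variation makes the contributions decrease geometrically, until the length is of order 1;
  there the logarithmic condition on the variance at 0 allows a chaining argument
  (\<open>small_interval_tail\<close>).

  Finally, a bounded continuous \<open>\<phi>\<close> on the path space is the pointwise limit from below of envelopes that are
  Lipschitz for the supremum distance on \<open>[0, k]\<close>, and so is \<open>- \<phi>\<close>. Convergence of the expectations of the
  envelopes therefore gives convergence of the expectations of \<open>\<phi>\<close> (\<open>portmanteau_envelope\<close>), and the
  envelopes are exactly the functionals for which the discretisation error can be controlled.
\<close>

section \<open>Exceptional events\<close>

text \<open>Events such as \<open>\<exists>t\<in>{a..b}. l < \<bar>X t \<omega>\<bar>\<close> quantify over uncountably many times. Bounding the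
  probability of a measurable superset instead leaves the union bounds intact and spares a
  measurability argument for each such event.\<close>

definition outer_prob_le :: "'a measure \<Rightarrow> ('a \<Rightarrow> bool) \<Rightarrow> real \<Rightarrow> bool" where
  "outer_prob_le M P p \<longleftrightarrow> (\<exists>A\<in>sets M. measure M A \<le> p \<and> (\<forall>\<omega>\<in>space M. P \<omega> \<longrightarrow> \<omega> \<in> A))"

lemma outer_prob_leI:
  "A \<in> sets M \<Longrightarrow> measure M A \<le> p \<Longrightarrow> (\<And>\<omega>. \<omega> \<in> space M \<Longrightarrow> P \<omega> \<Longrightarrow> \<omega> \<in> A) \<Longrightarrow> outer_prob_le M P p"
  unfolding outer_prob_le_def by blast

lemma outer_prob_le_mono:
  assumes "outer_prob_le M P p" "p \<le> q" "\<And>\<omega>. \<omega> \<in> space M \<Longrightarrow> Q \<omega> \<Longrightarrow> P \<omega>"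
  shows "outer_prob_le M Q q"
  using assms unfolding outer_prob_le_def by (meson order_trans)

lemma (in prob_space) outer_prob_le_1: "1 \<le> p \<Longrightarrow> outer_prob_le M P p"
  by (rule outer_prob_leI[of "space M"]) (auto simp: prob_space)

lemma (in prob_space) outer_prob_le_UN_finite:
  assumes "finite I" "\<And>i. i \<in> I \<Longrightarrow> outer_prob_le M (P i) (p i)"
  shows "outer_prob_le M (\<lambda>\<omega>. \<exists>i\<in>I. P i \<omega>) (sum p I)"
proof -
  have "\<forall>i\<in>I. \<exists>A. A \<in> sets M \<and> measure M A \<le> p i \<and> (\<forall>\<omega>\<in>space M. P i \<omega> \<longrightarrow> \<omega> \<in> A)"
    using assms(2) unfolding outer_prob_le_def by blast
  then obtain A where A: "\<And>i. i \<in> I \<Longrightarrow> A i \<in> sets M \<and> measure M (A i) \<le> p i \<and> (\<forall>\<omega>\<in>space M. P i \<omega> \<longrightarrow> \<omega> \<in> A i)"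
    by metis
  have "measure M (\<Union>i\<in>I. A i) \<le> (\<Sum>i\<in>I. measure M (A i))"
    by (rule finite_measure_subadditive_finite) (use assms(1) A in auto)
  also have "\<dots> \<le> sum p I" using A by (intro sum_mono) auto
  finally show ?thesis
    by (intro outer_prob_leI[of "\<Union>i\<in>I. A i"]) (use A assms(1) in auto)
qed

lemma (in prob_space) outer_prob_le_disj:
  assumes "outer_prob_le M P p" "outer_prob_le M Q q"
  shows "outer_prob_le M (\<lambda>\<omega>. P \<omega> \<or> Q \<omega>) (p + q)"
proof -
  have "outer_prob_le M (\<lambda>\<omega>. \<exists>i\<in>UNIV. (if i then P else Q) \<omega>) (\<Sum>i\<in>UNIV. if i then p else q)"
    using assms by (intro outer_prob_le_UN_finite) auto
  then show ?thesis
    by (rule outer_prob_le_mono) (auto simp: UNIV_bool split: if_splits)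
qed

lemma (in prob_space) outer_prob_le_UN:
  fixes P :: "nat \<Rightarrow> 'a \<Rightarrow> bool"
  assumes "\<And>i. outer_prob_le M (P i) (p i)" "summable p"
  shows "outer_prob_le M (\<lambda>\<omega>. \<exists>i. P i \<omega>) (\<Sum>i. p i)"
proof -
  have "\<forall>i. \<exists>A. A \<in> sets M \<and> measure M A \<le> p i \<and> (\<forall>\<omega>\<in>space M. P i \<omega> \<longrightarrow> \<omega> \<in> A)"
    using assms(1) unfolding outer_prob_le_def by blast
  then obtain A where A: "\<And>i. A i \<in> sets M \<and> measure M (A i) \<le> p i \<and> (\<forall>\<omega>\<in>space M. P i \<omega> \<longrightarrow> \<omega> \<in> A i)"
    by metis
  have s: "summable (\<lambda>i. measure M (A i))"
    by (rule summable_comparison_test'[OF assms(2), of 0]) (use A in auto)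
  have "measure M (\<Union>i. A i) \<le> (\<Sum>i. measure M (A i))"
    by (rule finite_measure_subadditive_countably) (use A s in auto)
  also have "\<dots> \<le> (\<Sum>i. p i)" using A s assms(2) by (intro suminf_le) auto
  finally show ?thesis
    by (intro outer_prob_leI[of "\<Union>i. A i"]) (use A in auto)
qed

text \<open>The intersection of the covering sets has measure below every \<open>p n\<close>.\<close>

lemma (in prob_space) AE_if_outer_prob_le:
  assumes "\<And>n. outer_prob_le M (P n) (p n)" "p \<longlonglongrightarrow> (0::real)"
  shows "AE \<omega> in M. \<exists>n::nat. \<not> P n \<omega>"
proof -
  have "\<forall>i. \<exists>A. A \<in> sets M \<and> measure M A \<le> p i \<and> (\<forall>\<omega>\<in>space M. P i \<omega> \<longrightarrow> \<omega> \<in> A)"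
    using assms(1) unfolding outer_prob_le_def by blast
  then obtain A where A: "\<And>i. A i \<in> sets M \<and> measure M (A i) \<le> p i \<and> (\<forall>\<omega>\<in>space M. P i \<omega> \<longrightarrow> \<omega> \<in> A i)"
    by metis
  define B where "B = (\<Inter>i. A i)"
  have B: "B \<in> sets M" unfolding B_def using A by auto
  have "measure M B \<le> p n" for n
  proof -
    have "measure M B \<le> measure M (A n)"
      by (rule finite_measure_mono) (use A in \<open>auto simp: B_def\<close>)
    then show ?thesis using A[of n] by linarith
  qed
  then have "measure M B \<le> 0"
    using LIMSEQ_le_const[OF assms(2)] by blast
  then have "emeasure M B = 0" using emeasure_eq_measure[of B] measure_nonneg[of M B] by simp
  with B have "B \<in> null_sets M" by auto
  then show ?thesis
    by (rule AE_I') (use A in \<open>auto simp: B_def\<close>)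
qed

text \<open>The two variables differ by at most \<open>e\<close> off the exceptional event and by at most \<open>2 * C\<close> on it.\<close>

lemma (in prob_space) abs_expectation_diff_le:
  fixes f g :: "'a \<Rightarrow> real"
  assumes "f \<in> borel_measurable M" "g \<in> borel_measurable M"
    and "\<And>\<omega>. \<omega> \<in> space M \<Longrightarrow> \<bar>f \<omega>\<bar> \<le> C" "\<And>\<omega>. \<omega> \<in> space M \<Longrightarrow> \<bar>g \<omega>\<bar> \<le> C"
    and "outer_prob_le M P p" "0 \<le> e"
    and "\<And>\<omega>. \<omega> \<in> space M \<Longrightarrow> \<not> P \<omega> \<Longrightarrow> \<bar>f \<omega> - g \<omega>\<bar> \<le> e"
  shows "\<bar>expectation f - expectation g\<bar> \<le> e + 2 * C * p"
proof -
  obtain A where A[measurable]: "A \<in> sets M" and Ap: "measure M A \<le> p" "\<And>\<omega>. \<omega> \<in> space M \<Longrightarrow> P \<omega> \<Longrightarrow> \<omega> \<in> A"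
    using assms(5) unfolding outer_prob_le_def by blast
  have int: "integrable M f" "integrable M g"
    by (rule integrable_const_bound[of _ C]; use assms in auto)+
  have C: "0 \<le> C" using assms(3) not_empty by (metis abs_ge_zero ex_in_conv order_trans)
  have "\<bar>expectation f - expectation g\<bar> = \<bar>expectation (\<lambda>\<omega>. f \<omega> - g \<omega>)\<bar>"
    using int by simp
  also have "\<dots> \<le> expectation (\<lambda>\<omega>. \<bar>f \<omega> - g \<omega>\<bar>)"
    by (rule integral_abs_bound)
  also have "\<dots> \<le> expectation (\<lambda>\<omega>. e + 2 * C * indicator A \<omega>)"
  proof (rule integral_mono)
    show "integrable M (\<lambda>\<omega>. \<bar>f \<omega> - g \<omega>\<bar>)" using int by simp
    show "integrable M (\<lambda>\<omega>. e + 2 * C * indicator A \<omega>)"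
      by (intro Bochner_Integration.integrable_add integrable_const integrable_mult_right integrable_real_indicator) (auto simp: emeasure_eq_measure)
    fix \<omega> assume w: "\<omega> \<in> space M"
    show "\<bar>f \<omega> - g \<omega>\<bar> \<le> e + 2 * C * indicator A \<omega>"
    proof (cases "\<omega> \<in> A")
      case True
      then show ?thesis using assms(3,4)[OF w] \<open>0 \<le> e\<close> by auto
    next
      case False
      then show ?thesis using Ap(2)[OF w] assms(7)[OF w] by auto
    qed
  qed
  also have "\<dots> = e + 2 * C * measure M A"
    by (subst Bochner_Integration.integral_add) (auto simp: emeasure_eq_measure prob_space)
  also have "\<dots> \<le> e + 2 * C * p" using Ap C by (simp add: mult_left_mono)
  finally show ?thesis .
qed

section \<open>Centered Gaussian variables\<close>

lemma (in prob_space) gaussian_rv_cases: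
  assumes "gaussian_rv M Y" "expectation Y = 0"
  obtains (zero) "AE \<omega> in M. Y \<omega> = 0" "variance Y = 0"
  | (normal) s where "s > 0" "distributed M lborel Y (normal_density 0 s)" "variance Y = s\<^sup>2"
proof -
  have Y[measurable]: "Y \<in> borel_measurable M" using assms(1) unfolding gaussian_rv_def by simp
  from assms(1) consider \<mu> where "AE \<omega> in M. Y \<omega> = \<mu>" | \<mu> s where "s > 0" "distributed M lborel Y (normal_density \<mu> s)"
    unfolding gaussian_rv_def by blast
  then show ?thesis
  proof cases
    case 1
    have "expectation Y = expectation (\<lambda>_. \<mu>)" by (rule integral_cong_AE) (use 1 in auto)
    with assms(2) have \<mu>: "\<mu> = 0" by (simp add: prob_space)
    have "variance Y = expectation (\<lambda>_. 0)" by (rule integral_cong_AE) (use 1 \<mu> assms(2) in auto)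
    with 1 \<mu> show ?thesis by (intro zero) auto
  next
    case 2
    have "\<mu> = 0" using normal_distributed_expectation[OF 2] assms(2) by simp
    with 2 normal_distributed_variance[OF 2] show ?thesis by (intro normal) auto
  qed
qed

lemma (in prob_space) centered_gaussian_charfun:
  assumes "gaussian_rv M Y" "expectation Y = 0"
  shows "(CLINT \<omega>|M. iexp (Y \<omega>)) = exp (- (variance Y / 2))"
  using assms
proof (cases rule: gaussian_rv_cases)
  case zero
  have [measurable]: "Y \<in> borel_measurable M" using assms(1) unfolding gaussian_rv_def by simp
  have "(CLINT \<omega>|M. iexp (Y \<omega>)) = (CLINT \<omega>|M. 1)"
    by (rule integral_cong_AE) (use zero in auto)
  then show ?thesis using zero by (simp add: prob_space)
next
  case (normal s)
  have "distributed M lborel (\<lambda>x. (Y x - 0) / s) std_normal_density"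
    using normal_standard_normal_convert[OF normal(1), of Y 0] normal(2) by simp
  then have d: "distr M lborel (\<lambda>x. Y x / s) = density lborel std_normal_density"
    and m: "(\<lambda>x. Y x / s) \<in> borel_measurable M"
    unfolding distributed_def by auto
  have "distr M borel (\<lambda>x. Y x / s) = density lborel std_normal_density"
    using d by (metis distr_cong sets_lborel)
  then have "char (distr M borel (\<lambda>x. Y x / s)) s = exp (- (s\<^sup>2) / 2)"
    using char_std_normal_distribution by simp
  moreover have "char (distr M borel (\<lambda>x. Y x / s)) s = (CLINT \<omega>|M. iexp (s * (Y \<omega> / s)))"
    unfolding char_def by (subst integral_distr) (use m in auto)
  ultimately show ?thesis using normal by simp
qed

text \<open>Chernoff's bound. For a standard normal \<open>Z\<close> and \<open>z \<ge> 0\<close>, Markov's inequality is applied to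
  \<open>exp (z * Z) + exp (- z * Z)\<close>, which has expectation \<open>2 * exp (z\<^sup>2 / 2)\<close> and is at least \<open>exp (z\<^sup>2)\<close>
  as soon as \<open>\<bar>Z\<bar> \<ge> z\<close>; this treats both tails at once.\<close>

lemma (in prob_space) centered_gaussian_tail:
  assumes "gaussian_rv M Y" "expectation Y = 0" "variance Y \<le> S" "0 < S" "0 \<le> x"
  shows "outer_prob_le M (\<lambda>\<omega>. x < \<bar>Y \<omega>\<bar>) (2 * exp (- (x\<^sup>2 / (2 * S))))"
  using assms(1,2)
proof (cases rule: gaussian_rv_cases)
  case zero
  have [measurable]: "Y \<in> borel_measurable M" using assms(1) unfolding gaussian_rv_def by simp
  have "prob {\<omega>\<in>space M. x < \<bar>Y \<omega>\<bar>} = 0"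
    by (rule prob_eq_0_AE) (use zero assms(5) in auto)
  then show ?thesis
    by (intro outer_prob_leI[of "{\<omega>\<in>space M. x < \<bar>Y \<omega>\<bar>}"]) auto
next
  case (normal s)
  have [measurable]: "Y \<in> borel_measurable M" using assms(1) unfolding gaussian_rv_def by simp
  define z where "z = x / s"
  have z: "0 \<le> z" using normal assms by (simp add: z_def)
  define Z where "Z \<omega> = Y \<omega> / s" for \<omega>
  have [measurable]: "Z \<in> borel_measurable M" unfolding Z_def by measurable
  have dZ: "distributed M lborel Z std_normal_density"
    unfolding Z_def using normal_standard_normal_convert[OF normal(1), of Y 0] normal(2) by simp
  have mgf: "has_bochner_integral M (\<lambda>\<omega>. exp (u * Z \<omega>)) (exp (u\<^sup>2 / 2))" for u
  proof -
    \<comment> \<open>Completing the square: the exponential tilt of a standard normal density is a shifted one.\<close>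
    have eq: "std_normal_density y * exp (u * y) = exp (u\<^sup>2 / 2) * normal_density u 1 y" for y
      unfolding normal_density_def
      by (simp add: exp_add[symmetric] field_simps power2_eq_square exp_diff exp_minus)
    have i: "integrable lborel (\<lambda>y. std_normal_density y * exp (u * y))"
      unfolding eq by simp
    have v: "(\<integral>y. std_normal_density y * exp (u * y) \<partial>lborel) = exp (u\<^sup>2 / 2)"
      unfolding eq by simp
    show ?thesis
      using i v distributed_integrable[OF dZ, of "\<lambda>y. exp (u * y)"] distributed_integral[OF dZ, of "\<lambda>y. exp (u * y)"]
      by (simp add: has_bochner_integral_iff)
  qed
  let ?f = "\<lambda>\<omega>. exp (z * Z \<omega>) + exp (- z * Z \<omega>)"
  have hf: "has_bochner_integral M ?f (exp (z\<^sup>2 / 2) + exp ((- z)\<^sup>2 / 2))"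
    by (rule has_bochner_integral_add[OF mgf mgf])
  have "prob {\<omega>\<in>space M. exp (z\<^sup>2) \<le> ?f \<omega>} \<le> expectation ?f / exp (z\<^sup>2)"
    by (rule integral_Markov_inequality_measure[of _ _ "{}"]) (use hf in \<open>auto simp: has_bochner_integral_iff intro!: AE_I2 add_nonneg_nonneg\<close>)
  also have "expectation ?f = 2 * exp (z\<^sup>2 / 2)" using hf by (simp add: has_bochner_integral_iff)
  also have "2 * exp (z\<^sup>2 / 2) / exp (z\<^sup>2) = 2 * exp (- (z\<^sup>2 / 2))"
    by (simp add: exp_diff[symmetric] flip: times_divide_eq_right) 
  also have "\<dots> \<le> 2 * exp (- (x\<^sup>2 / (2 * S)))"
  proof -
    have "x\<^sup>2 / (2 * S) \<le> x\<^sup>2 / (2 * s\<^sup>2)"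
      by (rule divide_left_mono) (use normal assms in auto)
    then show ?thesis by (simp add: z_def power_divide)
  qed
  finally show ?thesis
  proof (rule outer_prob_leI[rotated])
    fix \<omega> assume w: "\<omega> \<in> space M" "x < \<bar>Y \<omega>\<bar>"
    then have "z \<le> \<bar>Z \<omega>\<bar>" unfolding z_def Z_def using normal by (simp add: divide_right_mono)
    then have "z * z \<le> z * \<bar>Z \<omega>\<bar>" using z by (rule mult_left_mono)
    then have "exp (z\<^sup>2) \<le> exp (z * \<bar>Z \<omega>\<bar>)" by (simp add: power2_eq_square)
    also have "\<dots> \<le> ?f \<omega>" by (cases "Z \<omega> \<ge> 0") auto
    finally show "\<omega> \<in> {\<omega>\<in>space M. exp (z\<^sup>2) \<le> ?f \<omega>}" using w by simp
  qed measurable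
qed

lemma (in prob_space) centered_gaussian_integrable_power:
  assumes "gaussian_rv M Y" "expectation Y = 0"
  shows "integrable M (\<lambda>\<omega>. Y \<omega> ^ k)"
  using assms
proof (cases rule: gaussian_rv_cases)
  case zero
  have [measurable]: "Y \<in> borel_measurable M" using assms(1) unfolding gaussian_rv_def by simp
  have "integrable M (\<lambda>\<omega>. Y \<omega> ^ k) \<longleftrightarrow> integrable M (\<lambda>\<omega>. (0::real) ^ k)"
    by (rule integrable_cong_AE) (use zero in auto)
  then show ?thesis by simp
next
  case (normal s)
  show ?thesis
    using distributed_integrable[OF normal(2), of "\<lambda>x. x ^ k"] integrable_normal_moment[OF normal(1), of 0 k]
    by simp
qed

lemma exp_minus_le_power:
  fixes z :: real
  assumes "0 < z"
  shows "exp (- z) \<le> fact q / z ^ q"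
proof -
  have "z ^ q / fact q = (\<Sum>n\<in>{q}. z ^ n /\<^sub>R fact n)" by (simp add: divide_inverse mult.commute)
  also have "\<dots> \<le> exp z"
    unfolding exp_def by (rule sum_le_suminf) (use assms summable_exp_generic[of z] in auto)
  finally show ?thesis using assms by (simp add: exp_minus field_simps)
qed

text \<open>Across scales the errors are compared by powers of \<open>\<sigma>\<close>, so the tail is used with a power
  \<open>2 * q\<close> that can be chosen large in terms of \<open>1 / \<alpha>\<close>.\<close>

lemma (in prob_space) centered_gaussian_power_tail:
  assumes "gaussian_rv M Y" "expectation Y = 0" "variance Y \<le> S" "0 < S" "0 < x"
  shows "outer_prob_le M (\<lambda>\<omega>. x < \<bar>Y \<omega>\<bar>) (2 * fact q * 2 ^ q * S ^ q / x ^ (2 * q))"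
proof -
  have "outer_prob_le M (\<lambda>\<omega>. x < \<bar>Y \<omega>\<bar>) (2 * exp (- (x\<^sup>2 / (2 * S))))"
    by (rule centered_gaussian_tail) (use assms in auto)
  moreover have "2 * exp (- (x\<^sup>2 / (2 * S))) \<le> 2 * (fact q / (x\<^sup>2 / (2 * S)) ^ q)"
    by (intro mult_left_mono exp_minus_le_power) (use assms in auto)
  moreover have "2 * (fact q / (x\<^sup>2 / (2 * S)) ^ q) = 2 * fact q * 2 ^ q * S ^ q / x ^ (2 * q)"
    using assms by (simp add: power_divide power_mult_distrib power_mult)
  ultimately show ?thesis by (auto elim: outer_prob_le_mono)
qed

section \<open>Processes with stationary increments\<close>

text \<open>A nonnegative quadratic form has a nonpositive discriminant. Evaluating the form at \<open>a + e\<close> and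
  \<open>b + e\<close> with \<open>e > 0\<close> covers the case that \<open>a\<close> or \<open>b\<close> vanishes.\<close>

lemma discriminant_bound:
  fixes a b R :: real
  assumes "\<And>x y. 2 * x * y * R \<le> y\<^sup>2 * a\<^sup>2 + x\<^sup>2 * b\<^sup>2" "0 \<le> a" "0 \<le> b"
  shows "R \<le> a * b"
proof -
  have *: "R \<le> (a + e) * (b + e)" if "e > 0" for e
  proof -
    define x y where "x = a + e" and "y = b + e"
    have xy: "0 < x" "0 < y" "a \<le> x" "b \<le> y" using assms that by (auto simp: x_def y_def)
    have "2 * x * y * R \<le> y\<^sup>2 * a\<^sup>2 + x\<^sup>2 * b\<^sup>2" by (rule assms)
    also have "\<dots> \<le> y\<^sup>2 * x\<^sup>2 + x\<^sup>2 * y\<^sup>2"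
      using xy assms by (intro add_mono mult_left_mono power_mono) auto
    also have "\<dots> = 2 * x * y * (x * y)" by (simp add: power2_eq_square)
    finally have "R \<le> x * y" using xy by (simp add: mult_le_cancel_left_pos)
    then show ?thesis by (simp add: x_def y_def)
  qed
  have "((\<lambda>e. (a + e) * (b + e)) \<longlongrightarrow> (a + 0) * (b + 0)) (at_right 0)"
    by (intro tendsto_intros)
  then have "R \<le> (a + 0) * (b + 0)"
    by (rule tendsto_lowerbound) (use * in \<open>auto simp: eventually_at_right_less intro!: eventually_at_rightI[of 0 1]\<close>)
  then show ?thesis by simp
qed

locale gaussian_si_process = prob_space M
  for M :: "'a measure" and X :: "real \<Rightarrow> 'a \<Rightarrow> real" +
  assumes gsi: "centered_gaussian_si M X"
begin

abbreviation \<sigma> :: "real \<Rightarrow> real" where "\<sigma> \<equiv> std_dev M X"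

lemma continuous_path: "\<omega> \<in> space M \<Longrightarrow> continuous_on S (\<lambda>t. X t \<omega>)"
  using gsi unfolding centered_gaussian_si_def continuous_paths_def
  using continuous_on_subset by blast

lemma X_0 [simp]: "\<omega> \<in> space M \<Longrightarrow> X 0 \<omega> = 0"
  using gsi unfolding centered_gaussian_si_def by blast

lemma gaussian_linear_combination: "finite J \<Longrightarrow> gaussian_rv M (\<lambda>\<omega>. \<Sum>t\<in>J. a t * X t \<omega>)"
  using gsi unfolding centered_gaussian_si_def gaussian_process_def by blast

lemma gaussian_X: "gaussian_rv M (X t)"
  using gaussian_linear_combination[of "{t}" "\<lambda>_. 1"] by simp

lemma measurable_X [measurable]: "X t \<in> borel_measurable M"
  using gaussian_X unfolding gaussian_rv_def by blast

lemma expectation_X [simp]: "expectation (X t) = 0"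
  using gsi unfolding centered_gaussian_si_def centered_def by blast

lemma integrable_X [simp]: "integrable M (X t)"
  using centered_gaussian_integrable_power[OF gaussian_X expectation_X, of t 1] by simp

lemma integrable_X_square [simp]: "integrable M (\<lambda>\<omega>. (X t \<omega>)\<^sup>2)"
  using centered_gaussian_integrable_power[OF gaussian_X expectation_X] .

lemma integrable_X_prod [simp]: "integrable M (\<lambda>\<omega>. X t \<omega> * X s \<omega>)"
proof (rule Bochner_Integration.integrable_bound[of _ "\<lambda>\<omega>. (X t \<omega>)\<^sup>2 + (X s \<omega>)\<^sup>2"])
  have "\<bar>a * b\<bar> \<le> a\<^sup>2 + b\<^sup>2" for a b :: real
    using sum_squares_bound[of "\<bar>a\<bar>" "\<bar>b\<bar>"] mult_nonneg_nonneg[of "\<bar>a\<bar>" "\<bar>b\<bar>"]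
    unfolding abs_mult power2_abs by linarith
  then show "AE \<omega> in M. norm (X t \<omega> * X s \<omega>) \<le> norm ((X t \<omega>)\<^sup>2 + (X s \<omega>)\<^sup>2)"
    by (intro AE_I2) simp
qed auto

lemma \<sigma>_nonneg [simp]: "0 \<le> \<sigma> t"
  unfolding std_dev_def by simp

lemma \<sigma>_square: "(\<sigma> t)\<^sup>2 = expectation (\<lambda>\<omega>. (X t \<omega>)\<^sup>2)"
  unfolding std_dev_def by simp

lemma \<sigma>_0 [simp]: "\<sigma> 0 = 0"
proof -
  have "expectation (\<lambda>\<omega>. (X 0 \<omega>)\<^sup>2) = expectation (\<lambda>\<omega>. 0)"
    by (rule Bochner_Integration.integral_cong) auto
  then show ?thesis using \<sigma>_square[of 0] by simp
qed

text \<open>Stationarity of the increments, applied to the one-point index set \<open>{t - s}\<close> and the shift \<open>s\<close>.\<close>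

lemma variance_increment: "expectation (\<lambda>\<omega>. (X t \<omega> - X s \<omega>)\<^sup>2) = (\<sigma> (t - s))\<^sup>2"
proof -
  let ?J = "{t - s}"
  let ?P = "\<Pi>\<^sub>M t\<in>?J. (borel :: real measure)"
  have "distr M ?P (\<lambda>\<omega>. \<lambda>r\<in>?J. X (r + s) \<omega> - X s \<omega>) = distr M ?P (\<lambda>\<omega>. \<lambda>r\<in>?J. X r \<omega> - X 0 \<omega>)"
    using gsi unfolding centered_gaussian_si_def stationary_increments_def by blast
  then have "integral\<^sup>L (distr M ?P (\<lambda>\<omega>. \<lambda>r\<in>?J. X (r + s) \<omega> - X s \<omega>)) (\<lambda>x. (x (t - s))\<^sup>2) =
    integral\<^sup>L (distr M ?P (\<lambda>\<omega>. \<lambda>r\<in>?J. X r \<omega> - X 0 \<omega>)) (\<lambda>x. (x (t - s))\<^sup>2)"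
    by simp
  then have "expectation (\<lambda>\<omega>. (X t \<omega> - X s \<omega>)\<^sup>2) = expectation (\<lambda>\<omega>. (X (t - s) \<omega> - X 0 \<omega>)\<^sup>2)"
    by (subst (asm) (1 2) integral_distr) auto
  also have "\<dots> = expectation (\<lambda>\<omega>. (X (t - s) \<omega>)\<^sup>2)"
    by (rule Bochner_Integration.integral_cong) auto
  finally show ?thesis by (simp add: \<sigma>_square)
qed

lemma \<sigma>_minus [simp]: "\<sigma> (- t) = \<sigma> t"
proof -
  have "expectation (\<lambda>\<omega>. (X 0 \<omega> - X t \<omega>)\<^sup>2) = expectation (\<lambda>\<omega>. (X t \<omega>)\<^sup>2)"
    by (rule Bochner_Integration.integral_cong) auto
  then have "(\<sigma> (- t))\<^sup>2 = (\<sigma> t)\<^sup>2" using variance_increment[of 0 t] \<sigma>_square by simp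
  then show ?thesis by (simp add: power2_eq_iff_nonneg)
qed

text \<open>Polarisation: the variance function determines all covariances, hence all finite-dimensional
  distributions.\<close>

lemma expectation_X_prod:
  "expectation (\<lambda>\<omega>. X t \<omega> * X s \<omega>) = ((\<sigma> t)\<^sup>2 + (\<sigma> s)\<^sup>2 - (\<sigma> (t - s))\<^sup>2) / 2"
proof -
  have "(\<sigma> (t - s))\<^sup>2 = expectation (\<lambda>\<omega>. (X t \<omega>)\<^sup>2 + (X s \<omega>)\<^sup>2 - 2 * (X t \<omega> * X s \<omega>))"
    unfolding variance_increment[symmetric] by (simp add: power2_diff algebra_simps)
  also have "\<dots> = (\<sigma> t)\<^sup>2 + (\<sigma> s)\<^sup>2 - 2 * expectation (\<lambda>\<omega>. X t \<omega> * X s \<omega>)"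
    by (simp add: \<sigma>_square)
  finally show ?thesis by simp
qed

abbreviation excursion :: "real \<Rightarrow> real \<Rightarrow> real \<Rightarrow> 'a \<Rightarrow> bool" where
  "excursion h v l \<equiv> \<lambda>\<omega>. \<exists>t\<in>{h..h + v}. l < \<bar>X t \<omega> - X h \<omega>\<bar>"

lemma gaussian_increment: "gaussian_rv M (\<lambda>\<omega>. X t \<omega> - X s \<omega>)"
proof (cases "t = s")
  case False
  then show ?thesis
    using gaussian_linear_combination[of "{t, s}" "\<lambda>r. if r = t then 1 else -1"] by simp
qed (use gaussian_linear_combination[of "{}"] in simp)

lemma expectation_increment: "expectation (\<lambda>\<omega>. X t \<omega> - X s \<omega>) = 0"
  by simp

lemma increment_variance: "variance (\<lambda>\<omega>. X t \<omega> - X s \<omega>) = (\<sigma> (t - s))\<^sup>2"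
  by (simp add: variance_increment)

text \<open>\<open>\<sigma> (t - s)\<close> is the \<open>L\<^sup>2\<close> distance of \<open>X t\<close> and \<open>X s\<close>, so this is Minkowski's inequality for
  \<open>X t\<close> and \<open>X (- s)\<close>.\<close>

lemma \<sigma>_triangle: "\<sigma> (t + s) \<le> \<sigma> t + \<sigma> s"
proof -
  let ?U = "\<lambda>\<omega>. X t \<omega>" and ?V = "\<lambda>\<omega>. X (- s) \<omega>"
  have D: "0 \<le> expectation (\<lambda>\<omega>. (b * ?U \<omega> + a * ?V \<omega>)\<^sup>2)" for a b by simp
  have eq: "expectation (\<lambda>\<omega>. (b * ?U \<omega> + a * ?V \<omega>)\<^sup>2) =
      b\<^sup>2 * (\<sigma> t)\<^sup>2 + a\<^sup>2 * (\<sigma> s)\<^sup>2 + 2 * a * b * expectation (\<lambda>\<omega>. ?U \<omega> * ?V \<omega>)" for a b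
  proof -
    have "expectation (\<lambda>\<omega>. (b * ?U \<omega> + a * ?V \<omega>)\<^sup>2) =
       expectation (\<lambda>\<omega>. b\<^sup>2 * (?U \<omega>)\<^sup>2 + a\<^sup>2 * (?V \<omega>)\<^sup>2 + 2 * a * b * (?U \<omega> * ?V \<omega>))"
      by (rule Bochner_Integration.integral_cong) (auto simp: power2_eq_square algebra_simps)
    also have "\<dots> = b\<^sup>2 * (\<sigma> t)\<^sup>2 + a\<^sup>2 * (\<sigma> (- s))\<^sup>2 + 2 * a * b * expectation (\<lambda>\<omega>. ?U \<omega> * ?V \<omega>)"
      unfolding \<sigma>_square by simp
    finally show ?thesis by simp
  qed
  define R where "R = - expectation (\<lambda>\<omega>. ?U \<omega> * ?V \<omega>)"
  have R: "2 * a * b * R \<le> b\<^sup>2 * (\<sigma> t)\<^sup>2 + a\<^sup>2 * (\<sigma> s)\<^sup>2" for a b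
    using D[of b a] unfolding eq R_def by simp
  have "R \<le> \<sigma> t * \<sigma> s"
    by (rule discriminant_bound[OF R]) auto
  moreover have "(\<sigma> (t + s))\<^sup>2 = (\<sigma> t)\<^sup>2 + (\<sigma> s)\<^sup>2 + 2 * R"
    unfolding R_def expectation_X_prod by (simp add: field_simps)
  ultimately have "(\<sigma> (t + s))\<^sup>2 \<le> (\<sigma> t + \<sigma> s)\<^sup>2" by (simp add: power2_sum)
  then show ?thesis by (rule power2_le_imp_le) simp
qed

lemma \<sigma>_reverse_triangle: "\<bar>\<sigma> t - \<sigma> s\<bar> \<le> \<sigma> (t - s)"
  using \<sigma>_triangle[of "t - s" s] \<sigma>_triangle[of "s - t" t] \<sigma>_minus[of "t - s"] by simp

end

section \<open>Regular variation and the time scale\<close>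

locale rv_gaussian_process = gaussian_si_process +
  fixes \<alpha> :: real
  assumes local_variance: "\<exists>\<epsilon>>0. \<exists>L. ((\<lambda>t. (\<sigma> t)\<^sup>2 * \<bar>ln \<bar>t\<bar>\<bar> powr (1 + \<epsilon>)) \<longlongrightarrow> L) (at 0)"
    and \<alpha>_pos: "0 < \<alpha>" and \<alpha>_less_1: "\<alpha> < 1"
    and regular: "regularly_varying \<sigma> \<alpha>"
begin

text \<open>The factor \<open>\<bar>ln \<bar>t\<bar>\<bar> powr (1 + \<epsilon>)\<close> tends to infinity while its product with the variance stays
  bounded.\<close>

lemma \<sigma>_tendsto_0: "(\<sigma> \<longlongrightarrow> 0) (at 0)"
proof -
  obtain \<epsilon> L where e: "\<epsilon> > 0" and L: "((\<lambda>t. (\<sigma> t)\<^sup>2 * \<bar>ln \<bar>t\<bar>\<bar> powr (1 + \<epsilon>)) \<longlongrightarrow> L) (at 0)"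
    using local_variance by blast
  have "((\<lambda>t::real. \<bar>ln \<bar>t\<bar>\<bar> powr - (1 + \<epsilon>)) \<longlongrightarrow> 0) (at 0)"
    by (rule filterlim_split_at; use e in real_asymp)
  from tendsto_mult[OF L this]
  have *: "((\<lambda>t. ((\<sigma> t)\<^sup>2 * \<bar>ln \<bar>t\<bar>\<bar> powr (1 + \<epsilon>)) * \<bar>ln \<bar>t\<bar>\<bar> powr - (1 + \<epsilon>)) \<longlongrightarrow> 0) (at 0)"
    by simp
  have "\<forall>\<^sub>F t in at (0::real). t \<in> {-1<..<1} - {0}"
    by (intro eventually_at_in_open) auto
  then have "\<forall>\<^sub>F t in at 0. ((\<sigma> t)\<^sup>2 * \<bar>ln \<bar>t\<bar>\<bar> powr (1 + \<epsilon>)) * \<bar>ln \<bar>t\<bar>\<bar> powr - (1 + \<epsilon>) = (\<sigma> t)\<^sup>2"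
  proof eventually_elim
    case (elim t)
    then have "ln \<bar>t\<bar> < 0" by auto
    then have "\<bar>ln \<bar>t\<bar>\<bar> powr (1 + \<epsilon>) * \<bar>ln \<bar>t\<bar>\<bar> powr - (1 + \<epsilon>) = 1"
      by (simp flip: powr_add)
    then show ?case by (metis mult.assoc mult.right_neutral)
  qed
  with * have "((\<lambda>t. (\<sigma> t)\<^sup>2) \<longlongrightarrow> 0) (at 0)"
    by (rule Lim_transform_eventually)
  then have "((\<lambda>t. sqrt ((\<sigma> t)\<^sup>2)) \<longlongrightarrow> sqrt 0) (at 0)"
    by (rule tendsto_real_sqrt)
  then show ?thesis by simp
qed

lemma continuous_\<sigma>: "continuous_on S \<sigma>"
proof (rule continuous_at_imp_continuous_on, safe)
  fix t
  have "((\<lambda>h. \<sigma> (t + h) - \<sigma> t) \<longlongrightarrow> 0) (at 0)"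
    by (rule Lim_null_comparison[OF _ \<sigma>_tendsto_0]) (use \<sigma>_reverse_triangle[of "t + _" t] in auto)
  from tendsto_add[OF this tendsto_const[of "\<sigma> t"]]
  show "isCont \<sigma> t" unfolding isCont_iff by simp
qed

lemma scaling_limit: "((\<lambda>u. \<sigma> (u * t) / \<sigma> u) \<longlongrightarrow> \<bar>t\<bar> powr \<alpha>) at_top"
proof (cases "t = 0")
  case False
  have "((\<lambda>u. \<sigma> (\<bar>t\<bar> * u) / \<sigma> u) \<longlongrightarrow> \<bar>t\<bar> powr \<alpha>) at_top"
    using regular False unfolding regularly_varying_def by simp
  moreover have "\<sigma> (\<bar>t\<bar> * u) = \<sigma> (u * t)" for u
    using \<sigma>_minus[of "u * t"] by (cases "t \<ge> 0") (simp_all add: mult.commute)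
  ultimately show ?thesis by simp
qed (use \<alpha>_pos in simp)

text \<open>Potter's bounds for the factor 2 are the definition of regular variation at \<open>t = 2\<close>. Every
  comparison of scales below goes through repeated doubling, that is, through iterates of these two
  inequalities.\<close>

lemma dyadic_potter_bounds:
  assumes "g < \<alpha>" "\<alpha> < g'"
  obtains x0 where "x0 > 0" "\<And>x. x \<ge> x0 \<Longrightarrow> 0 < \<sigma> x"
    "\<And>x. x \<ge> x0 \<Longrightarrow> 2 powr g * \<sigma> x \<le> \<sigma> (2 * x)" "\<And>x. x \<ge> x0 \<Longrightarrow> \<sigma> (2 * x) \<le> 2 powr g' * \<sigma> x"
proof -
  have L: "((\<lambda>u. \<sigma> (u * 2) / \<sigma> u) \<longlongrightarrow> 2 powr \<alpha>) at_top" using scaling_limit[of 2] by simp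
  have "\<forall>\<^sub>F u in at_top. 2 powr g < \<sigma> (u * 2) / \<sigma> u \<and> \<sigma> (u * 2) / \<sigma> u < 2 powr g'"
    by (intro eventually_conj order_tendstoD[OF L]) (use assms in auto)
  then obtain x1 where x1: "\<And>u. u \<ge> x1 \<Longrightarrow> 2 powr g < \<sigma> (u * 2) / \<sigma> u \<and> \<sigma> (u * 2) / \<sigma> u < 2 powr g'"
    unfolding eventually_at_top_linorder by blast
  have pos: "0 < \<sigma> u" if "u \<ge> x1" for u
  proof -
    have "0 < \<sigma> (u * 2) / \<sigma> u" using x1[OF that] by (smt (verit) powr_gt_zero)
    then show ?thesis using \<sigma>_nonneg[of u] by (metis div_by_0 less_eq_real_def less_irrefl)
  qed
  show ?thesis
  proof (rule that[of "max 1 x1"])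
    fix x assume x: "x \<ge> max 1 x1"
    show "0 < \<sigma> x" using pos x by simp
    show "2 powr g * \<sigma> x \<le> \<sigma> (2 * x)" "\<sigma> (2 * x) \<le> 2 powr g' * \<sigma> x"
      using x1[of x] pos[of x] x by (simp_all add: field_simps)
  qed simp
qed

lemma \<sigma>_power2_le: "\<sigma> (2 ^ n * x) \<le> 2 ^ n * \<sigma> x"
proof (induction n)
  case (Suc n)
  have "\<sigma> (2 ^ Suc n * x) \<le> \<sigma> (2 ^ n * x) + \<sigma> (2 ^ n * x)"
    using \<sigma>_triangle[of "2 ^ n * x" "2 ^ n * x"] by (simp add: mult_ac)
  with Suc show ?case by simp
qed simp

lemma dyadic_scale:
  fixes x a :: real
  assumes "0 < a" "a \<le> x"
  obtains n :: nat and w where "x = 2 ^ n * w" "a \<le> w" "w \<le> 2 * a"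
proof -
  define n where "n = nat \<lfloor>log 2 (x / a)\<rfloor>"
  have l: "0 \<le> log 2 (x / a)" using assms by simp
  then have n: "real n \<le> log 2 (x / a)" "log 2 (x / a) < real n + 1" unfolding n_def by linarith+
  have "2 powr real n \<le> x / a" using n(1) assms by (simp add: le_log_iff)
  moreover have "x / a < 2 powr (real n + 1)" using n(2) assms by (simp add: log_less_iff)
  ultimately have "2 ^ n * a \<le> x" "x \<le> 2 ^ n * (2 * a)"
    using assms by (simp_all add: powr_realpow powr_add field_simps)
  then show ?thesis using assms
    by (intro that[of n "x / 2 ^ n"]) (auto simp: field_simps)
qed

text \<open>By subadditivity a zero of \<open>\<sigma>\<close> at \<open>x > 0\<close> would propagate to all \<open>2 ^ n * x\<close>, whereas regular
  variation forces \<open>\<sigma>\<close> to be positive near infinity.\<close>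

lemma \<sigma>_pos: "0 < x \<Longrightarrow> 0 < \<sigma> x"
proof -
  assume x: "0 < x"
  obtain x0 where x0: "x0 > 0" "\<And>x. x \<ge> x0 \<Longrightarrow> 0 < \<sigma> x"
    by (rule dyadic_potter_bounds[of "\<alpha> - 1" "\<alpha> + 1"]; simp)
  obtain n where "x0 / x < 2 ^ n" using real_arch_pow[of 2 "x0 / x"] by auto
  then have "0 < \<sigma> (2 ^ n * x)" using x by (intro x0) (simp add: field_simps)
  also have "\<dots> \<le> 2 ^ n * \<sigma> x" by (rule \<sigma>_power2_le)
  finally show ?thesis by (simp add: zero_less_mult_iff)
qed

lemma \<sigma>_min:
  assumes "0 < a" "a \<le> b"
  obtains m where "m > 0" "\<And>x. a \<le> x \<Longrightarrow> x \<le> b \<Longrightarrow> m \<le> \<sigma> x"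
proof -
  obtain z where "z \<in> {a..b}" "\<And>x. x \<in> {a..b} \<Longrightarrow> \<sigma> z \<le> \<sigma> x"
    using continuous_attains_inf[OF compact_Icc _ continuous_\<sigma>, of a b] assms by auto
  then show ?thesis using assms by (intro that[of "\<sigma> z"] \<sigma>_pos) auto
qed

text \<open>Iterating the upper doubling bound with an exponent \<open>g\<close> strictly between \<open>\<alpha>\<close> and 1.\<close>

lemma \<sigma>_sublinear: "((\<lambda>x. \<sigma> x / x) \<longlongrightarrow> 0) at_top"
proof -
  define g where "g = (\<alpha> + 1) / 2"
  have g: "0 < g" "\<alpha> < g" "g < 1" using \<alpha>_less_1 \<alpha>_pos by (auto simp: g_def field_simps)
  obtain x0 where x0: "x0 > 0" and up: "\<And>x. x \<ge> x0 \<Longrightarrow> \<sigma> (2 * x) \<le> 2 powr g * \<sigma> x"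
    by (rule dyadic_potter_bounds[of "\<alpha> - 1" g]; use g in simp)
  have "{x0..2 * x0} \<noteq> {}" using x0 by simp
  then obtain z where z: "\<And>x. x \<in> {x0..2 * x0} \<Longrightarrow> \<sigma> x \<le> \<sigma> z"
    using continuous_attains_sup[OF compact_Icc _ continuous_\<sigma>] by metis
  have pw: "\<sigma> (2 ^ n * w) \<le> (2 ^ n) powr g * \<sigma> w" if "w \<ge> x0" for n w
  proof (induction n)
    case (Suc n)
    have "1 * x0 \<le> 2 ^ n * w" using that x0 by (intro mult_mono) auto
    then have "\<sigma> (2 * (2 ^ n * w)) \<le> 2 powr g * \<sigma> (2 ^ n * w)" by (intro up) auto
    also have "\<dots> \<le> 2 powr g * ((2 ^ n) powr g * \<sigma> w)" using Suc by (intro mult_left_mono) auto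
    finally show ?case by (simp add: powr_mult mult_ac)
  qed simp
  have "\<sigma> x / x \<le> \<sigma> z / x0 powr g * x powr (g - 1)" if x: "x \<ge> x0" for x
  proof -
    obtain n :: nat and w where w: "x = 2 ^ n * w" "x0 \<le> w" "w \<le> 2 * x0"
      using dyadic_scale[OF x0 x] .
    have "\<sigma> x \<le> (2 ^ n) powr g * \<sigma> w" using pw w by simp
    also have "\<dots> \<le> (x / x0) powr g * \<sigma> z"
    proof (intro mult_mono powr_mono2)
      have "2 ^ n * x0 \<le> 2 ^ n * w" using w by simp
      then show "2 ^ n \<le> x / x0" using w x0 by (simp add: field_simps)
    qed (use g w z x0 in auto)
    also have "\<dots> = \<sigma> z / x0 powr g * x powr (g - 1) * x"
      using x0 x by (simp add: powr_divide powr_diff)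
    finally show ?thesis using x x0 by (simp add: field_simps)
  qed
  then have "\<forall>\<^sub>F x in at_top. norm (\<sigma> x / x) \<le> \<sigma> z / x0 powr g * x powr (g - 1)"
    unfolding eventually_at_top_linorder using x0 by (intro exI[of _ x0]) auto
  moreover have "((\<lambda>x::real. x powr (g - 1)) \<longlongrightarrow> 0) at_top"
    using g by real_asymp
  then have "((\<lambda>x. \<sigma> z / x0 powr g * x powr (g - 1)) \<longlongrightarrow> 0) at_top"
    by (rule tendsto_mult_right_zero)
  ultimately show ?thesis by (rule Lim_null_comparison)
qed

text \<open>Doubling \<open>x \<in> (0, A]\<close> until it enters \<open>[A, 2 * A]\<close> cannot increase \<open>\<sigma> x / x\<close>, so this quotient is
  bounded below on \<open>(0, A]\<close>. For small \<open>c\<close> the solutions of \<open>\<sigma> x = c * x\<close> therefore lie beyond \<open>A\<close>.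
  There they form a closed set, nonempty because \<open>\<sigma> x / x\<close> is continuous and tends to 0, and the
  infimum is attained. Letting \<open>A\<close> grow shows that the time scale tends to infinity as \<open>c\<close> tends
  to 0.\<close>

lemma time_scale_properties:
  assumes A: "0 < A"
  shows "\<exists>c0>0. \<forall>c. 0 < c \<longrightarrow> c < c0 \<longrightarrow> A \<le> time_scale \<sigma> c \<and> c * time_scale \<sigma> c = \<sigma> (time_scale \<sigma> c)"
proof -
  obtain m where m: "m > 0" "\<And>x. A \<le> x \<Longrightarrow> x \<le> 2 * A \<Longrightarrow> m \<le> \<sigma> x"
    by (rule \<sigma>_min[of A "2 * A"]; use A in simp)
  have low: "m / (2 * A) \<le> \<sigma> x / x" if x: "0 < x" "x \<le> A" for x
  proof -
    obtain n :: nat and w where w: "A / x = 2 ^ n * w" "1 \<le> w" "w \<le> 2 * 1"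
      using dyadic_scale[of 1 "A / x"] x by auto
    have y: "A \<le> 2 ^ Suc n * x" "2 ^ Suc n * x \<le> 2 * A"
    proof -
      have "A = 2 ^ n * w * x" using w(1) x by (simp add: field_simps)
      moreover have "2 ^ n * x * w \<le> 2 ^ n * x * 2" "2 ^ n * x * 1 \<le> 2 ^ n * x * w"
        using w x by (auto intro!: mult_left_mono)
      ultimately show "A \<le> 2 ^ Suc n * x" "2 ^ Suc n * x \<le> 2 * A" by (simp_all add: mult_ac)
    qed
    have "m \<le> \<sigma> (2 ^ Suc n * x)" using m y by blast
    also have "\<dots> \<le> 2 ^ Suc n * \<sigma> x" by (rule \<sigma>_power2_le)
    also have "\<dots> = 2 ^ Suc n * x * (\<sigma> x / x)" using x by simp
    also have "\<dots> \<le> 2 * A * (\<sigma> x / x)" using y x by (intro mult_right_mono) auto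
    finally show ?thesis using A by (simp add: field_simps)
  qed
  have "A \<le> time_scale \<sigma> c \<and> c * time_scale \<sigma> c = \<sigma> (time_scale \<sigma> c)" if c: "0 < c" "c < m / (2 * A)" for c
  proof -
    let ?S = "{x. x > 0 \<and> x / \<sigma> x = 1 / c}"
    have S: "?S = {A..} \<inter> {x. \<sigma> x = c * x}"
    proof (intro set_eqI iffI)
      fix x assume "x \<in> ?S"
      then have x: "0 < x" "x / \<sigma> x = 1 / c" by auto
      then have e: "\<sigma> x = c * x" using \<sigma>_pos[of x] c by (simp add: field_simps)
      moreover have "\<not> x \<le> A" using low[of x] x c e by auto
      ultimately show "x \<in> {A..} \<inter> {x. \<sigma> x = c * x}" by simp
    next
      fix x assume "x \<in> {A..} \<inter> {x. \<sigma> x = c * x}"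
      then show "x \<in> ?S" using A c by auto
    qed
    have cl: "closed ?S"
      unfolding S by (intro closed_Int closed_atLeast closed_Collect_eq continuous_\<sigma> continuous_intros)
    have bd: "bdd_below ?S" unfolding S by (intro bdd_belowI[of _ A]) auto
    have "\<forall>\<^sub>F x in at_top. \<sigma> x / x < c" using order_tendstoD(2)[OF \<sigma>_sublinear] c by simp
    then have "\<forall>\<^sub>F x in at_top. \<sigma> x / x < c \<and> A \<le> x" using eventually_ge_at_top by (rule eventually_conj)
    then obtain b where b: "\<sigma> b / b < c" "A \<le> b" using eventually_happens'[OF trivial_limit_at_top_linorder] by blast
    have "\<exists>x. A \<le> x \<and> x \<le> b \<and> \<sigma> x / x = c"
      by (rule IVT2') (use b c low[of A] A in \<open>auto intro!: continuous_intros continuous_\<sigma>\<close>)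
    then have ne: "?S \<noteq> {}" unfolding S using A by (auto simp: field_simps)
    have "Inf ?S \<in> ?S" using closed_contains_Inf[OF ne bd cl] .
    then have "Inf ?S \<in> {A..} \<inter> {x. \<sigma> x = c * x}" unfolding S .
    then show ?thesis unfolding time_scale_def by auto
  qed
  then show ?thesis using m A by (intro exI[of _ "m / (2 * A)"]) auto
qed

end

section \<open>Chaining at small scales\<close>

context gaussian_si_process
begin

lemma increment_tail:
  assumes "(\<sigma> (t - s))\<^sup>2 \<le> S" "0 < S" "0 \<le> x"
  shows "outer_prob_le M (\<lambda>\<omega>. x < \<bar>X t \<omega> - X s \<omega>\<bar>) (2 * exp (- (x\<^sup>2 / (2 * S))))"
  using centered_gaussian_tail[OF gaussian_increment expectation_increment, of t s S x, unfolded increment_variance] assms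
  by simp

lemma increment_power_tail:
  assumes "(\<sigma> (t - s))\<^sup>2 \<le> S" "0 < S" "0 < x"
  shows "outer_prob_le M (\<lambda>\<omega>. x < \<bar>X t \<omega> - X s \<omega>\<bar>) (2 * fact q * 2 ^ q * S ^ q / x ^ (2 * q))"
  using centered_gaussian_power_tail[OF gaussian_increment expectation_increment, of t s S x q, unfolded increment_variance] assms
  by simp

text \<open>The pathwise part of the chaining argument. The grid of level \<open>k\<close> has \<open>2 ^ 2 ^ k\<close> points; each point
  of level \<open>k + 1\<close> is linked to its left neighbour of level \<open>k\<close>, with index \<open>j div 2 ^ 2 ^ k\<close>. The link
  bounds add up along every chain, and the grid points approach every \<open>t\<close> in the interval.\<close>

lemma chaining_step:
  fixes x :: "nat \<Rightarrow> real"
  assumes b: "0 < b" and x: "\<And>k. 0 \<le> x k" "\<And>k. (\<Sum>i<k. x i) \<le> l / 2"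
    and w: "\<omega> \<in> space M"
    and first: "\<bar>X (h + b / 2) \<omega> - X h \<omega>\<bar> \<le> l / 2"
    and links: "\<And>k j. j < 2 ^ 2 ^ Suc k \<Longrightarrow>
      \<bar>X (h + b * real j / 2 ^ 2 ^ Suc k) \<omega> - X (h + b * real (j div 2 ^ 2 ^ k) / 2 ^ 2 ^ k) \<omega>\<bar> \<le> x k"
    and t: "t \<in> {h..h + b}"
  shows "\<bar>X t \<omega> - X h \<omega>\<bar> \<le> l"
proof -
  define pt where "pt k j = h + b * real j / 2 ^ 2 ^ k" for k j :: nat
  have l: "0 \<le> l" using x(2)[of 0] by simp
  have grid: "\<bar>X (pt k j) \<omega> - X h \<omega>\<bar> \<le> l / 2 + (\<Sum>i<k. x i)" if "j < 2 ^ 2 ^ k" for k j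
    using that
  proof (induction k arbitrary: j)
    case 0
    then have "j = 0 \<or> j = 1" by auto
    then show ?case using first l by (auto simp: pt_def)
  next
    case (Suc k)
    have "j < 2 ^ 2 ^ k * 2 ^ 2 ^ k" using Suc.prems by (simp add: power_add[symmetric] mult_2)
    then have "j div 2 ^ 2 ^ k < 2 ^ 2 ^ k" by (simp add: less_mult_imp_div_less)
    from Suc.IH[OF this] links[OF Suc.prems] show ?case
      unfolding pt_def by simp
  qed
  \<comment> \<open>Rounding up and subtracting one, instead of rounding down, keeps the index in range for \<open>t = h + b\<close>.\<close>
  define j where "j k = nat (\<lceil>(t - h) * 2 ^ 2 ^ k / b\<rceil> - 1)" for k :: nat
  have j: "j k < 2 ^ 2 ^ k" "\<bar>pt k (j k) - t\<bar> \<le> b / 2 ^ 2 ^ k" for k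
  proof -
    let ?N = "2 ^ 2 ^ k :: real"
    let ?y = "(t - h) * ?N / b"
    have "(t - h) / b * ?N \<le> 1 * ?N" using t b by (intro mult_right_mono) auto
    then have y: "0 \<le> ?y" "?y \<le> ?N" using t b by auto
    have c: "\<lceil>?y\<rceil> \<le> 2 ^ 2 ^ k" using y(2) by (simp add: ceiling_le_iff)
    have N: "0 < ?N" by simp
    show "j k < 2 ^ 2 ^ k"
    proof -
      have "int (j k) < 2 ^ 2 ^ k" unfolding j_def using c by auto
      then show ?thesis by (metis of_nat_less_numeral_power_cancel_iff)
    qed
    have "\<bar>real (j k) - ?y\<bar> \<le> 1" using y(1) unfolding j_def by linarith
    then have "\<bar>real (j k) - ?y\<bar> * (b / ?N) \<le> 1 * (b / ?N)"
      using b by (intro mult_right_mono) auto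
    moreover have "(real (j k) - ?y) * (b / ?N) = pt k (j k) - t"
      using b N unfolding pt_def by (simp add: field_simps)
    moreover have "0 < b / ?N" using b by simp
    ultimately have "\<bar>pt k (j k) - t\<bar> \<le> b / ?N"
      by (metis abs_mult abs_of_pos mult_1)
    then show "\<bar>pt k (j k) - t\<bar> \<le> b / 2 ^ 2 ^ k" .
  qed
  have lim: "(\<lambda>k. pt k (j k)) \<longlonglongrightarrow> t"
  proof (rule LIM_zero_cancel, rule Lim_null_comparison)
    show "\<forall>\<^sub>F k in sequentially. norm (pt k (j k) - t) \<le> b * (1 / 2) ^ k"
    proof (intro always_eventually allI)
      fix k
      have "b / 2 ^ 2 ^ k \<le> b / 2 ^ k"
        by (intro divide_left_mono power_increasing) (use b in \<open>auto intro: less_imp_le[OF less_exp]\<close>)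
      with j(2)[of k] show "norm (pt k (j k) - t) \<le> b * (1 / 2) ^ k"
        by (simp add: power_divide)
    qed
    show "(\<lambda>k. b * (1 / 2) ^ k) \<longlonglongrightarrow> 0"
      by (intro tendsto_mult_right_zero LIMSEQ_realpow_zero) auto
  qed
  have "(\<lambda>k. X (pt k (j k)) \<omega>) \<longlonglongrightarrow> X t \<omega>"
    using continuous_on_tendsto_compose[OF continuous_path[OF w, of UNIV] lim] by simp
  then have "(\<lambda>k. \<bar>X (pt k (j k)) \<omega> - X h \<omega>\<bar>) \<longlonglongrightarrow> \<bar>X t \<omega> - X h \<omega>\<bar>"
    by (intro tendsto_intros)
  moreover have "\<bar>X (pt k (j k)) \<omega> - X h \<omega>\<bar> \<le> l" for k
    using grid[OF j(1)[of k]] x(2)[of k] by simp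
  ultimately show ?thesis by (intro LIMSEQ_le_const2) auto
qed

end

context rv_gaussian_process
begin

text \<open>The logarithmic condition on the variance, read off at the meshes \<open>b / 2 ^ 2 ^ k\<close>, where the
  logarithm is of order \<open>2 ^ k\<close>. The exponent \<open>1 + \<epsilon>\<close> gives the rate \<open>r = 2 powr (1 + \<epsilon>) > 2\<close>.\<close>

lemma small_scale_variance:
  obtains b r K where "0 < b" "2 < r" "0 < K"
    "\<And>y k. 0 \<le> y \<Longrightarrow> y \<le> b / 2 ^ 2 ^ k \<Longrightarrow> (\<sigma> y)\<^sup>2 \<le> K / r ^ k"
proof -
  obtain \<epsilon> L where e: "\<epsilon> > 0" and L: "((\<lambda>t. (\<sigma> t)\<^sup>2 * \<bar>ln \<bar>t\<bar>\<bar> powr (1 + \<epsilon>)) \<longlongrightarrow> L) (at 0)"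
    using local_variance by blast
  have "\<forall>\<^sub>F t in at 0. (\<sigma> t)\<^sup>2 * \<bar>ln \<bar>t\<bar>\<bar> powr (1 + \<epsilon>) < \<bar>L\<bar> + 1"
    by (rule order_tendstoD(2)[OF L]) linarith
  then obtain d where d: "d > 0" "\<And>t. t \<noteq> 0 \<Longrightarrow> \<bar>t\<bar> < d \<Longrightarrow> (\<sigma> t)\<^sup>2 * \<bar>ln \<bar>t\<bar>\<bar> powr (1 + \<epsilon>) < \<bar>L\<bar> + 1"
    unfolding eventually_at by (auto simp: dist_real_def)
  define b where "b = min (1/2) (d / 2)"
  have b: "0 < b" "b \<le> 1/2" "b < d" using d by (auto simp: b_def min_def)
  define r where "r = 2 powr (1 + \<epsilon>)"
  have r: "2 < r" unfolding r_def using e powr_less_mono[of 1 "1 + \<epsilon>" 2] by simp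
  define K where "K = (\<bar>L\<bar> + 1) / (ln 2) powr (1 + \<epsilon>)"
  have K: "0 < K" unfolding K_def by (intro divide_pos_pos) (auto simp: powr_gt_zero)
  have var: "(\<sigma> y)\<^sup>2 \<le> K / r ^ k" if y: "0 \<le> y" "y \<le> b / 2 ^ 2 ^ k" for y k
  proof (cases "y = 0")
    case False
    have "b / 2 ^ 2 ^ k \<le> 1 / 2 ^ 2 ^ k" using b by (intro divide_right_mono) auto
    with y(2) have y_le: "y \<le> 1 / 2 ^ 2 ^ k" by linarith
    have "b / 2 ^ 2 ^ k \<le> b / 1" using b by (intro divide_left_mono) auto
    then have y': "0 < y" "y \<le> b" using y False by auto
    have "ln y \<le> ln (1 / 2 ^ 2 ^ k)" using y_le y' by simp
    also have "\<dots> = - (2 ^ k * ln 2)" by (simp add: ln_div ln_realpow)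
    finally have "2 ^ k * ln 2 \<le> \<bar>ln y\<bar>" by simp
    then have "(2 ^ k * ln 2) powr (1 + \<epsilon>) \<le> \<bar>ln y\<bar> powr (1 + \<epsilon>)"
      using e by (intro powr_mono2) auto
    moreover have "(2 ^ k * ln 2) powr (1 + \<epsilon>) = r ^ k * (ln 2) powr (1 + \<epsilon>)"
      unfolding r_def by (simp add: powr_mult powr_power powr_realpow[symmetric] powr_powr mult.commute)
    ultimately have "(\<sigma> y)\<^sup>2 * (r ^ k * (ln 2) powr (1 + \<epsilon>)) \<le> (\<sigma> y)\<^sup>2 * \<bar>ln \<bar>y\<bar>\<bar> powr (1 + \<epsilon>)"
      using y' by (intro mult_left_mono) auto
    also have "\<dots> \<le> \<bar>L\<bar> + 1" using d(2)[of y] y' b by simp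
    finally have "(\<sigma> y)\<^sup>2 * (r ^ k * (ln 2) powr (1 + \<epsilon>)) \<le> \<bar>L\<bar> + 1" .
    then show ?thesis unfolding K_def using r by (simp add: field_simps)
  qed (use K r in simp)
  show ?thesis by (rule that[OF b(1) r K var])
qed

text \<open>Along the grids of \<open>2 ^ 2 ^ k\<close> points the logarithm of the number of links doubles at each level,
  while the variance of a link decays like \<open>r ^ k\<close> with \<open>r > 2\<close>. Allowing a link of level \<open>k\<close> the size
  \<open>l * (1 - \<rho>) * \<rho> ^ k / 2\<close> with \<open>\<rho> < 1\<close> keeps the total below \<open>l / 2\<close>, and \<open>\<rho>\<^sup>2 * r = 2\<close> makes the
  exponent in the Gaussian bound \<open>A * l\<^sup>2 * 2 ^ k\<close>, which dominates the \<open>2 ^ Suc k * ln 2\<close> of the union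
  bound once \<open>l\<close> is large. Doubling the number of points at each level would instead leave link
  sizes that are not summable for small \<open>\<epsilon>\<close>.\<close>

lemma small_interval_tail:
  obtains b \<kappa> l0 where "0 < b" "0 < \<kappa>" "0 < l0"
    "\<And>h l. l \<ge> l0 \<Longrightarrow> outer_prob_le M (excursion h b l) (6 * exp (- (\<kappa> * l\<^sup>2)))"
proof -
  obtain b r K where b: "0 < b" and r: "2 < r" and K: "0 < K"
    and var: "\<And>y k. 0 \<le> y \<Longrightarrow> y \<le> b / 2 ^ 2 ^ k \<Longrightarrow> (\<sigma> y)\<^sup>2 \<le> K / r ^ k"
    by (rule small_scale_variance) (rule that; assumption)
  define \<rho> where "\<rho> = sqrt (2 / r)"
  have \<rho>: "0 < \<rho>" "\<rho> < 1" "\<rho>\<^sup>2 * r = 2" using r by (auto simp: \<rho>_def)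
  define A where "A = (1 - \<rho>)\<^sup>2 / (8 * K)"
  have A: "0 < A" using K \<rho> by (simp add: A_def)
  define l0 where "l0 = sqrt (4 / A)"
  have l0: "0 < l0" using A by (simp add: l0_def)
  show ?thesis
  proof (rule that[of b "A / 2" l0])
    fix h l assume l: "l \<ge> l0"
    then have "l0\<^sup>2 \<le> l\<^sup>2" using l0 by (intro power_mono) auto
    then have Al: "4 \<le> A * l\<^sup>2" using A by (simp add: l0_def field_simps)
    have lp: "0 < l" using l l0 by simp
    define x where "x k = l * (1 - \<rho>) * \<rho> ^ k / 2" for k :: nat
    have x: "0 \<le> x k" for k using lp \<rho> by (simp add: x_def)
    have xs: "(\<Sum>i<k. x i) \<le> l / 2" for k
    proof -
      have "(\<Sum>i<k. x i) = l / 2 * ((1 - \<rho>) * (\<Sum>i<k. \<rho> ^ i))"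
        unfolding x_def by (simp add: sum_distrib_left mult_ac)
      also have "(1 - \<rho>) * (\<Sum>i<k. \<rho> ^ i) = 1 - \<rho> ^ k" by (simp add: one_diff_power_eq)
      also have "l / 2 * (1 - \<rho> ^ k) \<le> l / 2 * 1" using lp \<rho> by (intro mult_left_mono) auto
      finally show ?thesis by simp
    qed
    define z where "z = exp (- (A * l\<^sup>2 / 2))"
    have z: "0 < z" "z \<le> 1 / 2"
    proof -
      have "z \<le> exp (- 1)" unfolding z_def using Al by simp
      also have "\<dots> \<le> 1 / 2" using exp_ge_add_one_self[of 1] by (simp add: exp_minus field_simps)
      finally show "z \<le> 1 / 2" .
    qed (simp add: z_def)
    let ?link = "\<lambda>k j \<omega>. x k < \<bar>X (h + b * real j / 2 ^ 2 ^ Suc k) \<omega> - X (h + b * real (j div 2 ^ 2 ^ k) / 2 ^ 2 ^ k) \<omega>\<bar>"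
    have level: "outer_prob_le M (\<lambda>\<omega>. \<exists>j\<in>{..<2 ^ 2 ^ Suc k}. ?link k j \<omega>) (2 * z * (1/2) ^ k)" for k
    proof -
      have "outer_prob_le M (?link k j) (2 * exp (- ((x k)\<^sup>2 / (2 * (K / r ^ k)))))" for j
      proof (rule increment_tail)
        have sq: "(2::nat) ^ 2 ^ Suc k = 2 ^ 2 ^ k * 2 ^ 2 ^ k" by (simp add: power_add[symmetric] mult_2)
        have sq': "(2::real) ^ 2 ^ Suc k = 2 ^ 2 ^ k * 2 ^ 2 ^ k" by (simp add: power_add[symmetric] mult_2)
        define q where "q = j div 2 ^ 2 ^ k"
        define s where "s = j mod 2 ^ 2 ^ k"
        have j: "real j = 2 ^ 2 ^ k * real q + real s"
        proof -
          have "j = 2 ^ 2 ^ k * q + s" unfolding q_def s_def by simp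
          then have "real j = real (2 ^ 2 ^ k * q + s)" by (rule arg_cong)
          then show ?thesis unfolding of_nat_add of_nat_mult of_nat_power of_nat_numeral .
        qed
        have "s < 2 ^ 2 ^ k" by (simp add: s_def)
        then have s: "real s \<le> 2 ^ 2 ^ k" by (intro less_imp_le) simp
        have "h + b * real j / 2 ^ 2 ^ Suc k - (h + b * real q / 2 ^ 2 ^ k) = b * real s / (2 ^ 2 ^ k * 2 ^ 2 ^ k)"
          unfolding sq' j by (simp add: field_simps)
        also have "(\<sigma> (b * real s / (2 ^ 2 ^ k * 2 ^ 2 ^ k)))\<^sup>2 \<le> K / r ^ k"
        proof (rule var)
          have "b * real s / (2 ^ 2 ^ k * 2 ^ 2 ^ k) \<le> b * 2 ^ 2 ^ k / (2 ^ 2 ^ k * 2 ^ 2 ^ k)"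
            using s b by (intro divide_right_mono mult_left_mono) auto
          then show "b * real s / (2 ^ 2 ^ k * 2 ^ 2 ^ k) \<le> b / 2 ^ 2 ^ k" by simp
        qed (use b in auto)
        finally show "(\<sigma> (h + b * real j / 2 ^ 2 ^ Suc k - (h + b * real (j div 2 ^ 2 ^ k) / 2 ^ 2 ^ k)))\<^sup>2 \<le> K / r ^ k"
          unfolding q_def .
      qed (use K r x in auto)
      then have *: "outer_prob_le M (\<lambda>\<omega>. \<exists>j\<in>{..<2 ^ 2 ^ Suc k}. ?link k j \<omega>)
          (\<Sum>j\<in>{..<2 ^ 2 ^ Suc k :: nat}. 2 * exp (- ((x k)\<^sup>2 / (2 * (K / r ^ k)))))"
        by (intro outer_prob_le_UN_finite) auto
      have ex: "(x k)\<^sup>2 / (2 * (K / r ^ k)) = A * l\<^sup>2 * 2 ^ k"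
      proof -
        have xk: "(x k)\<^sup>2 = (l\<^sup>2 * (1 - \<rho>)\<^sup>2) * (\<rho>\<^sup>2) ^ k / 4"
          unfolding x_def power_divide power_mult_distrib by (simp add: power_mult[symmetric] mult.commute[of k])
        have "(x k)\<^sup>2 / (2 * (K / r ^ k)) = (l\<^sup>2 * (1 - \<rho>)\<^sup>2 / (8 * K)) * ((\<rho>\<^sup>2) ^ k * r ^ k)"
          unfolding xk using r K by (simp add: field_simps)
        also have "(\<rho>\<^sup>2) ^ k * r ^ k = 2 ^ k" using \<rho>(3) by (simp flip: power_mult_distrib)
        finally show ?thesis by (simp add: A_def)
      qed
      have "(2::real) ^ 2 ^ Suc k \<le> exp 1 ^ 2 ^ Suc k"
        using exp_ge_add_one_self[of 1] by (intro power_mono) auto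
      also have "\<dots> = exp (2 * 2 ^ k)" by (simp flip: exp_of_nat_mult)
      finally have two: "(2::real) ^ 2 ^ Suc k \<le> exp (2 * 2 ^ k)" .
      have "(\<Sum>j\<in>{..<2 ^ 2 ^ Suc k :: nat}. 2 * exp (- ((x k)\<^sup>2 / (2 * (K / r ^ k))))) = 2 * (2 ^ 2 ^ Suc k * exp (- (A * l\<^sup>2 * 2 ^ k)))"
        unfolding ex by simp
      also have "\<dots> \<le> 2 * (exp (2 * 2 ^ k) * exp (- (A * l\<^sup>2 * 2 ^ k)))"
        using two by (intro mult_left_mono mult_right_mono) auto
      also have "exp (2 * 2 ^ k) * exp (- (A * l\<^sup>2 * 2 ^ k)) = exp (- ((A * l\<^sup>2 - 2) * 2 ^ k))"
        by (simp add: exp_add[symmetric] algebra_simps)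
      also have "\<dots> \<le> exp (- ((A * l\<^sup>2 / 2) * (real k + 1)))"
      proof -
        have "Suc k \<le> 2 ^ k" using less_exp[of k] by (rule Suc_leI)
        then have "real (Suc k) \<le> real (2 ^ k)" by (rule of_nat_mono)
        then have "real k + 1 \<le> 2 ^ k" by (simp add: add.commute)
        then have "(A * l\<^sup>2 / 2) * (real k + 1) \<le> (A * l\<^sup>2 - 2) * 2 ^ k"
          using Al by (intro mult_mono) auto
        then show ?thesis by simp
      qed
      also have "\<dots> = z * z ^ k" unfolding z_def by (simp add: exp_of_nat_mult[symmetric] exp_add[symmetric] algebra_simps)
      also have "2 * (z * z ^ k) \<le> 2 * (z * (1/2) ^ k)"
        using z by (intro mult_left_mono power_mono) auto
      finally show ?thesis using * by (auto elim!: outer_prob_le_mono simp: mult_ac)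
    qed
    have links: "outer_prob_le M (\<lambda>\<omega>. \<exists>k. \<exists>j\<in>{..<2 ^ 2 ^ Suc k}. ?link k j \<omega>) (\<Sum>k. 2 * z * (1/2) ^ k)"
      by (rule outer_prob_le_UN[OF level]) (intro summable_mult summable_geometric, simp)
    have "(\<Sum>k. 2 * z * (1/2) ^ k) = 4 * z"
      by (subst suminf_mult) (auto simp: suminf_geometric)
    with links have links: "outer_prob_le M (\<lambda>\<omega>. \<exists>k. \<exists>j\<in>{..<2 ^ 2 ^ Suc k}. ?link k j \<omega>) (4 * z)" by simp
    have "outer_prob_le M (\<lambda>\<omega>. l / 2 < \<bar>X (h + b / 2) \<omega> - X h \<omega>\<bar>) (2 * exp (- ((l / 2)\<^sup>2 / (2 * K))))"
      by (rule increment_tail) (use var[of "b / 2" 0] b K lp in auto)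
    moreover have "2 * exp (- ((l / 2)\<^sup>2 / (2 * K))) \<le> 2 * z"
    proof -
      have "(1 - \<rho>)\<^sup>2 \<le> 1\<^sup>2" using \<rho> by (intro power_mono) auto
      then have "(1 - \<rho>)\<^sup>2 * l\<^sup>2 \<le> 2 * l\<^sup>2" by (intro mult_right_mono) auto
      then have "A * l\<^sup>2 / 2 \<le> (l / 2)\<^sup>2 / (2 * K)" unfolding A_def using K by (simp add: power_divide field_simps)
      then show ?thesis unfolding z_def by simp
    qed
    ultimately have first: "outer_prob_le M (\<lambda>\<omega>. l / 2 < \<bar>X (h + b / 2) \<omega> - X h \<omega>\<bar>) (2 * z)"
      by (auto elim: outer_prob_le_mono)
    from outer_prob_le_disj[OF links first]
    show "outer_prob_le M (excursion h b l) (6 * exp (- (A / 2 * l\<^sup>2)))"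
    proof (rule outer_prob_le_mono)
      fix \<omega> assume w: "\<omega> \<in> space M" "\<exists>t\<in>{h..h + b}. l < \<bar>X t \<omega> - X h \<omega>\<bar>"
      show "(\<exists>k. \<exists>j\<in>{..<2 ^ 2 ^ Suc k}. ?link k j \<omega>) \<or> l / 2 < \<bar>X (h + b / 2) \<omega> - X h \<omega>\<bar>"
      proof (rule ccontr)
        assume "\<not> ?thesis"
        then have "\<bar>X t \<omega> - X h \<omega>\<bar> \<le> l" if "t \<in> {h..h + b}" for t
          by (intro chaining_step[OF b x xs w(1) _ _ that]) (auto simp: not_less)
        with w(2) show False by force
      qed
    qed (simp add: z_def)
  qed (use b A l0 in auto)
qed

end

section \<open>Tail bounds at all scales\<close>

context rv_gaussian_process
begin

text \<open>An interval of any length is cut into \<open>n\<close> short ones. For \<open>l < n * l0\<close> the constant makes the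
  bound exceed 1, and beyond that the exponential tail is below the power.\<close>

lemma bounded_interval_tail:
  assumes a: "0 < a"
  shows "\<exists>C>0. \<forall>h. \<forall>l>0. outer_prob_le M (excursion h a l) (C / l ^ (2 * q))"
proof -
  obtain b \<kappa> l0 where b: "0 < b" and \<kappa>: "0 < \<kappa>" and l0: "0 < l0"
    and small: "\<And>h l. l \<ge> l0 \<Longrightarrow> outer_prob_le M (excursion h b l) (6 * exp (- (\<kappa> * l\<^sup>2)))"
    by (rule small_interval_tail) (rule that; assumption)
  obtain n :: nat where n: "a \<le> real n * b" "0 < n"
  proof -
    obtain m :: nat where "a / b < real m" using reals_Archimedean2 by blast
    then show ?thesis using that[of "Suc m"] b by (simp add: field_simps)
  qed
  define C where "C = (real n * l0) ^ (2 * q) + real n * 6 * (fact q * real n ^ (2 * q) / \<kappa> ^ q)"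
  have "0 < (real n * l0) ^ (2 * q)" using n l0 by simp
  moreover have "0 \<le> real n * 6 * (fact q * real n ^ (2 * q) / \<kappa> ^ q)" using \<kappa> by simp
  ultimately have C: "0 < C" "(real n * l0) ^ (2 * q) \<le> C" "real n * 6 * (fact q * real n ^ (2 * q) / \<kappa> ^ q) \<le> C"
    unfolding C_def by linarith+
  have "outer_prob_le M (excursion h a l) (C / l ^ (2 * q))" if l: "l > 0" for h l
  proof (cases "l < real n * l0")
    case True
    then have "l ^ (2 * q) \<le> (real n * l0) ^ (2 * q)" using l by (intro power_mono) auto
    also have "\<dots> \<le> C" by (rule C)
    finally show ?thesis using l by (intro outer_prob_le_1) simp
  next
    case False
    define l' where "l' = l / real n"
    have l': "l0 \<le> l'" "0 < l'" using False n l by (simp_all add: l'_def field_simps)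
    have "outer_prob_le M (\<lambda>\<omega>. \<exists>i\<in>{..<n}. excursion (h + real i * b) b l' \<omega>)
        (\<Sum>i<n. 6 * exp (- (\<kappa> * l'\<^sup>2)))"
      by (intro outer_prob_le_UN_finite small l') auto
    moreover have "(\<Sum>i<n. 6 * exp (- (\<kappa> * l'\<^sup>2))) \<le> C / l ^ (2 * q)"
    proof -
      have "exp (- (\<kappa> * l'\<^sup>2)) \<le> fact q / (\<kappa> * l'\<^sup>2) ^ q"
        by (rule exp_minus_le_power) (use \<kappa> l' in auto)
      also have "\<dots> = (fact q * real n ^ (2 * q) / \<kappa> ^ q) / l ^ (2 * q)"
        unfolding l'_def power_divide power_mult_distrib power_mult[symmetric] using n by (simp add: field_simps)
      finally have "real n * 6 * exp (- (\<kappa> * l'\<^sup>2)) \<le> real n * 6 * ((fact q * real n ^ (2 * q) / \<kappa> ^ q) / l ^ (2 * q))"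
        by (intro mult_left_mono) auto
      also have "\<dots> = real n * 6 * (fact q * real n ^ (2 * q) / \<kappa> ^ q) / l ^ (2 * q)" by simp
      also have "\<dots> \<le> C / l ^ (2 * q)" using C(3) l by (intro divide_right_mono) auto
      finally show ?thesis by simp
    qed
    ultimately show ?thesis
    proof (rule outer_prob_le_mono)
      fix \<omega> assume w: "\<exists>t\<in>{h..h + a}. l < \<bar>X t \<omega> - X h \<omega>\<bar>"
      show "\<exists>i\<in>{..<n}. excursion (h + real i * b) b l' \<omega>"
      proof (rule ccontr)
        assume "\<not> ?thesis"
        then have no: "\<bar>X t \<omega> - X (h + real i * b) \<omega>\<bar> \<le> l'" if "i < n" "h + real i * b \<le> t" "t \<le> h + real i * b + b" for i t
          using that by (auto simp: not_less)
        have node: "\<bar>X (h + real i * b) \<omega> - X h \<omega>\<bar> \<le> real i * l'" if "i \<le> n" for i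
          using that
        proof (induction i)
          case (Suc i)
          then have "\<bar>X (h + real (Suc i) * b) \<omega> - X (h + real i * b) \<omega>\<bar> \<le> l'"
            using b by (intro no) (auto simp: algebra_simps)
          with Suc show ?case by (simp add: algebra_simps)
        qed simp
        obtain t where t: "t \<in> {h..h + a}" "l < \<bar>X t \<omega> - X h \<omega>\<bar>" using w by blast
        obtain i where i: "i < n" "h + real i * b \<le> t" "t \<le> h + real i * b + b"
        proof (cases "t = h + real n * b")
          case True
          with n show ?thesis using b by (intro that[of "n - 1"]) (auto simp: of_nat_diff algebra_simps)
        next
          case False
          define i where "i = nat \<lfloor>(t - h) / b\<rfloor>"
          have y: "0 \<le> (t - h) / b" using t b by simp
          have "t - h < real n * b" using False t n by auto
          then have "(t - h) / b < real n" using b by (simp add: field_simps)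
          then have "i < n" unfolding i_def using y by linarith
          moreover have "real i \<le> (t - h) / b" "(t - h) / b \<le> real i + 1" unfolding i_def using y by linarith+
          then have "h + real i * b \<le> t" "t \<le> h + real i * b + b" using b by (simp_all add: field_simps)
          ultimately show ?thesis by (rule that)
        qed
        have "\<bar>X t \<omega> - X h \<omega>\<bar> \<le> l' + real i * l'"
          using no[OF i] node[of i] i(1) by linarith
        also have "\<dots> = (1 + real i) * l'" by (simp add: algebra_simps)
        also have "\<dots> \<le> real n * l'" using i(1) l' by (intro mult_right_mono) auto
        also have "\<dots> = l" using n by (simp add: l'_def)
        finally show False using t(2) by simp
      qed
    qed
  qed
  with C show ?thesis by blast
qed

text \<open>Induction over the number of doublings from \<open>[x0, 2 * x0]\<close> to \<open>v\<close>. For length \<open>2 * v\<close>, an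
  excursion above \<open>l * \<sigma> (2 * v)\<close> requires that one of the two halves makes an excursion above
  \<open>l * \<theta> * \<sigma> v\<close> or that the increment between their left ends exceeds \<open>\<eta> * l * \<sigma> (2 * v)\<close>, where
  \<open>\<theta>\<^sup>2 = 2 powr g\<close> and \<open>\<eta> = 1 - 1 / \<theta>\<close>. The same constant \<open>C\<close> survives each step: because
  \<open>\<theta> ^ (2 * q) \<ge> 4\<close> the halves cost \<open>C / 4\<close> each, and \<open>C\<close> is chosen so that the increment costs at most
  \<open>C / 2\<close>.\<close>

lemma scaled_tail:
  assumes g: "0 < g" "2 \<le> g * real q" and x0: "0 < x0"
    and low: "\<And>x. x \<ge> x0 \<Longrightarrow> 2 powr g * \<sigma> x \<le> \<sigma> (2 * x)"
  shows "\<exists>C>0. \<forall>v\<ge>x0. \<forall>h. \<forall>l>0.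
    outer_prob_le M (excursion h v (l * \<sigma> v)) (C / l ^ (2 * q))"
proof -
  obtain C0 where C0: "C0 > 0"
    "\<And>h l. l > 0 \<Longrightarrow> outer_prob_le M (excursion h (2 * x0) l) (C0 / l ^ (2 * q))"
    using bounded_interval_tail[of "2 * x0" q] x0 by auto
  obtain m where m: "m > 0" "\<And>x. x0 \<le> x \<Longrightarrow> x \<le> 2 * x0 \<Longrightarrow> m \<le> \<sigma> x"
    by (rule \<sigma>_min[of x0 "2 * x0"]; use x0 in simp)
  define \<theta> where "\<theta> = 2 powr (g / 2)"
  have \<theta>: "1 < \<theta>" "2 powr g = \<theta> * \<theta>" using g by (auto simp: \<theta>_def powr_add[symmetric])
  have \<theta>q: "4 \<le> \<theta> ^ (2 * q)"
  proof -
    have "(4::real) = 2 powr 2" by simp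
    also have "\<dots> \<le> 2 powr (g * real q)" using g by (intro powr_mono) auto
    also have "\<dots> = \<theta> ^ (2 * q)" unfolding \<theta>_def by (simp add: powr_realpow[symmetric] powr_powr)
    finally show ?thesis .
  qed
  define \<eta> where "\<eta> = 1 - 1 / \<theta>"
  have \<eta>: "0 < \<eta>" using \<theta> by (simp add: \<eta>_def)
  define c1 where "c1 = 2 * fact q * 2 ^ q / \<eta> ^ (2 * q)"
  have c1: "0 < c1" using \<eta> by (simp add: c1_def)
  define C where "C = C0 / m ^ (2 * q) + 2 * c1"
  have C: "0 < C" "C0 / m ^ (2 * q) \<le> C" "2 * c1 \<le> C"
    using c1 C0 m by (simp_all add: C_def add_pos_pos)
  have claim: "outer_prob_le M (excursion h (2 ^ n * w) (l * \<sigma> (2 ^ n * w))) (C / l ^ (2 * q))"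
    if w: "x0 \<le> w" "w \<le> 2 * x0" and l: "l > 0" for n w h l
    using l
  proof (induction n arbitrary: h l)
    case 0
    have s: "0 < \<sigma> w" "m \<le> \<sigma> w" using m w by (auto intro!: \<sigma>_pos simp: less_le_trans[OF x0 w(1)])
    have "outer_prob_le M (excursion h (2 * x0) (l * \<sigma> w)) (C0 / (l * \<sigma> w) ^ (2 * q))"
      by (rule C0) (use 0 s in simp)
    moreover have "C0 / (l * \<sigma> w) ^ (2 * q) \<le> C / l ^ (2 * q)"
    proof -
      have "C0 / \<sigma> w ^ (2 * q) \<le> C0 / m ^ (2 * q)"
        using C0 m s by (intro divide_left_mono power_mono mult_pos_pos zero_less_power) auto
      then have "C0 / \<sigma> w ^ (2 * q) / l ^ (2 * q) \<le> C / l ^ (2 * q)"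
        using C 0 by (intro divide_right_mono) auto
      then show ?thesis by (simp add: power_mult_distrib field_simps)
    qed
    ultimately show ?case
      by (rule outer_prob_le_mono) (use w in auto)
  next
    case (Suc n)
    define v where "v = 2 ^ n * w"
    have wv: "1 * x0 \<le> v" unfolding v_def using w x0 by (intro mult_mono) auto
    have v: "x0 \<le> v" "0 < v" using wv x0 by auto
    have sv: "0 < \<sigma> v" using v \<sigma>_pos by simp
    have up: "\<theta> * \<theta> * \<sigma> v \<le> \<sigma> (2 * v)" using low[OF v(1)] \<theta>(2) by simp
    have s2: "0 < \<sigma> (2 * v)" using v \<sigma>_pos by simp
    have eqv: "2 ^ Suc n * w = 2 * v" by (simp add: v_def)
    let ?P = "\<lambda>h. excursion h v ((l * \<theta>) * \<sigma> v)"
    let ?Q = "\<lambda>\<omega>. \<eta> * l * \<sigma> (2 * v) < \<bar>X (h + v) \<omega> - X h \<omega>\<bar>"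
    have P: "outer_prob_le M (?P h) (C / (l * \<theta>) ^ (2 * q))" for h
      unfolding v_def by (rule Suc.IH) (use Suc.prems \<theta> in auto)
    have Q: "outer_prob_le M ?Q (2 * fact q * 2 ^ q * ((\<sigma> v)\<^sup>2) ^ q / (\<eta> * l * \<sigma> (2 * v)) ^ (2 * q))"
      by (rule increment_power_tail) (use sv s2 \<eta> Suc.prems in auto)
    have "outer_prob_le M (\<lambda>\<omega>. (?P h \<omega> \<or> ?P (h + v) \<omega>) \<or> ?Q \<omega>)
      ((C / (l * \<theta>) ^ (2 * q) + C / (l * \<theta>) ^ (2 * q)) +
       2 * fact q * 2 ^ q * ((\<sigma> v)\<^sup>2) ^ q / (\<eta> * l * \<sigma> (2 * v)) ^ (2 * q))"
      by (intro outer_prob_le_disj P Q)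
    then show ?case unfolding eqv
    proof (rule outer_prob_le_mono)
      fix \<omega> assume "\<exists>t\<in>{h..h + 2 * v}. l * \<sigma> (2 * v) < \<bar>X t \<omega> - X h \<omega>\<bar>"
      then obtain t where t: "h \<le> t" "t \<le> h + 2 * v" "l * \<sigma> (2 * v) < \<bar>X t \<omega> - X h \<omega>\<bar>" by auto
      have "l * \<theta> * \<sigma> v = l * (\<theta> * \<theta> * \<sigma> v) / \<theta>" using \<theta> by simp
      also have "\<dots> \<le> l * \<sigma> (2 * v) / \<theta>"
        using up Suc.prems \<theta> by (intro divide_right_mono mult_left_mono) auto
      finally have s: "l * \<theta> * \<sigma> v + \<eta> * l * \<sigma> (2 * v) \<le> l * \<sigma> (2 * v)"
        by (simp add: \<eta>_def algebra_simps)
      have "0 \<le> \<eta> * l * \<sigma> (2 * v)" using \<eta> Suc.prems by simp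
      show "(?P h \<omega> \<or> ?P (h + v) \<omega>) \<or> ?Q \<omega>"
      proof (rule ccontr)
        assume n: "\<not> ?thesis"
        show False
        proof (cases "t \<le> h + v")
          case True
          then have "\<bar>X t \<omega> - X h \<omega>\<bar> \<le> l * \<theta> * \<sigma> v" using n t by (auto simp: not_less)
          with t s \<open>0 \<le> \<eta> * l * \<sigma> (2 * v)\<close> show False by linarith
        next
          case False
          then have "\<bar>X t \<omega> - X (h + v) \<omega>\<bar> \<le> l * \<theta> * \<sigma> v" using n t by (auto simp: not_less)
          moreover have "\<bar>X (h + v) \<omega> - X h \<omega>\<bar> \<le> \<eta> * l * \<sigma> (2 * v)" using n by (auto simp: not_less)
          ultimately show False using t s by linarith
        qed
      qed
    next
      have "C / (l * \<theta>) ^ (2 * q) = C / l ^ (2 * q) / \<theta> ^ (2 * q)" by (simp add: power_mult_distrib)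
      also have "\<dots> \<le> C / l ^ (2 * q) / 4"
        using \<theta>q C Suc.prems by (intro divide_left_mono) auto
      finally have a: "C / (l * \<theta>) ^ (2 * q) \<le> C / l ^ (2 * q) / 4" .
      have "1 * \<sigma> v \<le> \<theta> * \<theta> * \<sigma> v" using \<theta> sv by (intro mult_right_mono) (auto intro: less_imp_le less_1_mult)
      then have "\<sigma> v \<le> \<sigma> (2 * v)" using up by simp
      then have r: "\<sigma> v ^ (2 * q) / \<sigma> (2 * v) ^ (2 * q) \<le> 1"
        using sv s2 by (simp add: power_mono)
      have "2 * fact q * 2 ^ q * ((\<sigma> v)\<^sup>2) ^ q / (\<eta> * l * \<sigma> (2 * v)) ^ (2 * q)
         = c1 / l ^ (2 * q) * (\<sigma> v ^ (2 * q) / \<sigma> (2 * v) ^ (2 * q))"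
        unfolding c1_def power_mult[symmetric] power_mult_distrib by simp
      also have "\<dots> \<le> c1 / l ^ (2 * q) * 1"
        using r c1 Suc.prems by (intro mult_left_mono) auto
      also have "\<dots> \<le> (C / 2) / l ^ (2 * q)"
        using divide_right_mono[of c1 "C / 2" "l ^ (2 * q)"] C(3) Suc.prems by simp
      finally show "(C / (l * \<theta>) ^ (2 * q) + C / (l * \<theta>) ^ (2 * q)) +
       2 * fact q * 2 ^ q * ((\<sigma> v)\<^sup>2) ^ q / (\<eta> * l * \<sigma> (2 * v)) ^ (2 * q) \<le> C / l ^ (2 * q)"
        using a by simp
    qed
  qed
  have "outer_prob_le M (excursion h v (l * \<sigma> v)) (C / l ^ (2 * q))"
    if v: "v \<ge> x0" and l: "l > 0" for v h l
  proof -
    obtain n :: nat and w where w: "v = 2 ^ n * w" "x0 \<le> w" "w \<le> 2 * x0"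
      using dyadic_scale[OF x0 v] .
    show ?thesis unfolding w(1) by (rule claim[OF w(2,3) l])
  qed
  with C show ?thesis by blast
qed

end

context rv_gaussian_process
begin

lemma \<sigma>_dyadic_upper:
  assumes "\<And>x. x \<ge> x0 \<Longrightarrow> \<sigma> (2 * x) \<le> \<beta> * \<sigma> x" "0 < x0" "x0 \<le> x" "0 \<le> \<beta>"
  shows "\<sigma> (2 ^ n * x) \<le> \<beta> ^ n * \<sigma> x"
proof (induction n)
  case (Suc n)
  have "1 * x0 \<le> 2 ^ n * x" using assms by (intro mult_mono) auto
  then have "\<sigma> (2 * (2 ^ n * x)) \<le> \<beta> * \<sigma> (2 ^ n * x)" by (intro assms) simp
  also have "\<dots> \<le> \<beta> * (\<beta> ^ n * \<sigma> x)" using Suc assms by (intro mult_left_mono) auto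
  finally show ?case by (simp add: mult_ac)
qed simp

lemma \<sigma>_dyadic_lower:
  assumes "\<And>x. x \<ge> x0 \<Longrightarrow> \<theta> * \<sigma> x \<le> \<sigma> (2 * x)" "0 < x0" "x0 \<le> x" "0 \<le> \<theta>"
  shows "\<theta> ^ n * \<sigma> x \<le> \<sigma> (2 ^ n * x)"
proof (induction n)
  case (Suc n)
  have "\<theta> * (\<theta> ^ n * \<sigma> x) \<le> \<theta> * \<sigma> (2 ^ n * x)" using Suc assms by (intro mult_left_mono) auto
  also have "1 * x0 \<le> 2 ^ n * x" using assms by (intro mult_mono) auto
  then have "\<theta> * \<sigma> (2 ^ n * x) \<le> \<sigma> (2 * (2 ^ n * x))" by (intro assms) simp
  finally show ?case by (simp add: mult_ac)
qed simp

text \<open>If \<open>\<bar>X s\<bar> > c * \<bar>s\<bar>\<close> for some \<open>s\<close> with \<open>- s \<in> [2 ^ k * w, 2 ^ Suc k * w]\<close>, then \<open>X s\<close> or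
  \<open>X 0 = 0\<close> differs from \<open>X (- v k)\<close>, \<open>v k = 2 ^ Suc k * w\<close>, by more than half of \<open>c * 2 ^ k * w\<close>.
  Since \<open>\<sigma>\<close> grows by a factor \<open>\<beta> < 2\<close> per doubling, the bounds for the blocks form a geometric
  series.\<close>

lemma linear_growth_tail:
  assumes C1: "0 < C1" and tail: "\<And>v h l. v \<ge> x0 \<Longrightarrow> l > 0 \<Longrightarrow>
      outer_prob_le M (excursion h v (l * \<sigma> v)) (C1 / l ^ (2 * q))"
    and up: "\<And>x. x \<ge> x0 \<Longrightarrow> \<sigma> (2 * x) \<le> \<beta> * \<sigma> x" and \<beta>: "0 < \<beta>" "\<beta> < 2"
    and x0: "0 < x0" and q: "0 < q"
  shows "\<exists>C>0. \<forall>w\<ge>x0. \<forall>c>0.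
    outer_prob_le M (\<lambda>\<omega>. \<exists>s\<le>-w. c * \<bar>s\<bar> < \<bar>X s \<omega>\<bar>) (C * (\<sigma> w / (c * w)) ^ (2 * q))"
proof -
  define \<rho> where "\<rho> = (\<beta> / 2) ^ (2 * q)"
  have \<rho>: "0 < \<rho>" "\<rho> < 1" unfolding \<rho>_def using \<beta> q by (auto intro!: power_less_one_iff[THEN iffD2])
  define C where "C = C1 * (2 * \<beta>) ^ (2 * q) / (1 - \<rho>)"
  have C: "0 < C" using C1 \<beta> \<rho> by (simp add: C_def)
  have "outer_prob_le M (\<lambda>\<omega>. \<exists>s\<le>-w. c * \<bar>s\<bar> < \<bar>X s \<omega>\<bar>) (C * (\<sigma> w / (c * w)) ^ (2 * q))"
    if w: "w \<ge> x0" and c: "c > 0" for w c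
  proof -
    have wp: "0 < w" using w x0 by simp
    define v where "v k = 2 ^ Suc k * w" for k
    have v: "x0 \<le> v k" "0 < v k" for k
    proof -
      have "1 * x0 \<le> 2 ^ Suc k * w" using w x0 by (intro mult_mono one_le_power) auto
      then show "x0 \<le> v k" by (simp add: v_def)
      with x0 show "0 < v k" by simp
    qed
    define l where "l k = c * 2 ^ k * w / (2 * \<sigma> (v k))" for k
    have sv: "0 < \<sigma> (v k)" for k using \<sigma>_pos v by simp
    have sw: "0 < \<sigma> w" using \<sigma>_pos wp by simp
    have l: "0 < l k" for k using sv[of k] c wp by (simp add: l_def)
    have ls: "l k * \<sigma> (v k) = c * 2 ^ k * w / 2" for k using sv[of k] by (simp add: l_def)
    let ?P = "\<lambda>k. excursion (- v k) (v k) (l k * \<sigma> (v k))"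
    define A where "A = C1 * (2 * \<beta>) ^ (2 * q) * (\<sigma> w / (c * w)) ^ (2 * q)"
    have P: "outer_prob_le M (?P k) (A * \<rho> ^ k)" for k
    proof (rule outer_prob_le_mono[OF tail[OF v(1) l]])
      have "1 / l k = 2 * \<sigma> (v k) / (c * 2 ^ k * w)" by (simp add: l_def)
      also have "\<dots> \<le> 2 * (\<beta> ^ Suc k * \<sigma> w) / (c * 2 ^ k * w)"
        unfolding v_def using c wp \<beta> up x0 w
        by (intro divide_right_mono mult_left_mono \<sigma>_dyadic_upper[of x0]) auto
      also have "\<dots> = (2 * \<beta>) * (\<sigma> w / (c * w)) * (\<beta> / 2) ^ k"
        by (simp add: power_divide mult_ac)
      finally have "(1 / l k) ^ (2 * q) \<le> ((2 * \<beta>) * (\<sigma> w / (c * w)) * (\<beta> / 2) ^ k) ^ (2 * q)"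
        using l by (intro power_mono) (auto intro: less_imp_le)
      also have "\<dots> = (2 * \<beta>) ^ (2 * q) * (\<sigma> w / (c * w)) ^ (2 * q) * \<rho> ^ k"
        unfolding \<rho>_def power_mult_distrib power_mult[symmetric] by (simp add: mult.commute)
      finally have "C1 * (1 / l k) ^ (2 * q) \<le> C1 * ((2 * \<beta>) ^ (2 * q) * (\<sigma> w / (c * w)) ^ (2 * q) * \<rho> ^ k)"
        using C1 by (intro mult_left_mono) auto
      then show "C1 / l k ^ (2 * q) \<le> A * \<rho> ^ k" by (simp add: A_def power_divide mult_ac)
    qed
    have "outer_prob_le M (\<lambda>\<omega>. \<exists>k. ?P k \<omega>) (\<Sum>k. A * \<rho> ^ k)"
      by (rule outer_prob_le_UN[OF P]) (use \<rho> in \<open>auto intro!: summable_mult summable_geometric\<close>)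
    moreover have "(\<Sum>k. A * \<rho> ^ k) \<le> C * (\<sigma> w / (c * w)) ^ (2 * q)"
      using \<rho> by (subst suminf_mult) (auto simp: suminf_geometric summable_geometric A_def C_def)
    ultimately show ?thesis
    proof (rule outer_prob_le_mono)
      fix \<omega> assume w\<omega>: "\<omega> \<in> space M" and "\<exists>s\<le>-w. c * \<bar>s\<bar> < \<bar>X s \<omega>\<bar>"
      then obtain s where s: "s \<le> -w" "c * \<bar>s\<bar> < \<bar>X s \<omega>\<bar>" by blast
      obtain k :: nat and y where y: "- s = 2 ^ k * y" "w \<le> y" "y \<le> 2 * w"
        by (rule dyadic_scale[of w "- s"]; use s wp in simp)
      have "2 ^ k * w \<le> 2 ^ k * y" "2 ^ k * y \<le> 2 ^ k * (2 * w)" using y by auto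
      then have sk: "2 ^ k * w \<le> - s" "- v k \<le> s" unfolding v_def power_Suc using y(1) by linarith+
      show "\<exists>k. ?P k \<omega>"
      proof (rule ccontr)
        assume "\<not> ?thesis"
        then have n: "\<bar>X t \<omega> - X (- v k) \<omega>\<bar> \<le> c * 2 ^ k * w / 2" if "- v k \<le> t" "t \<le> 0" for t
          using that ls by (auto simp: not_less)
        have "\<bar>X s \<omega> - X (- v k) \<omega>\<bar> \<le> c * 2 ^ k * w / 2"
          by (rule n) (use sk s wp in auto)
        moreover have "\<bar>X 0 \<omega> - X (- v k) \<omega>\<bar> \<le> c * 2 ^ k * w / 2"
          by (rule n) (use v in \<open>auto intro: less_imp_le\<close>)
        ultimately have "\<bar>X s \<omega>\<bar> \<le> c * (2 ^ k * w)" unfolding X_0[OF w\<omega>] by linarith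
        also have "\<dots> \<le> c * \<bar>s\<bar>" using sk c by (intro mult_left_mono) auto
        finally show False using s by simp
      qed
    qed
  qed
  with C show ?thesis by blast
qed

text \<open>Fixes the exponents: \<open>\<theta> = 2 powr (\<alpha> / 2)\<close>, \<open>\<beta> = 2 powr ((\<alpha> + 1) / 2)\<close> and \<open>q\<close> with \<open>\<alpha> * q \<ge> 4\<close>. The
  resulting \<open>\<theta> ^ (2 * q) \<ge> 16\<close> later beats the number \<open>2 ^ r\<close> of cells of mesh \<open>1 / 2 ^ r\<close>.\<close>

lemma quantitative_bounds:
  obtains x0 C q \<theta> \<beta> where "0 < x0" "0 < C" "0 < q" "1 < \<theta>" "16 \<le> \<theta> ^ (2 * q)" "0 < \<beta>" "\<beta> < 2"
    "\<And>x. x \<ge> x0 \<Longrightarrow> \<theta> * \<sigma> x \<le> \<sigma> (2 * x)" "\<And>x. x \<ge> x0 \<Longrightarrow> \<sigma> (2 * x) \<le> \<beta> * \<sigma> x"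
    "\<And>v h l. v \<ge> x0 \<Longrightarrow> l > 0 \<Longrightarrow>
      outer_prob_le M (excursion h v (l * \<sigma> v)) (C / l ^ (2 * q))"
proof -
  define g g' where "g = \<alpha> / 2" and "g' = (\<alpha> + 1) / 2"
  have g: "0 < g" "g < \<alpha>" "\<alpha> < g'" "g' < 1" using \<alpha>_pos \<alpha>_less_1 by (auto simp: g_def g'_def)
  obtain x0 where x0: "x0 > 0" "\<And>x. x \<ge> x0 \<Longrightarrow> 2 powr g * \<sigma> x \<le> \<sigma> (2 * x)"
      "\<And>x. x \<ge> x0 \<Longrightarrow> \<sigma> (2 * x) \<le> 2 powr g' * \<sigma> x"
    by (rule dyadic_potter_bounds[of g g']) (use g in auto)
  obtain q :: nat where "2 / g < real q" using reals_Archimedean2 by blast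
  then have gq: "2 \<le> g * real q" and q: "0 < q" using g by (auto simp: field_simps intro: gr0I)
  obtain C where C: "C > 0" "\<forall>v\<ge>x0. \<forall>h. \<forall>l>0.
    outer_prob_le M (excursion h v (l * \<sigma> v)) (C / l ^ (2 * q))"
    using scaled_tail[OF g(1) gq x0(1,2)] by blast
  have "(16::real) = 2 powr 4" by simp
  also have "\<dots> \<le> 2 powr (g * real (2 * q))" using gq by (intro powr_mono) auto
  also have "\<dots> = (2 powr g) ^ (2 * q)" by (simp add: powr_realpow[symmetric] powr_powr)
  finally have p16: "16 \<le> (2 powr g) ^ (2 * q)" .
  show ?thesis
  proof (rule that[OF x0(1) C(1) q _ p16 _ _ x0(2,3)])
    show "1 < 2 powr g" using g by simp
    show "2 powr g' < 2" using powr_less_mono[of g' 1 2] g by simp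
  qed (use C in auto)
qed

lemma linear_growth:
  assumes c: "0 < c"
  shows "AE \<omega> in M. \<exists>R>0. \<forall>s\<le>-R. \<bar>X s \<omega>\<bar> \<le> c * \<bar>s\<bar>"
proof -
  obtain x0 C q \<theta> \<beta> where *: "0 < x0" "0 < C" "0 < q" "1 < \<theta>" "16 \<le> \<theta> ^ (2 * q)" "0 < \<beta>" "\<beta> < 2"
    "\<And>x. x \<ge> x0 \<Longrightarrow> \<theta> * \<sigma> x \<le> \<sigma> (2 * x)" "\<And>x. x \<ge> x0 \<Longrightarrow> \<sigma> (2 * x) \<le> \<beta> * \<sigma> x"
    "\<And>v h l. v \<ge> x0 \<Longrightarrow> l > 0 \<Longrightarrow>
      outer_prob_le M (excursion h v (l * \<sigma> v)) (C / l ^ (2 * q))"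
    by (rule quantitative_bounds) (rule that; assumption)
  obtain C' where C': "0 < C'" "\<And>w c. w \<ge> x0 \<Longrightarrow> c > 0 \<Longrightarrow>
    outer_prob_le M (\<lambda>\<omega>. \<exists>s\<le>-w. c * \<bar>s\<bar> < \<bar>X s \<omega>\<bar>) (C' * (\<sigma> w / (c * w)) ^ (2 * q))"
    using linear_growth_tail[OF *(2,10,9,6,7,1,3)] by blast
  define w where "w n = x0 + real n" for n
  have "filterlim w at_top sequentially"
    unfolding w_def by (rule filterlim_tendsto_add_at_top[OF tendsto_const filterlim_real_sequentially])
  then have "(\<lambda>n. \<sigma> (w n) / w n) \<longlonglongrightarrow> 0"
    by (rule filterlim_compose[OF \<sigma>_sublinear])
  have z: "C' * (1 / c * 0) ^ (2 * q) = 0" using *(3) by (simp add: zero_power)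
  from \<open>(\<lambda>n. \<sigma> (w n) / w n) \<longlonglongrightarrow> 0\<close> have "(\<lambda>n. C' * ((1 / c) * (\<sigma> (w n) / w n)) ^ (2 * q)) \<longlonglongrightarrow> C' * ((1 / c) * 0) ^ (2 * q)"
    by (intro tendsto_intros)
  then have "(\<lambda>n. C' * (\<sigma> (w n) / (c * w n)) ^ (2 * q)) \<longlonglongrightarrow> 0"
    unfolding z by simp
  then have "AE \<omega> in M. \<exists>n. \<not> (\<exists>s\<le>-w n. c * \<bar>s\<bar> < \<bar>X s \<omega>\<bar>)"
    by (intro AE_if_outer_prob_le[of _ "\<lambda>n. C' * (\<sigma> (w n) / (c * w n)) ^ (2 * q)"] C')
      (use c in \<open>auto simp: w_def\<close>)
  then show ?thesis
  proof (rule AE_mp, intro AE_I2 impI)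
    fix \<omega> assume "\<exists>n. \<not> (\<exists>s\<le>-w n. c * \<bar>s\<bar> < \<bar>X s \<omega>\<bar>)"
    then obtain n where "\<not> (\<exists>s\<le>-w n. c * \<bar>s\<bar> < \<bar>X s \<omega>\<bar>)" by blast
    moreover have "0 < w n" using *(1) by (simp add: w_def)
    ultimately show "\<exists>R>0. \<forall>s\<le>-R. \<bar>X s \<omega>\<bar> \<le> c * \<bar>s\<bar>"
      by (intro exI[of _ "w n"]) (auto simp: not_less)
  qed
qed

text \<open>The event is that \<open>\<bar>X s\<bar> > (\<sigma> u / u) * \<bar>s\<bar>\<close> for some \<open>s \<le> - u * T\<close>. With \<open>T = 2 ^ r\<close> the bound is of
  order \<open>(\<beta> / 2) ^ r\<close> to the power \<open>2 * q\<close>, uniformly in \<open>u\<close>.\<close>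

lemma scaled_linear_growth:
  assumes e: "0 < e"
  shows "\<exists>T0>0. \<exists>u0>0. \<forall>u\<ge>u0. \<forall>T\<ge>T0. outer_prob_le M (\<lambda>\<omega>. \<exists>s\<le>-T. \<bar>s\<bar> < \<bar>X (u * s) \<omega> / \<sigma> u\<bar>) e"
proof -
  obtain x0 C q \<theta> \<beta> where *: "0 < x0" "0 < C" "0 < q" "1 < \<theta>" "16 \<le> \<theta> ^ (2 * q)" "0 < \<beta>" "\<beta> < 2"
    "\<And>x. x \<ge> x0 \<Longrightarrow> \<theta> * \<sigma> x \<le> \<sigma> (2 * x)" "\<And>x. x \<ge> x0 \<Longrightarrow> \<sigma> (2 * x) \<le> \<beta> * \<sigma> x"
    "\<And>v h l. v \<ge> x0 \<Longrightarrow> l > 0 \<Longrightarrow>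
      outer_prob_le M (excursion h v (l * \<sigma> v)) (C / l ^ (2 * q))"
    by (rule quantitative_bounds) (rule that; assumption)
  obtain C' where C': "0 < C'" "\<And>w c. w \<ge> x0 \<Longrightarrow> c > 0 \<Longrightarrow>
    outer_prob_le M (\<lambda>\<omega>. \<exists>s\<le>-w. c * \<bar>s\<bar> < \<bar>X s \<omega>\<bar>) (C' * (\<sigma> w / (c * w)) ^ (2 * q))"
    using linear_growth_tail[OF *(2,10,9,6,7,1,3)] by blast
  have "(\<lambda>r. C' * ((\<beta> / 2) ^ r) ^ (2 * q)) \<longlonglongrightarrow> C' * 0 ^ (2 * q)"
    using * by (intro tendsto_intros LIMSEQ_realpow_zero) auto
  moreover have "C' * 0 ^ (2 * q) = 0" using *(3) by (simp add: zero_power)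
  ultimately have "(\<lambda>r. C' * ((\<beta> / 2) ^ r) ^ (2 * q)) \<longlonglongrightarrow> 0" by simp
  then have "\<forall>\<^sub>F r in sequentially. C' * ((\<beta> / 2) ^ r) ^ (2 * q) < e"
    using e by (rule order_tendstoD)
  then obtain r where r: "C' * ((\<beta> / 2) ^ r) ^ (2 * q) < e"
    using eventually_happens'[OF sequentially_bot] by blast
  have "outer_prob_le M (\<lambda>\<omega>. \<exists>s\<le>-T. \<bar>s\<bar> < \<bar>X (u * s) \<omega> / \<sigma> u\<bar>) e" if u: "u \<ge> x0" and T: "T \<ge> 2 ^ r" for u T
  proof -
    have up: "0 < u" using u *(1) by simp
    have su: "0 < \<sigma> u" using \<sigma>_pos up by simp
    have w: "x0 \<le> 2 ^ r * u" using mult_mono[of 1 "2 ^ r" x0 u] u *(1) by auto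
    have "outer_prob_le M (\<lambda>\<omega>. \<exists>s\<le>-(2 ^ r * u). (\<sigma> u / u) * \<bar>s\<bar> < \<bar>X s \<omega>\<bar>) (C' * (\<sigma> (2 ^ r * u) / (\<sigma> u / u * (2 ^ r * u))) ^ (2 * q))"
      by (rule C'(2)[OF w]) (use su up in simp)
    moreover have "C' * (\<sigma> (2 ^ r * u) / (\<sigma> u / u * (2 ^ r * u))) ^ (2 * q) \<le> e"
    proof -
      have "\<sigma> (2 ^ r * u) / (\<sigma> u / u * (2 ^ r * u)) \<le> \<beta> ^ r * \<sigma> u / (\<sigma> u / u * (2 ^ r * u))"
        using su up u * by (intro divide_right_mono \<sigma>_dyadic_upper[of x0]) auto
      also have "\<dots> = (\<beta> / 2) ^ r" using su up by (simp add: power_divide)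
      finally have "(\<sigma> (2 ^ r * u) / (\<sigma> u / u * (2 ^ r * u))) ^ (2 * q) \<le> ((\<beta> / 2) ^ r) ^ (2 * q)"
        using su up by (intro power_mono) auto
      then have "C' * (\<sigma> (2 ^ r * u) / (\<sigma> u / u * (2 ^ r * u))) ^ (2 * q) \<le> C' * ((\<beta> / 2) ^ r) ^ (2 * q)"
        using C'(1) by (intro mult_left_mono) auto
      with r show ?thesis by linarith
    qed
    ultimately show ?thesis
    proof (rule outer_prob_le_mono)
      fix \<omega> assume "\<exists>s\<le>-T. \<bar>s\<bar> < \<bar>X (u * s) \<omega> / \<sigma> u\<bar>"
      then obtain s where s: "s \<le> -T" "\<bar>s\<bar> < \<bar>X (u * s) \<omega> / \<sigma> u\<bar>" by blast
      have "u * 2 ^ r \<le> u * (- s)" using s T up by (intro mult_left_mono) auto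
      moreover have "\<sigma> u / u * \<bar>u * s\<bar> < \<bar>X (u * s) \<omega>\<bar>" using s su up by (simp add: abs_mult field_simps)
      ultimately show "\<exists>s\<le>-(2 ^ r * u). (\<sigma> u / u) * \<bar>s\<bar> < \<bar>X s \<omega>\<bar>"
        by (intro exI[of _ "u * s"]) (auto simp: mult_ac)
    qed
  qed
  then show ?thesis using *(1) by (intro exI[of _ "2 ^ r"] conjI exI[of _ x0]) auto
qed

abbreviation scaled :: "real \<Rightarrow> real \<Rightarrow> 'a \<Rightarrow> real" where
  "scaled u s \<omega> \<equiv> X (u * s) \<omega> / \<sigma> u"

abbreviation cell_oscillation :: "real \<Rightarrow> real \<Rightarrow> nat \<Rightarrow> nat \<Rightarrow> real \<Rightarrow> 'a \<Rightarrow> bool" where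
  "cell_oscillation u h n r \<eta> \<equiv> \<lambda>\<omega>. \<exists>i<n * 2 ^ r. \<exists>t\<in>{h + real i / 2 ^ r..h + (real i + 1) / 2 ^ r}.
     \<eta> < \<bar>scaled u t \<omega> - scaled u (h + real i / 2 ^ r) \<omega>\<bar>"

text \<open>For \<open>u = 2 ^ r * v\<close> the level \<open>\<eta> * \<sigma> u\<close> is at least \<open>\<eta> * \<theta> ^ r * \<sigma> v\<close>, so a single cell oscillates by more
  than \<open>\<eta>\<close> with probability of order \<open>1 / (\<theta> ^ (2 * q)) ^ r\<close>, and there are \<open>(r + K) * 2 ^ r\<close>
  cells. Letting the window grow with \<open>r\<close> costs only a linear factor.\<close>

lemma scaled_modulus:
  assumes e: "0 < e" and \<eta>: "0 < \<eta>"
  shows "\<forall>\<^sub>F r in sequentially. \<exists>u0>0. \<forall>u\<ge>u0. \<forall>h. outer_prob_le M (cell_oscillation u h (r + K) r \<eta>) e"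
proof -
  obtain x0 C q \<theta> \<beta> where *: "0 < x0" "0 < C" "0 < q" "1 < \<theta>" "16 \<le> \<theta> ^ (2 * q)" "0 < \<beta>" "\<beta> < 2"
    "\<And>x. x \<ge> x0 \<Longrightarrow> \<theta> * \<sigma> x \<le> \<sigma> (2 * x)" "\<And>x. x \<ge> x0 \<Longrightarrow> \<sigma> (2 * x) \<le> \<beta> * \<sigma> x"
    "\<And>v h l. v \<ge> x0 \<Longrightarrow> l > 0 \<Longrightarrow>
      outer_prob_le M (excursion h v (l * \<sigma> v)) (C / l ^ (2 * q))"
    by (rule quantitative_bounds) (rule that; assumption)
  have "(\<lambda>r. (real r + real K) * (1 / 2) ^ r) \<longlonglongrightarrow> 0" by real_asymp
  then have "(\<lambda>r. (C / \<eta> ^ (2 * q)) * ((real r + real K) * (1 / 2) ^ r)) \<longlonglongrightarrow> 0"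
    by (rule tendsto_mult_right_zero)
  then have "\<forall>\<^sub>F r in sequentially. (C / \<eta> ^ (2 * q)) * ((real r + real K) * (1 / 2) ^ r) < e"
    by (rule order_tendstoD) (rule e)
  then show ?thesis
  proof eventually_elim
    case (elim r)
    then have r: "real (r + K) * C / \<eta> ^ (2 * q) * (1 / 2) ^ r < e" by (simp add: mult_ac)
  have "outer_prob_le M (cell_oscillation u h (r + K) r \<eta>) e" if u: "u \<ge> x0 * 2 ^ r" for u h
  proof -
    define v where "v = u / 2 ^ r"
    have v: "x0 \<le> v" "0 < v" using u *(1) by (auto simp: v_def field_simps intro: less_le_trans[of _ "x0 * 2 ^ r"])
    have u_v: "u = 2 ^ r * v" by (simp add: v_def)
    have up: "0 < u" using v u_v by simp
    have s: "0 < \<sigma> u" "0 < \<sigma> v" using \<sigma>_pos v up by auto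
    define l where "l = \<eta> * \<sigma> u / \<sigma> v"
    have l: "0 < l" using s \<eta> by (simp add: l_def)
    have "\<theta> ^ r * \<sigma> v \<le> \<sigma> (2 ^ r * v)" by (rule \<sigma>_dyadic_lower[of x0]) (use * v in auto)
    then have l_le: "\<eta> * \<theta> ^ r \<le> l" unfolding l_def using s \<eta> u_v by (simp add: field_simps)
    define a where "a i = u * (h + real i / 2 ^ r)" for i
    have "outer_prob_le M (\<lambda>\<omega>. \<exists>i\<in>{..<(r + K) * 2 ^ r}. excursion (a i) v (l * \<sigma> v) \<omega>) (\<Sum>i<(r + K) * 2 ^ r. C / l ^ (2 * q))"
      by (intro outer_prob_le_UN_finite *(10) v l) auto
    moreover have "(\<Sum>i<(r + K) * 2 ^ r. C / l ^ (2 * q)) \<le> e"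
    proof -
      have "(2::real) ^ r * 2 ^ r = 4 ^ r" by (simp flip: power_mult_distrib)
      also have "\<dots> \<le> (\<theta> ^ (2 * q)) ^ r" using *(5) by (intro power_mono) auto
      finally have th: "2 ^ r / (\<theta> ^ (2 * q)) ^ r \<le> (1 / 2) ^ r"
        using *(4) by (simp add: power_divide field_simps)
      have "(\<Sum>i<(r + K) * 2 ^ r. C / l ^ (2 * q)) = real (r + K) * 2 ^ r * C / l ^ (2 * q)" by simp
      also have "\<dots> \<le> real (r + K) * 2 ^ r * C / (\<eta> * \<theta> ^ r) ^ (2 * q)"
        using l_le \<eta> *(2,4) l by (intro divide_left_mono power_mono mult_pos_pos zero_less_power) auto
      also have "\<dots> = real (r + K) * C / \<eta> ^ (2 * q) * (2 ^ r / (\<theta> ^ (2 * q)) ^ r)"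
        unfolding power_mult_distrib power_mult[symmetric] by (simp add: mult_ac)
      also have "\<dots> \<le> real (r + K) * C / \<eta> ^ (2 * q) * (1 / 2) ^ r"
        using \<eta> *(2) by (intro mult_left_mono th) auto
      finally show ?thesis using r by linarith
    qed
    ultimately show ?thesis
    proof (rule outer_prob_le_mono)
      fix \<omega> assume "cell_oscillation u h (r + K) r \<eta> \<omega>"
      then obtain i t where i: "i < (r + K) * 2 ^ r" and t: "h + real i / 2 ^ r \<le> t" "t \<le> h + (real i + 1) / 2 ^ r"
         and big: "\<eta> < \<bar>X (u * t) \<omega> / \<sigma> u - X (a i) \<omega> / \<sigma> u\<bar>" unfolding a_def by auto
      have "a i \<le> u * t" unfolding a_def using t up by (intro mult_left_mono) auto
      moreover have "u * t \<le> u * (h + (real i + 1) / 2 ^ r)" using t up by (intro mult_left_mono) auto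
      then have "u * t \<le> a i + v" unfolding a_def v_def by (simp add: field_simps)
      moreover have "l * \<sigma> v < \<bar>X (u * t) \<omega> - X (a i) \<omega>\<bar>"
        using big s unfolding l_def by (simp add: diff_divide_distrib[symmetric] field_simps)
      ultimately show "\<exists>i\<in>{..<(r + K) * 2 ^ r}. excursion (a i) v (l * \<sigma> v) \<omega>"
        using i by (intro bexI[of _ i] bexI[of _ "u * t"]) auto
    qed
  qed
  then show ?case using *(1) by (intro exI[of _ "x0 * 2 ^ r"]) auto
  qed
qed

end

section \<open>The buffer content as a functional of the input path\<close>

text \<open>The buffer with unit drain rate, as a functional of a single path, and its real-valued variant
  for a buffer that is empty before time \<open>- T\<close>. The variant makes sense for step functions as well.\<close>

definition queue :: "(real \<Rightarrow> real) \<Rightarrow> real \<Rightarrow> ereal" where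
  "queue f t = (SUP s\<in>{..t}. ereal (f t - f s - (t - s)))"

definition queue_from :: "real \<Rightarrow> (real \<Rightarrow> real) \<Rightarrow> real \<Rightarrow> real" where
  "queue_from T f t = (SUP s\<in>{-T..t}. f t - f s - (t - s))"

text \<open>Beyond \<open>t\<close> the running supremum can rise only by as much as the path rises above its value at
  \<open>t\<close>.\<close>

lemma running_supremum_continuous:
  fixes g :: "real \<Rightarrow> real"
  assumes g: "continuous_on UNIV g"
  shows "continuous_on {a..} (\<lambda>t. SUP s\<in>{a..t}. g s :: real)"
proof -
  define R where "R t = (SUP s\<in>{a..t}. g s)" for t
  have gc: "continuous_on S g" for S using g continuous_on_subset by blast
  have bdd: "bdd_above (g ` {a..t})" for t
    by (intro bounded_imp_bdd_above compact_imp_bounded compact_continuous_image gc compact_Icc)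
  have step: "R t \<le> R t'" "R t' \<le> R t + e"
    if t: "a \<le> t" "t \<le> t'" and e: "0 \<le> e" "\<And>s. t \<le> s \<Longrightarrow> s \<le> t' \<Longrightarrow> g s \<le> g t + e" for t t' e
  proof -
    show "R t \<le> R t'" unfolding R_def by (rule cSUP_subset_mono[OF _ bdd]) (use t in auto)
    have Rt: "g s \<le> R t" if "a \<le> s" "s \<le> t" for s
      unfolding R_def by (rule cSUP_upper[OF _ bdd]) (use that in auto)
    show "R t' \<le> R t + e" unfolding R_def[of t']
    proof (rule cSUP_least)
      fix s assume s: "s \<in> {a..t'}"
      show "g s \<le> R t + e"
      proof (cases "s \<le> t")
        case True then show ?thesis using Rt[of s] s e(1) by auto
      next
        case False then show ?thesis using e(2)[of s] Rt[of t] s t by auto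
      qed
    qed (use t in auto)
  qed
  have "continuous_on {a..} R"
    unfolding continuous_on_iff
  proof (intro ballI allI impI)
    fix t e :: real assume t: "t \<in> {a..}" and e: "0 < e"
    have "uniformly_continuous_on {a..t + 1} g" by (intro compact_uniformly_continuous gc) auto
    then obtain d where d: "d > 0" "\<And>x y. x \<in> {a..t + 1} \<Longrightarrow> y \<in> {a..t + 1} \<Longrightarrow> dist y x < d \<Longrightarrow> dist (g y) (g x) < e / 2"
      unfolding uniformly_continuous_on_def using e by (metis half_gt_zero)
    have near: "\<bar>R t1 - R t2\<bar> \<le> e / 2" if "a \<le> t1" "t1 \<le> t2" "t2 \<le> t + 1" "t2 - t1 < d" for t1 t2
    proof -
      have "g s \<le> g t1 + e / 2" if "t1 \<le> s" "s \<le> t2" for s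
      proof -
        have "dist (g s) (g t1) < e / 2"
          using that \<open>a \<le> t1\<close> \<open>t1 \<le> t2\<close> \<open>t2 \<le> t + 1\<close> \<open>t2 - t1 < d\<close> by (intro d(2)) (auto simp: dist_real_def)
        then show ?thesis unfolding dist_real_def by linarith
      qed
      then show ?thesis using step[of t1 t2 "e / 2"] that e by auto
    qed
    show "\<exists>d>0. \<forall>x'\<in>{a..}. dist x' t < d \<longrightarrow> dist (R x') (R t) < e"
    proof (intro exI[of _ "min d 1"] conjI ballI impI)
      fix x' assume x': "x' \<in> {a..}" "dist x' t < min d 1"
      then have "\<bar>R x' - R t\<bar> \<le> e / 2"
        using near[of x' t] near[of t x'] t by (cases "x' \<le> t") (auto simp: dist_real_def abs_minus_commute)
      then show "dist (R x') (R t) < e" using e by (simp add: dist_real_def)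
    qed (use d in auto)
  qed
  then show ?thesis unfolding R_def .
qed

text \<open>Everything that happened before time 0 enters through the content \<open>K\<close> at time 0.\<close>

lemma queue_eq_max:
  assumes f: "continuous_on UNIV f" "f 0 = 0" and K: "queue f 0 = ereal K" and t: "0 \<le> t"
  shows "queue f t = ereal (f t - t + max K (SUP s\<in>{0..t}. s - f s))"
proof -
  have c: "continuous_on {0..t} (\<lambda>s. s - f s)"
    by (intro continuous_intros continuous_on_subset[OF f(1)]) auto
  obtain z where z: "z \<in> {0..t}" "\<And>s. s \<in> {0..t} \<Longrightarrow> s - f s \<le> z - f z"
    using continuous_attains_sup[OF compact_Icc _ c] t by auto
  have S: "(SUP s\<in>{0..t}. s - f s) = z - f z"
    by (rule cSup_eq_maximum) (use z in auto)
  have low: "s - f s \<le> K" if "s \<le> 0" for s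
  proof -
    have "ereal (f 0 - f s - (0 - s)) \<le> queue f 0" unfolding queue_def
      by (rule SUP_upper) (use that in auto)
    then show ?thesis using K f by simp
  qed
  show ?thesis unfolding queue_def S
  proof (rule SUP_eqI)
    fix s assume "s \<in> {..t}"
    then show "ereal (f t - f s - (t - s)) \<le> ereal (f t - t + max K (z - f z))"
      using low[of s] z(2)[of s] by (cases "s \<le> 0") auto
  next
    fix y assume y: "\<And>s. s \<in> {..t} \<Longrightarrow> ereal (f t - f s - (t - s)) \<le> y"
    show "ereal (f t - t + max K (z - f z)) \<le> y"
    proof (cases y)
      case (real r)
      have r: "s - f s \<le> r - f t + t" if "s \<le> t" for s using y[of s] that real by auto
      have "queue f 0 \<le> ereal (r - f t + t)" unfolding queue_def
        by (rule SUP_least) (use r t f in auto)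
      then have "K \<le> r - f t + t" using K by simp
      with r[of z] z real show ?thesis by (auto simp: max_def)
    next
      case MInf
      then show ?thesis using y[of t] t by auto
    qed auto
  qed
qed

lemma queue_0_nonneg: "0 \<le> queue f 0"
proof -
  have "ereal (f 0 - f 0 - (0 - 0)) \<le> queue f 0" unfolding queue_def by (rule SUP_upper) auto
  then show ?thesis by (simp add: zero_ereal_def)
qed

text \<open>So one value decides whether the whole trajectory is finite and continuous; this also makes the
  set of good trajectories measurable.\<close>

lemma is_cpath_queue_iff:
  assumes f: "continuous_on UNIV f" "f 0 = 0"
  shows "is_cpath (queue f) \<longleftrightarrow> queue f 0 \<noteq> \<infinity>"
proof
  assume "queue f 0 \<noteq> \<infinity>"
  with queue_0_nonneg[of f] obtain K where K: "queue f 0 = ereal K" by (cases "queue f 0") auto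
  note eq = queue_eq_max[OF f K]
  have g: "continuous_on UNIV (\<lambda>s. s - f s)" by (intro continuous_intros f)
  have "continuous_on {0..} (\<lambda>t. f t - t + max K (SUP s\<in>{0..t}. s - f s))"
    by (intro continuous_intros running_supremum_continuous[OF g] continuous_on_subset[OF f(1)]) auto
  then have "continuous_on {0..} (\<lambda>t. real_of_ereal (queue f t))"
    by (rule continuous_on_eq) (simp add: eq)
  then show "is_cpath (queue f)" unfolding is_cpath_def by (simp add: eq)
qed (auto simp: is_cpath_def)

text \<open>Every \<open>s \<le> - T\<close> contributes at most \<open>f t - t\<close>, which is the contribution of \<open>s = 0\<close>.\<close>

lemma queue_eq_queue_from:
  assumes f: "continuous_on UNIV f" "f 0 = 0" and T: "0 \<le> T" "\<And>s. s \<le> -T \<Longrightarrow> - f s \<le> - s" and t: "0 \<le> t"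
  shows "queue f t = ereal (queue_from T f t)"
proof -
  have c: "continuous_on {-T..t} (\<lambda>s. f t - f s - (t - s))"
    by (intro continuous_intros continuous_on_subset[OF f(1)]) auto
  obtain z where z: "z \<in> {-T..t}" "\<And>s. s \<in> {-T..t} \<Longrightarrow> f t - f s - (t - s) \<le> f t - f z - (t - z)"
    using continuous_attains_sup[OF compact_Icc _ c] t T(1) by auto
  have "queue_from T f t = f t - f z - (t - z)" unfolding queue_from_def
    by (rule cSup_eq_maximum) (use z in auto)
  moreover have "queue f t = ereal (f t - f z - (t - z))" unfolding queue_def
  proof (rule SUP_eqI)
    fix s assume s: "s \<in> {..t}"
    show "ereal (f t - f s - (t - s)) \<le> ereal (f t - f z - (t - z))"
    proof (cases "-T \<le> s")
      case False
      then have "- f s \<le> - s" by (intro T(2)) simp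
      then show ?thesis using z(2)[of 0] T(1) t f(2) by simp
    qed (use z(2)[of s] s in simp)
  qed (use z in auto)
  ultimately show ?thesis by simp
qed

lemma queue_from_lipschitz:
  assumes "0 \<le> T" "0 \<le> t" and d: "\<And>s. -T \<le> s \<Longrightarrow> s \<le> t \<Longrightarrow> \<bar>f s - g s\<bar> \<le> \<eta>"
    and b: "\<And>s. -T \<le> s \<Longrightarrow> s \<le> t \<Longrightarrow> \<bar>f s\<bar> \<le> B" "\<And>s. -T \<le> s \<Longrightarrow> s \<le> t \<Longrightarrow> \<bar>g s\<bar> \<le> B"
  shows "\<bar>queue_from T f t - queue_from T g t\<bar> \<le> 2 * \<eta>"
proof -
  have bdd: "bdd_above ((\<lambda>s. h t - h s - (t - s)) ` {-T..t})" if "\<And>s. -T \<le> s \<Longrightarrow> s \<le> t \<Longrightarrow> \<bar>h s\<bar> \<le> B" for h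
  proof (rule bdd_aboveI2)
    fix s assume "s \<in> {-T..t}"
    then show "h t - h s - (t - s) \<le> 2 * B" using that[of s] that[of t] assms(1,2) by auto
  qed
  have "queue_from T f' t \<le> queue_from T g' t + 2 * \<eta>"
    if "\<And>s. -T \<le> s \<Longrightarrow> s \<le> t \<Longrightarrow> \<bar>f' s - g' s\<bar> \<le> \<eta>" "\<And>s. -T \<le> s \<Longrightarrow> s \<le> t \<Longrightarrow> \<bar>g' s\<bar> \<le> B" for f' g'
    unfolding queue_from_def[of T f']
  proof (rule cSUP_least)
    fix s assume s: "s \<in> {-T..t}"
    have "g' t - g' s - (t - s) \<le> queue_from T g' t" unfolding queue_from_def
      by (rule cSUP_upper[OF s bdd]) (use that in auto)
    then show "f' t - f' s - (t - s) \<le> queue_from T g' t + 2 * \<eta>"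
      using that(1)[of s] that(1)[of t] s assms(1,2) by auto
  qed (use assms(1,2) in auto)
  from this[of f g] this[of g f] show ?thesis using d b by (force simp: abs_minus_commute)
qed

section \<open>Measurability in the path space\<close>

lemma to_cpath_eval:
  assumes "0 \<le> t"
  shows "eval_cpath (to_cpath x) t = (if is_cpath x then real_of_ereal (x t) else 0)"
proof -
  have "(\<lambda>t\<in>{0..}. if is_cpath x then real_of_ereal (x t) else 0) \<in> {f. f \<in> extensional {0..} \<and> continuous_on {0..} f}"
  proof (cases "is_cpath x")
    case True
    then have "continuous_on {0..} (\<lambda>t. real_of_ereal (x t))" by (simp add: is_cpath_def)
    then show ?thesis using True by (auto intro: continuous_on_eq)
  next
    case False
    then show ?thesis by (auto intro: continuous_on_eq[OF continuous_on_const])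
  qed
  then show ?thesis unfolding to_cpath_def by (subst Abs_cpath_inverse) (use assms in auto)
qed

lemma continuous_eval_cpath: "continuous_on {0..} (eval_cpath f)"
  using eval_cpath[of f] by simp

text \<open>The centres are step functions with rational values. They need not be continuous, and only the
  values at rational times are compared, so that there are countably many such sets and each of them
  is cut out by countably many evaluations.\<close>

definition rational_ball :: "nat \<Rightarrow> nat \<Rightarrow> rat list \<Rightarrow> cpath set" where
  "rational_ball n m l = {f. \<forall>t\<in>\<rat> \<inter> {0..real n}. \<bar>eval_cpath f t - of_rat (l ! nat \<lfloor>real m * t\<rfloor>)\<bar> \<le> 1 / real n}"

text \<open>A path that is uniformly continuous on \<open>[0, n]\<close> is within \<open>1 / n\<close> of a rational step function there,
  and any other path with this property is within \<open>2 / n\<close> of it, by continuity also at irrational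
  times.\<close>

lemma rational_ball_exists:
  assumes U: "open U" and f: "f \<in> U"
  shows "\<exists>n m l. f \<in> rational_ball n m l \<and> rational_ball n m l \<subseteq> U"
proof -
  obtain T e where T: "T > 0" "e > 0"
    and sub: "\<And>g. (\<forall>t\<in>{0..T}. dist (eval_cpath g t) (eval_cpath f t) < e) \<Longrightarrow> g \<in> U"
    using U f unfolding open_cpath_def by blast
  obtain n :: nat where n0: "max T (2 / e) < real n" using reals_Archimedean2 by blast
  then have n: "T < real n" "2 / e < real n" by auto
  then have n': "0 < real n" "2 / real n < e" using T by (auto simp: field_simps)
  have "uniformly_continuous_on {0..real n} (eval_cpath f)"
    by (intro compact_uniformly_continuous continuous_on_subset[OF continuous_eval_cpath]) auto
  then obtain d where d: "d > 0" "\<And>x y. x \<in> {0..real n} \<Longrightarrow> y \<in> {0..real n} \<Longrightarrow> dist y x < d \<Longrightarrow> dist (eval_cpath f y) (eval_cpath f x) < 1 / (2 * real n)"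
    unfolding uniformly_continuous_on_def using n' by (metis divide_pos_pos mult_pos_pos zero_less_numeral zero_less_one)
  obtain m :: nat where m: "1 / d < real m" using reals_Archimedean2 by blast
  have "0 < 1 / d" using d by simp
  with m have "0 < real m" by linarith
  then have m': "0 < real m" "1 / real m < d" using d m by (simp_all add: field_simps)
  have "\<exists>q::rat. \<bar>eval_cpath f (real i / real m) - of_rat q\<bar> < 1 / (2 * real n)" for i :: nat
  proof -
    have "eval_cpath f (real i / real m) - 1 / (2 * real n) < eval_cpath f (real i / real m) + 1 / (2 * real n)"
      using n' by (simp add: field_simps)
    from of_rat_dense[OF this] show ?thesis by (metis abs_diff_less_iff abs_minus_commute)
  qed
  then obtain q :: "nat \<Rightarrow> rat" where q: "\<And>i. \<bar>eval_cpath f (real i / real m) - of_rat (q i)\<bar> < 1 / (2 * real n)"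
    by metis
  define l where "l = map q [0..<n * m + 1]"
  have l: "l ! i = q i" if "i \<le> n * m" for i
    using that unfolding l_def by (subst nth_map) (auto simp del: upt_Suc)
  have "\<bar>eval_cpath f t - of_rat (l ! nat \<lfloor>real m * t\<rfloor>)\<bar> \<le> 1 / real n" if t: "t \<in> {0..real n}" for t
  proof -
    define i where "i = nat \<lfloor>real m * t\<rfloor>"
    have mt: "0 \<le> real m * t" using t by simp
    have i: "real i \<le> real m * t" "real m * t < real i + 1" unfolding i_def using mt by linarith+
    have "real m * t \<le> real m * real n" using t by (intro mult_left_mono) auto
    then have "real i \<le> real (n * m)" using i by (simp add: mult.commute)
    then have inm: "i \<le> n * m" by (simp only: of_nat_le_iff)
    have "real i / real m \<le> t" "t < real i / real m + 1 / real m" using i m' by (auto simp: field_simps)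
    then have "dist t (real i / real m) < d" "real i / real m \<in> {0..real n}"
      using m' t by (auto simp: dist_real_def)
    then have "dist (eval_cpath f t) (eval_cpath f (real i / real m)) < 1 / (2 * real n)"
      using d(2) t by blast
    moreover have "1 / (2 * real n) + 1 / (2 * real n) = 1 / real n" using n' by (simp add: field_simps)
    ultimately show ?thesis using q[of i] l[OF inm] unfolding i_def[symmetric] dist_real_def by (simp add: abs_if split: if_splits)
  qed
  then have "f \<in> rational_ball n m l" unfolding rational_ball_def by auto
  moreover have "rational_ball n m l \<subseteq> U"
  proof
    fix g assume g: "g \<in> rational_ball n m l"
    have Q: "\<bar>eval_cpath g t - eval_cpath f t\<bar> \<le> 2 / real n" if "t \<in> \<rat> \<inter> {0..real n}" for t
    proof -
      have "\<bar>eval_cpath g t - of_rat (l ! nat \<lfloor>real m * t\<rfloor>)\<bar> \<le> 1 / real n"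
        using g that unfolding rational_ball_def by auto
      moreover have "\<bar>eval_cpath f t - of_rat (l ! nat \<lfloor>real m * t\<rfloor>)\<bar> \<le> 1 / real n"
        using \<open>f \<in> rational_ball n m l\<close> that unfolding rational_ball_def by auto
      moreover have "2 / real n = 1 / real n + 1 / real n" by simp
      ultimately show ?thesis by linarith
    qed
    have "\<bar>eval_cpath g t - eval_cpath f t\<bar> \<le> 2 / real n" if t: "t \<in> {0..T}" for t
    proof -
      define s where "s k = real_of_int \<lceil>real (Suc k) * t\<rceil> / real (Suc k)" for k
      have s: "t \<le> s k" "s k \<le> t + 1 / real (Suc k)" "s k \<in> \<rat>" for k
      proof -
        have N: "real (Suc k) \<noteq> 0" by simp
        have "real (Suc k) * t / real (Suc k) \<le> s k" "s k \<le> (real (Suc k) * t + 1) / real (Suc k)"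
          unfolding s_def by (intro divide_right_mono; linarith)+
        then show "t \<le> s k" "s k \<le> t + 1 / real (Suc k)"
          unfolding add_divide_distrib nonzero_mult_div_cancel_left[OF N] by auto
        then show "s k \<in> \<rat>" unfolding s_def by (intro Rats_divide Rats_of_int Rats_of_nat)
      qed
      have lim: "s \<longlonglongrightarrow> t"
      proof (rule tendsto_sandwich[of "\<lambda>_. t" _ _ "\<lambda>k. t + 1 / real (Suc k)"])
        show "(\<lambda>k. t + 1 / real (Suc k)) \<longlonglongrightarrow> t"
          using tendsto_add[OF tendsto_const[of t] LIMSEQ_inverse_real_of_nat] by (simp add: inverse_eq_divide)
      qed (use s in auto)
      have ev: "\<forall>\<^sub>F k in sequentially. s k < real n" using order_tendstoD(2)[OF lim] t n by auto
      have c: "(\<lambda>k. eval_cpath h (s k)) \<longlonglongrightarrow> eval_cpath h t" for h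
        by (rule continuous_on_tendsto_compose[OF continuous_eval_cpath lim]) (use t in \<open>auto intro!: always_eventually order_trans[OF _ s(1)]\<close>)
      have "(\<lambda>k. \<bar>eval_cpath g (s k) - eval_cpath f (s k)\<bar>) \<longlonglongrightarrow> \<bar>eval_cpath g t - eval_cpath f t\<bar>"
        by (intro tendsto_intros c)
      then show ?thesis
      proof (rule tendsto_upperbound)
        show "\<forall>\<^sub>F k in sequentially. \<bar>eval_cpath g (s k) - eval_cpath f (s k)\<bar> \<le> 2 / real n"
          using ev by eventually_elim (rule Q, use s t in \<open>auto intro: order_trans\<close>)
      qed simp
    qed
    then show "g \<in> U" by (intro sub) (use n' in \<open>force simp: dist_real_def\<close>)
  qed
  ultimately show ?thesis by blast
qed

text \<open>Every open set is a countable union of rational balls, hence the evaluations generate the Borel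
  sets.\<close>

lemma cpath_borel_measurableI:
  assumes F: "\<And>t. 0 \<le> t \<Longrightarrow> (\<lambda>\<omega>. eval_cpath (F \<omega>) t) \<in> borel_measurable M"
  shows "F \<in> M \<rightarrow>\<^sub>M borel"
proof (rule borel_measurableI)
  fix U :: "cpath set" assume U: "open U"
  define I where "I = {(n, m, l). rational_ball n m l \<subseteq> U}"
  have "U = (\<Union>(n, m, l)\<in>I. rational_ball n m l)"
    using rational_ball_exists[OF U] unfolding I_def by fast
  then have "F -` U \<inter> space M = (\<Union>(n, m, l)\<in>I. {\<omega>\<in>space M. F \<omega> \<in> rational_ball n m l})"
    by auto
  also have "\<dots> \<in> sets M"
  proof (rule sets.countable_UN'')
    show "countable I" by simp
    show "(case i of (n, m, l) \<Rightarrow> {\<omega> \<in> space M. F \<omega> \<in> rational_ball n m l}) \<in> sets M" for i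
    proof (cases i)
      case (fields n m l)
      have "countable (\<rat> \<inter> {0..real n})" using countable_rat by (rule countable_subset[rotated]) auto
      moreover have "{\<omega>\<in>space M. \<bar>eval_cpath (F \<omega>) t - of_rat (l ! nat \<lfloor>real m * t\<rfloor>)\<bar> \<le> 1 / real n} \<in> sets M"
        if "t \<in> \<rat> \<inter> {0..real n}" for t
      proof -
        have [measurable]: "(\<lambda>\<omega>. eval_cpath (F \<omega>) t) \<in> borel_measurable M" using that by (intro F) auto
        show ?thesis by measurable
      qed
      ultimately have "{\<omega>\<in>space M. \<forall>t\<in>\<rat> \<inter> {0..real n}. \<bar>eval_cpath (F \<omega>) t - of_rat (l ! nat \<lfloor>real m * t\<rfloor>)\<bar> \<le> 1 / real n} \<in> sets M"
        by (intro sets.sets_Collect_countable_All') auto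
      then show ?thesis using fields unfolding rational_ball_def by simp
    qed
  qed
  finally show "F -` U \<inter> space M \<in> sets M" .
qed

text \<open>The lags \<open>i / Suc n\<close> are dense in the half line.\<close>

lemma queue_SUP_countable:
  assumes f: "continuous_on UNIV f"
  shows "queue f t = (SUP (i, n)\<in>(UNIV :: (nat \<times> nat) set). ereal (f t - f (t - real i / real (Suc n)) - real i / real (Suc n)))"
    (is "_ = ?R")
proof (rule antisym)
  show "queue f t \<le> ?R" unfolding queue_def
  proof (rule SUP_least)
    fix s assume "s \<in> {..t}"
    then have r: "0 \<le> t - s" by simp
    define i where "i n = nat \<lfloor>real (Suc n) * (t - s)\<rfloor>" for n
    define p where "p n = real (i n) / real (Suc n)" for n
    have b: "t - s - 1 / real (Suc n) \<le> p n" "p n \<le> t - s" for n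
    proof -
      have "0 \<le> real (Suc n) * (t - s)" using r by (intro mult_nonneg_nonneg) auto
      then have "real (i n) \<le> real (Suc n) * (t - s)" "real (Suc n) * (t - s) - 1 \<le> real (i n)"
        unfolding i_def by linarith+
      then have "real (i n) / real (Suc n) \<le> real (Suc n) * (t - s) / real (Suc n)"
          "(real (Suc n) * (t - s) - 1) / real (Suc n) \<le> real (i n) / real (Suc n)"
        by (intro divide_right_mono; simp only: of_nat_0_le_iff)+
      moreover have N: "real (Suc n) \<noteq> 0" by simp
      ultimately show "t - s - 1 / real (Suc n) \<le> p n" "p n \<le> t - s"
        unfolding p_def diff_divide_distrib nonzero_mult_div_cancel_left[OF N] by auto
    qed
    have lim: "p \<longlonglongrightarrow> t - s"
    proof (rule tendsto_sandwich[of "\<lambda>k. t - s - 1 / real (Suc k)" _ _ "\<lambda>_. t - s"])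
      show "(\<lambda>k. t - s - 1 / real (Suc k)) \<longlonglongrightarrow> t - s"
        using tendsto_diff[OF tendsto_const[of "t - s"] LIMSEQ_inverse_real_of_nat] by (simp add: inverse_eq_divide)
    qed (use b in auto)
    have "(\<lambda>n. t - p n) \<longlonglongrightarrow> t - (t - s)" by (intro tendsto_intros lim)
    then have "(\<lambda>n. f (t - p n)) \<longlonglongrightarrow> f (t - (t - s))"
      by (rule continuous_on_tendsto_compose[OF f]) auto
    then have "(\<lambda>n. f t - f (t - p n) - p n) \<longlonglongrightarrow> f t - f s - (t - s)"
      by (intro tendsto_intros lim) simp
    then have "(\<lambda>n. ereal (f t - f (t - p n) - p n)) \<longlonglongrightarrow> ereal (f t - f s - (t - s))" by simp
    then show "ereal (f t - f s - (t - s)) \<le> ?R"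
    proof (rule tendsto_upperbound)
      show "\<forall>\<^sub>F n in sequentially. ereal (f t - f (t - p n) - p n) \<le> ?R"
        unfolding p_def by (intro always_eventually allI SUP_upper2[of "(i _, _)"]) auto
    qed simp
  qed
next
  show "?R \<le> queue f t" unfolding queue_def
    by (rule SUP_least) (auto intro!: SUP_upper2[of "t - real _ / real (Suc _)"])
qed

lemma buffer_eq_queue: "buffer Y 1 t \<omega> = queue (\<lambda>s. Y s \<omega>) t"
  unfolding buffer_def queue_def by simp

lemma queue_measurable:
  assumes [measurable]: "\<And>s. Y s \<in> borel_measurable M"
    and c: "\<And>\<omega>. \<omega> \<in> space M \<Longrightarrow> continuous_on UNIV (\<lambda>s. Y s \<omega>)"
  shows "(\<lambda>\<omega>. queue (\<lambda>s. Y s \<omega>) t) \<in> borel_measurable M"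
proof -
  have "(\<lambda>\<omega>. SUP (i, n)\<in>(UNIV :: (nat \<times> nat) set). ereal (Y t \<omega> - Y (t - real i / real (Suc n)) \<omega> - real i / real (Suc n))) \<in> borel_measurable M"
    by (rule borel_measurable_SUP) auto
  then show ?thesis
    by (rule measurable_cong[THEN iffD1, rotated]) (use queue_SUP_countable[OF c] in simp)
qed

text \<open>Linear growth at minus infinity makes the content at time 0 finite almost surely.\<close>

lemma random_cpath_queue:
  assumes [measurable]: "\<And>s. Y s \<in> borel_measurable M"
    and c: "\<And>\<omega>. \<omega> \<in> space M \<Longrightarrow> continuous_on UNIV (\<lambda>s. Y s \<omega>)"
    and z: "\<And>\<omega>. \<omega> \<in> space M \<Longrightarrow> Y 0 \<omega> = 0"
    and growth: "AE \<omega> in M. \<exists>R>0. \<forall>s\<le>-R. \<bar>Y s \<omega>\<bar> \<le> \<bar>s\<bar>"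
  shows "random_cpath M (\<lambda>t \<omega>. queue (\<lambda>s. Y s \<omega>) t)"
proof -
  have AE: "AE \<omega> in M. is_cpath (queue (\<lambda>s. Y s \<omega>))"
    using growth
  proof (rule AE_mp, intro AE_I2 impI)
    fix \<omega> assume w: "\<omega> \<in> space M" and "\<exists>R>0. \<forall>s\<le>-R. \<bar>Y s \<omega>\<bar> \<le> \<bar>s\<bar>"
    then obtain R where R: "R > 0" "\<And>s. s \<le> -R \<Longrightarrow> \<bar>Y s \<omega>\<bar> \<le> \<bar>s\<bar>" by blast
    have "queue (\<lambda>s. Y s \<omega>) 0 = ereal (queue_from R (\<lambda>s. Y s \<omega>) 0)"
      by (rule queue_eq_queue_from[OF c[OF w] z[OF w]]) (use R in \<open>force+\<close>)
    then show "is_cpath (queue (\<lambda>s. Y s \<omega>))"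
      by (subst is_cpath_queue_iff[OF c[OF w] z[OF w]]) simp
  qed
  have qm[measurable]: "(\<lambda>\<omega>. queue (\<lambda>s. Y s \<omega>) t) \<in> borel_measurable M" for t
    by (rule queue_measurable) (use c in auto)
  have "(\<lambda>\<omega>. to_cpath (queue (\<lambda>s. Y s \<omega>))) \<in> M \<rightarrow>\<^sub>M borel"
  proof (rule cpath_borel_measurableI)
    fix t :: real assume t: "0 \<le> t"
    have "(\<lambda>\<omega>. if queue (\<lambda>s. Y s \<omega>) 0 \<noteq> \<infinity> then real_of_ereal (queue (\<lambda>s. Y s \<omega>) t) else 0) \<in> borel_measurable M"
      by measurable
    then show "(\<lambda>\<omega>. eval_cpath (to_cpath (queue (\<lambda>s. Y s \<omega>))) t) \<in> borel_measurable M"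
      by (rule measurable_cong[THEN iffD1, rotated])
        (simp add: to_cpath_eval[OF t] is_cpath_queue_iff[OF c z])
  qed
  with AE show ?thesis unfolding random_cpath_def by simp
qed

section \<open>Weak convergence through Lipschitz envelopes\<close>

text \<open>The Lipschitz envelope of \<open>\<phi>\<close> from below with constant \<open>k\<close>, for the supremum distance on
  \<open>[0, k]\<close>. It is defined for arbitrary functions \<open>x\<close>, so it can be evaluated at the discontinuous
  paths of a discretised buffer; capping it by \<open>C\<close> keeps it bounded when \<open>x\<close> is far from every
  continuous path.\<close>

definition envelope :: "(cpath \<Rightarrow> real) \<Rightarrow> real \<Rightarrow> nat \<Rightarrow> (real \<Rightarrow> real) \<Rightarrow> real" where
  "envelope \<phi> C k x = Inf (insert C {\<phi> y + real k * \<eta> | y \<eta>. 0 \<le> \<eta> \<and> (\<forall>t\<in>{0..real k}. \<bar>x t - eval_cpath y t\<bar> \<le> \<eta>)})"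

context
  fixes \<phi> :: "cpath \<Rightarrow> real" and C :: real
  assumes bound: "\<And>y. \<bar>\<phi> y\<bar> \<le> C"
begin

lemma C_nonneg: "0 \<le> C"
  using bound[of undefined] by linarith

lemma envelope_set_bdd: "bdd_below (insert C {\<phi> y + real k * \<eta> | y \<eta>. 0 \<le> \<eta> \<and> (\<forall>t\<in>{0..real k}. \<bar>x t - eval_cpath y t\<bar> \<le> \<eta>)})"
proof (rule bdd_belowI[of _ "- C"])
  fix v assume "v \<in> insert C {\<phi> y + real k * \<eta> | y \<eta>. 0 \<le> \<eta> \<and> (\<forall>t\<in>{0..real k}. \<bar>x t - eval_cpath y t\<bar> \<le> \<eta>)}"
  then show "- C \<le> v"
  proof
    assume "v \<in> {\<phi> y + real k * \<eta> | y \<eta>. 0 \<le> \<eta> \<and> (\<forall>t\<in>{0..real k}. \<bar>x t - eval_cpath y t\<bar> \<le> \<eta>)}"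
    then obtain y \<eta> where v: "v = \<phi> y + real k * \<eta>" "0 \<le> \<eta>" by blast
    have "0 \<le> real k * \<eta>" using v by simp
    with bound[of y] v show ?thesis by linarith
  qed (use C_nonneg in simp)
qed

lemma envelope_le: "envelope \<phi> C k x \<le> C"
  unfolding envelope_def by (rule cInf_lower[OF _ envelope_set_bdd]) simp

lemma envelope_le_candidate:
  assumes "0 \<le> \<eta>" "\<And>t. 0 \<le> t \<Longrightarrow> t \<le> real k \<Longrightarrow> \<bar>x t - eval_cpath y t\<bar> \<le> \<eta>"
  shows "envelope \<phi> C k x \<le> \<phi> y + real k * \<eta>"
  unfolding envelope_def
  by (rule cInf_lower[OF _ envelope_set_bdd], intro insertI2 CollectI exI[of _ y] exI[of _ \<eta>]) (use assms in auto)

lemma envelope_greatest: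
  assumes "a \<le> C" "\<And>y \<eta>. 0 \<le> \<eta> \<Longrightarrow> (\<And>t. 0 \<le> t \<Longrightarrow> t \<le> real k \<Longrightarrow> \<bar>x t - eval_cpath y t\<bar> \<le> \<eta>) \<Longrightarrow> a \<le> \<phi> y + real k * \<eta>"
  shows "a \<le> envelope \<phi> C k x"
  unfolding envelope_def by (rule cInf_greatest) (use assms in auto)

lemma envelope_abs_le: "\<bar>envelope \<phi> C k x\<bar> \<le> C"
proof -
  have "- C \<le> envelope \<phi> C k x"
  proof (rule envelope_greatest)
    fix y \<eta> assume "0 \<le> (\<eta>::real)"
    then have "0 \<le> real k * \<eta>" by simp
    with bound[of y] show "- C \<le> \<phi> y + real k * \<eta>" by linarith
  qed (use C_nonneg in simp)
  with envelope_le[of k x] show ?thesis by linarith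
qed

lemma envelope_le_eval: "envelope \<phi> C k (eval_cpath y) \<le> \<phi> y"
  using envelope_le_candidate[of 0 k "eval_cpath y" y] by simp

lemma envelope_lipschitz:
  assumes e: "0 \<le> e" "\<And>t. 0 \<le> t \<Longrightarrow> t \<le> real k \<Longrightarrow> \<bar>x t - x' t\<bar> \<le> e"
  shows "\<bar>envelope \<phi> C k x - envelope \<phi> C k x'\<bar> \<le> real k * e"
proof -
  have ke: "0 \<le> real k * e" using e by simp
  have "envelope \<phi> C k x - real k * e \<le> envelope \<phi> C k x'"
    if d: "\<And>t. 0 \<le> t \<Longrightarrow> t \<le> real k \<Longrightarrow> \<bar>x t - x' t\<bar> \<le> e" for x x'
  proof (rule envelope_greatest)
    show "envelope \<phi> C k x - real k * e \<le> C" using envelope_le[of k x] ke by linarith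
    fix y \<eta> assume \<eta>: "0 \<le> (\<eta>::real)" and y: "\<And>t. 0 \<le> t \<Longrightarrow> t \<le> real k \<Longrightarrow> \<bar>x' t - eval_cpath y t\<bar> \<le> \<eta>"
    have "envelope \<phi> C k x \<le> \<phi> y + real k * (\<eta> + e)"
    proof (rule envelope_le_candidate)
      fix t assume t: "0 \<le> t" "t \<le> real k"
      show "\<bar>x t - eval_cpath y t\<bar> \<le> \<eta> + e" using d[OF t] y[OF t] by linarith
    qed (use \<eta> e in simp)
    then show "envelope \<phi> C k x - real k * e \<le> \<phi> y + real k * \<eta>" by (simp add: algebra_simps)
  qed
  from this[of x x'] this[of x' x] show ?thesis using e(2) by (simp add: abs_minus_commute abs_le_iff)
qed

lemma envelope_cong:
  assumes "\<And>t. 0 \<le> t \<Longrightarrow> t \<le> real k \<Longrightarrow> x t = x' t"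
  shows "envelope \<phi> C k x = envelope \<phi> C k x'"
  using envelope_lipschitz[of 0 k x x'] assms by simp

text \<open>A competitor \<open>y\<close> near \<open>x\<close> on \<open>[0, k]\<close> has \<open>\<phi> y\<close> almost as large as \<open>\<phi> x\<close>, by continuity; a competitor
  at distance at least \<open>e\<close> pays the penalty \<open>k * e \<ge> 2 * C\<close>.\<close>

lemma envelope_tendsto:
  assumes c: "continuous_on UNIV \<phi>"
  shows "(\<lambda>k. envelope \<phi> C k (eval_cpath x)) \<longlonglongrightarrow> \<phi> x"
proof (rule LIMSEQ_I)
  fix r :: real assume r: "0 < r"
  have "open (\<phi> -` {\<phi> x - r / 2<..})"
    using c by (subst (asm) continuous_on_open_vimage) auto
  then obtain T e where T: "T > 0" "e > 0"
    and sub: "\<And>g. (\<forall>t\<in>{0..T}. dist (eval_cpath g t) (eval_cpath x t) < e) \<Longrightarrow> g \<in> \<phi> -` {\<phi> x - r / 2<..}"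
    unfolding open_cpath_def using r by force
  obtain n :: nat where n: "max T (2 * C / e) < real n" using reals_Archimedean2 by blast
  have "norm (envelope \<phi> C k (eval_cpath x) - \<phi> x) < r" if k: "k \<ge> n" for k
  proof -
    have k': "T < real k" "2 * C / e < real k" using n k by auto
    then have ke: "2 * C \<le> real k * e" using T by (simp add: field_simps)
    have "\<phi> x - r / 2 \<le> envelope \<phi> C k (eval_cpath x)"
    proof (rule envelope_greatest)
      show "\<phi> x - r / 2 \<le> C" using bound[of x] r by linarith
      fix y \<eta> assume \<eta>: "0 \<le> (\<eta>::real)" and y: "\<And>t. 0 \<le> t \<Longrightarrow> t \<le> real k \<Longrightarrow> \<bar>eval_cpath x t - eval_cpath y t\<bar> \<le> \<eta>"
      show "\<phi> x - r / 2 \<le> \<phi> y + real k * \<eta>"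
      proof (cases "\<eta> < e")
        case True
        have "y \<in> \<phi> -` {\<phi> x - r / 2<..}"
        proof (rule sub, intro ballI)
          fix t assume "t \<in> {0..T}"
          then show "dist (eval_cpath y t) (eval_cpath x t) < e"
            using y[of t] True k' by (auto simp: dist_real_def abs_minus_commute)
        qed
        moreover have "0 \<le> real k * \<eta>" using \<eta> by simp
        ultimately show ?thesis by simp
      next
        case False
        then have "real k * e \<le> real k * \<eta>" by (intro mult_left_mono) auto
        then show ?thesis using ke bound[of x] bound[of y] r by linarith
      qed
    qed
    with envelope_le_eval[of k x] r show ?thesis by simp
  qed
  then show "\<exists>no. \<forall>k\<ge>no. norm (envelope \<phi> C k (eval_cpath x) - \<phi> x) < r" by blast
qed

lemma envelope_continuous: "continuous_on UNIV (\<lambda>f. envelope \<phi> C k (eval_cpath f))"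
  unfolding continuous_on_open_vimage[OF open_UNIV]
proof (intro allI impI)
  fix B :: "real set" assume B: "open B"
  show "open ((\<lambda>f. envelope \<phi> C k (eval_cpath f)) -` B \<inter> UNIV)"
    unfolding open_cpath_def
  proof
    fix f assume "f \<in> (\<lambda>f. envelope \<phi> C k (eval_cpath f)) -` B \<inter> UNIV"
    then obtain \<epsilon> where \<epsilon>: "\<epsilon> > 0" "ball (envelope \<phi> C k (eval_cpath f)) \<epsilon> \<subseteq> B"
      using B openE by blast
    define e where "e = \<epsilon> / (2 * (real k + 1))"
    have e: "0 < e" using \<epsilon> by (simp add: e_def)
    have "real k * e = \<epsilon> / 2 * (real k / (real k + 1))" by (simp add: e_def)
    also have "\<dots> \<le> \<epsilon> / 2 * 1" using \<epsilon> by (intro mult_left_mono) auto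
    finally have ke: "real k * e < \<epsilon>" using \<epsilon> by simp
    show "\<exists>T>0. \<exists>e>0. \<forall>g. (\<forall>t\<in>{0..T}. dist (eval_cpath g t) (eval_cpath f t) < e) \<longrightarrow> g \<in> (\<lambda>f. envelope \<phi> C k (eval_cpath f)) -` B \<inter> UNIV"
    proof (rule exI[of _ "real k + 1"], intro conjI, simp, rule exI[of _ e], intro conjI allI impI)
      fix g assume g: "\<forall>t\<in>{0..real k + 1}. dist (eval_cpath g t) (eval_cpath f t) < e"
      have "\<bar>envelope \<phi> C k (eval_cpath g) - envelope \<phi> C k (eval_cpath f)\<bar> \<le> real k * e"
        by (rule envelope_lipschitz) (use g e in \<open>auto simp: dist_real_def intro: less_imp_le\<close>)
      then have "envelope \<phi> C k (eval_cpath g) \<in> ball (envelope \<phi> C k (eval_cpath f)) \<epsilon>"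
        using ke by (simp add: dist_real_def abs_minus_commute)
      with \<epsilon> show "g \<in> (\<lambda>f. envelope \<phi> C k (eval_cpath f)) -` B \<inter> UNIV" by blast
    qed (use e in auto)
  qed
qed

lemma envelope_measurable:
  "F \<in> M \<rightarrow>\<^sub>M borel \<Longrightarrow> (\<lambda>\<omega>. envelope \<phi> C k (eval_cpath (F \<omega>))) \<in> borel_measurable M"
  by (rule measurable_compose[OF _ borel_measurable_continuous_onI[OF envelope_continuous]])

end

text \<open>The envelopes lie below \<open>\<phi>\<close> and converge to it, so one of them has expectation above \<open>a\<close> under the
  limit law, and eventually also under the approximating laws.\<close>

lemma portmanteau_lower:
  assumes M: "prob_space M" and N: "prob_space N"
    and F: "\<And>n::nat. F n \<in> M \<rightarrow>\<^sub>M borel" and G: "G \<in> N \<rightarrow>\<^sub>M borel"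
    and c: "continuous_on UNIV \<phi>" and bound: "\<And>y. \<bar>\<phi> y\<bar> \<le> C"
    and conv: "\<And>k. (\<lambda>n. \<integral>\<omega>. envelope \<phi> C k (eval_cpath (F n \<omega>)) \<partial>M) \<longlonglongrightarrow> (\<integral>\<omega>. envelope \<phi> C k (eval_cpath (G \<omega>)) \<partial>N)"
    and a: "a < (\<integral>\<omega>. \<phi> (G \<omega>) \<partial>N)"
  shows "\<forall>\<^sub>F n in sequentially. a < (\<integral>\<omega>. \<phi> (F n \<omega>) \<partial>M)"
proof -
  interpret M: prob_space M by fact
  interpret N: prob_space N by fact
  have \<phi>m: "\<phi> \<in> borel_measurable borel" by (rule borel_measurable_continuous_onI[OF c])
  have "(\<lambda>k. \<integral>\<omega>. envelope \<phi> C k (eval_cpath (G \<omega>)) \<partial>N) \<longlonglongrightarrow> (\<integral>\<omega>. \<phi> (G \<omega>) \<partial>N)"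
    by (rule integral_dominated_convergence[where w = "\<lambda>_. C"])
      (use envelope_tendsto[OF bound c] envelope_abs_le[OF bound] envelope_measurable[OF bound G] measurable_compose[OF G \<phi>m] in auto)
  then have "\<forall>\<^sub>F k in sequentially. a < (\<integral>\<omega>. envelope \<phi> C k (eval_cpath (G \<omega>)) \<partial>N)"
    using a by (rule order_tendstoD)
  then obtain k where k: "a < (\<integral>\<omega>. envelope \<phi> C k (eval_cpath (G \<omega>)) \<partial>N)"
    using eventually_happens'[OF sequentially_bot] by blast
  have "\<forall>\<^sub>F n in sequentially. a < (\<integral>\<omega>. envelope \<phi> C k (eval_cpath (F n \<omega>)) \<partial>M)"
    using conv k by (rule order_tendstoD)
  then show ?thesis
  proof eventually_elim
    case (elim n)
    also have "(\<integral>\<omega>. envelope \<phi> C k (eval_cpath (F n \<omega>)) \<partial>M) \<le> (\<integral>\<omega>. \<phi> (F n \<omega>) \<partial>M)"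
    proof (rule integral_mono)
      show "integrable M (\<lambda>\<omega>. envelope \<phi> C k (eval_cpath (F n \<omega>)))"
        by (rule M.integrable_const_bound[of _ C]) (use envelope_abs_le[OF bound] envelope_measurable[OF bound F] in auto)
      show "integrable M (\<lambda>\<omega>. \<phi> (F n \<omega>))"
        by (rule M.integrable_const_bound[of _ C]) (use bound measurable_compose[OF F \<phi>m] in auto)
    qed (rule envelope_le_eval[OF bound])
    finally show ?case .
  qed
qed

text \<open>The lower bound for \<open>\<phi>\<close> and for \<open>- \<phi>\<close>.\<close>

lemma portmanteau_envelope:
  fixes \<phi> :: "cpath \<Rightarrow> real"
  assumes M: "prob_space M" and N: "prob_space N"
    and F: "\<And>n::nat. F n \<in> M \<rightarrow>\<^sub>M borel" and G: "G \<in> N \<rightarrow>\<^sub>M borel"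
    and conv: "\<And>\<phi> C k. (\<And>y. \<bar>\<phi> y\<bar> \<le> C) \<Longrightarrow> (\<lambda>n. \<integral>\<omega>. envelope \<phi> C k (eval_cpath (F n \<omega>)) \<partial>M) \<longlonglongrightarrow> (\<integral>\<omega>. envelope \<phi> C k (eval_cpath (G \<omega>)) \<partial>N)"
    and c: "continuous_on UNIV \<phi>" and b: "bounded (range \<phi>)"
  shows "(\<lambda>n. \<integral>\<omega>. \<phi> (F n \<omega>) \<partial>M) \<longlonglongrightarrow> (\<integral>\<omega>. \<phi> (G \<omega>) \<partial>N)"
proof -
  obtain C where bound: "\<And>y. \<bar>\<phi> y\<bar> \<le> C" using b by (auto simp: bounded_iff)
  have bound': "\<bar>- \<phi> y\<bar> \<le> C" for y using bound by simp
  show ?thesis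
  proof (rule order_tendstoI)
    fix a assume "a < (\<integral>\<omega>. \<phi> (G \<omega>) \<partial>N)"
    then show "\<forall>\<^sub>F n in sequentially. a < (\<integral>\<omega>. \<phi> (F n \<omega>) \<partial>M)"
      by (rule portmanteau_lower[OF M N F G c bound conv[OF bound]])
  next
    fix a assume "(\<integral>\<omega>. \<phi> (G \<omega>) \<partial>N) < a"
    then show "\<forall>\<^sub>F n in sequentially. (\<integral>\<omega>. \<phi> (F n \<omega>) \<partial>M) < a"
      using portmanteau_lower[OF M N F G continuous_on_minus[OF c] bound' conv[OF bound'], of "- a"] by simp
  qed
qed

section \<open>From characteristic functions to Lipschitz functionals\<close>

lemma lipschitz_coordinates_measurable:
  fixes \<psi> :: "(nat \<Rightarrow> real) \<Rightarrow> real"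
  assumes "\<And>x y. \<bar>\<psi> x - \<psi> y\<bar> \<le> L * (\<Sum>i<d. \<bar>x i - y i\<bar>)"
  shows "\<psi> \<in> borel_measurable borel"
proof (rule borel_measurable_continuous_onI, rule continuous_at_imp_continuous_on, safe)
  fix x :: "nat \<Rightarrow> real"
  have c: "((\<lambda>y. y i) \<longlongrightarrow> x i) (at x)" for i
    using continuous_on_product_coordinates[of i] unfolding continuous_on_def by auto
  have "((\<lambda>y. L * (\<Sum>i<d. \<bar>y i - x i\<bar>)) \<longlongrightarrow> L * (\<Sum>i<d. \<bar>x i - x i\<bar>)) (at x)"
    by (intro tendsto_intros c)
  then have lim: "((\<lambda>y. L * (\<Sum>i<d. \<bar>y i - x i\<bar>)) \<longlongrightarrow> 0) (at x)" by simp
  have "((\<lambda>y. \<psi> y - \<psi> x) \<longlongrightarrow> 0) (at x)"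
    by (rule Lim_null_comparison[OF _ lim]) (use assms in auto)
  then show "isCont \<psi> x" unfolding isCont_def using LIM_zero_cancel by blast
qed

lemma one_minus_gaussian_le: "1 - exp (- (z\<^sup>2 / 2)) \<le> \<bar>z\<bar>" for z :: real
proof (cases "\<bar>z\<bar> \<le> 1")
  case True
  have "1 - exp (- (z\<^sup>2 / 2)) \<le> z\<^sup>2 / 2" using exp_ge_add_one_self[of "- (z\<^sup>2 / 2)"] by simp
  also have "\<dots> \<le> \<bar>z\<bar> * \<bar>z\<bar>" by (simp add: power2_eq_square abs_mult[symmetric])
  also have "\<dots> \<le> \<bar>z\<bar> * 1" using True by (intro mult_left_mono) auto
  finally show ?thesis by simp
next
  case False
  have "0 < exp (- (z\<^sup>2 / 2))" by simp
  then show ?thesis using False by linarith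
qed

text \<open>The function \<open>\<psi>\<close>, damped by a Gaussian factor of width \<open>R\<close> in coordinate \<open>j\<close>, is averaged over a
  normal perturbation of that coordinate with standard deviation \<open>\<epsilon>\<close>. The damping makes the average,
  as a function of coordinate \<open>j\<close>, a superposition of exponentials over a finite measure.\<close>

definition smoothing :: "real \<Rightarrow> real \<Rightarrow> nat \<Rightarrow> ((nat \<Rightarrow> real) \<Rightarrow> real) \<Rightarrow> (nat \<Rightarrow> real) \<Rightarrow> real" where
  "smoothing \<epsilon> R j \<psi> x = (\<integral>y. \<psi> (x(j := y)) * exp (- ((y / R)\<^sup>2 / 2)) * normal_density (x j) \<epsilon> y \<partial>lborel)"

lemma measurable_fun_upd_nat [measurable]:
  fixes V :: "nat \<Rightarrow> 'a \<Rightarrow> real"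
  assumes [measurable]: "\<And>i. V i \<in> borel_measurable M" "Y \<in> borel_measurable M"
  shows "(\<lambda>\<omega>. (\<lambda>i. V i \<omega>)(j := Y \<omega>)) \<in> M \<rightarrow>\<^sub>M borel"
proof (rule measurable_coordinatewise_then_product)
  show "(\<lambda>\<omega>. ((\<lambda>i. V i \<omega>)(j := Y \<omega>)) i) \<in> borel_measurable M" for i
    by (cases "i = j") auto
qed

lemma measurable_section:
  assumes "\<psi> \<in> borel_measurable (borel :: (nat \<Rightarrow> real) measure)"
  shows "(\<lambda>y. \<psi> (x(j := y))) \<in> borel_measurable borel"
proof -
  have "(\<lambda>y. (\<lambda>i. x i)(j := y)) \<in> borel \<rightarrow>\<^sub>M borel"
    by (rule measurable_fun_upd_nat[of "\<lambda>i _. x i"]) auto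
  from measurable_compose[OF this assms] show ?thesis .
qed

lemma smoothing_measurable:
  fixes \<psi> :: "(nat \<Rightarrow> real) \<Rightarrow> real"
  assumes [measurable]: "\<psi> \<in> borel_measurable borel"
  shows "smoothing \<epsilon> R j \<psi> \<in> borel_measurable borel"
proof -
  have [measurable]: "(\<lambda>q. fst q i) \<in> borel_measurable (borel \<Otimes>\<^sub>M lborel)" for i :: nat
    by (rule measurable_compose[OF measurable_fst]) (intro borel_measurable_continuous_onI continuous_on_product_coordinates)
  have [measurable]: "(\<lambda>q :: (nat \<Rightarrow> real) \<times> real. \<psi> ((fst q)(j := snd q))) \<in> borel_measurable (borel \<Otimes>\<^sub>M lborel)"
    using measurable_compose[OF measurable_fun_upd_nat[of "\<lambda>i q. fst q i" "borel \<Otimes>\<^sub>M lborel" snd j] assms] by simp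
  show ?thesis unfolding smoothing_def[abs_def]
    by (rule lborel.borel_measurable_lebesgue_integral) (simp add: case_prod_beta' normal_density_def)
qed

lemma smoothing_bounded:
  fixes \<psi> :: "(nat \<Rightarrow> real) \<Rightarrow> real"
  assumes C: "\<And>x. \<bar>\<psi> x\<bar> \<le> C" and pos: "0 < \<epsilon>"
  shows "\<bar>smoothing \<epsilon> R j \<psi> x\<bar> \<le> C"
proof -
  have C0: "0 \<le> C" using C[of undefined] by linarith
  have "\<bar>smoothing \<epsilon> R j \<psi> x\<bar> \<le> (\<integral>y. \<bar>\<psi> (x(j := y)) * exp (- ((y / R)\<^sup>2 / 2)) * normal_density (x j) \<epsilon> y\<bar> \<partial>lborel)"
    unfolding smoothing_def by (rule integral_abs_bound)
  also have "\<dots> \<le> (\<integral>y. C * normal_density (x j) \<epsilon> y \<partial>lborel)"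
  proof (rule integral_mono')
    fix y
    have "\<bar>\<psi> (x(j := y))\<bar> * exp (- ((y / R)\<^sup>2 / 2)) \<le> C * 1" using C C0 by (intro mult_mono) auto
    then have "\<bar>\<psi> (x(j := y))\<bar> * exp (- ((y / R)\<^sup>2 / 2)) * normal_density (x j) \<epsilon> y \<le> C * normal_density (x j) \<epsilon> y"
      by (intro mult_right_mono) auto
    then show "\<bar>\<psi> (x(j := y)) * exp (- ((y / R)\<^sup>2 / 2)) * normal_density (x j) \<epsilon> y\<bar> \<le> C * normal_density (x j) \<epsilon> y"
      by (simp add: abs_mult)
    show "0 \<le> C * normal_density (x j) \<epsilon> y" using C0 by simp
  qed (use pos in auto)
  also have "\<dots> = C" using pos by simp
  finally show ?thesis .
qed

text \<open>The perturbation moves coordinate \<open>j\<close> by at most \<open>\<epsilon>\<close> on average, and the damping factor differs from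
  1 by at most \<open>\<bar>y\<bar> / R\<close>.\<close>

lemma smoothing_error:
  fixes \<psi> :: "(nat \<Rightarrow> real) \<Rightarrow> real"
  assumes lip: "\<And>x y. \<bar>\<psi> x - \<psi> y\<bar> \<le> L * (\<Sum>i<d. \<bar>x i - y i\<bar>)" and C: "\<And>x. \<bar>\<psi> x\<bar> \<le> C"
    and j: "j < d" and pos: "0 < \<epsilon>" "0 < R" and L: "0 \<le> L"
  shows "\<bar>smoothing \<epsilon> R j \<psi> x - \<psi> x\<bar> \<le> (L + C / R) * \<epsilon> + C / R * \<bar>x j\<bar>"
proof -
  let ?n = "normal_density (x j) \<epsilon>"
  let ?h = "\<lambda>y. exp (- ((y / R)\<^sup>2 / 2))"
  have C0: "0 \<le> C" using C[of x] by linarith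
  have [measurable]: "\<psi> \<in> borel_measurable borel" by (rule lipschitz_coordinates_measurable[OF lip])
  have [measurable]: "(\<lambda>y. \<psi> (x(j := y))) \<in> borel_measurable borel"
    by (rule measurable_section) simp
  have in_n: "integrable lborel ?n" and i_n: "integral\<^sup>L lborel ?n = 1" using pos by auto
  have in_a: "integrable lborel (\<lambda>y. ?n y * \<bar>y - x j\<bar>)"
    using integrable_normal_moment_abs[OF pos(1), of "x j" 1] by simp
  have i_a: "integral\<^sup>L lborel (\<lambda>y. ?n y * \<bar>y - x j\<bar>) \<le> \<epsilon>"
  proof -
    have "integral\<^sup>L lborel (\<lambda>y. ?n y * \<bar>y - x j\<bar>) = \<epsilon> * sqrt (2 / pi)"
      using integral_normal_moment_abs_odd[OF pos(1), of "x j" 0] by simp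
    also have "\<dots> \<le> \<epsilon> * 1"
      using pos pi_gt3 by (intro mult_left_mono) auto
    finally show ?thesis by simp
  qed
  have hb: "0 \<le> ?h y" "?h y \<le> 1" for y by auto
  have in_p: "integrable lborel (\<lambda>y. \<psi> (x(j := y)) * ?h y * ?n y)"
  proof (rule Bochner_Integration.integrable_bound[of _ "\<lambda>y. C * ?n y"])
    show "AE y in lborel. norm (\<psi> (x(j := y)) * ?h y * ?n y) \<le> norm (C * ?n y)"
    proof (rule AE_I2)
      fix y
      have "\<bar>\<psi> (x(j := y))\<bar> * ?h y \<le> C * 1" using C hb C0 by (intro mult_mono) auto
      then have "\<bar>\<psi> (x(j := y))\<bar> * ?h y * ?n y \<le> C * ?n y" by (intro mult_right_mono) auto
      then show "norm (\<psi> (x(j := y)) * ?h y * ?n y) \<le> norm (C * ?n y)" using C0 by (simp add: abs_mult)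
    qed
  qed (use in_n in auto)
  have "smoothing \<epsilon> R j \<psi> x - \<psi> x = (\<integral>y. \<psi> (x(j := y)) * ?h y * ?n y \<partial>lborel) - (\<integral>y. \<psi> x * ?n y \<partial>lborel)"
    unfolding smoothing_def using i_n by simp
  also have "\<dots> = (\<integral>y. \<psi> (x(j := y)) * ?h y * ?n y - \<psi> x * ?n y \<partial>lborel)"
    using in_p in_n by simp
  finally have "smoothing \<epsilon> R j \<psi> x - \<psi> x = (\<integral>y. \<psi> (x(j := y)) * ?h y * ?n y - \<psi> x * ?n y \<partial>lborel)" .
  then have "\<bar>smoothing \<epsilon> R j \<psi> x - \<psi> x\<bar> \<le> (\<integral>y. \<bar>\<psi> (x(j := y)) * ?h y * ?n y - \<psi> x * ?n y\<bar> \<partial>lborel)"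
    by (simp only: integral_abs_bound)
  also have "\<dots> \<le> (\<integral>y. (L + C / R) * (?n y * \<bar>y - x j\<bar>) + C / R * \<bar>x j\<bar> * ?n y \<partial>lborel)"
  proof (rule integral_mono)
    fix y
    have l: "\<bar>\<psi> (x(j := y)) - \<psi> x\<bar> \<le> L * \<bar>y - x j\<bar>"
    proof -
      have "(\<Sum>i<d. \<bar>(x(j := y)) i - x i\<bar>) = (\<Sum>i<d. if i = j then \<bar>y - x j\<bar> else 0)"
        by (intro sum.cong) auto
      also have "\<dots> = \<bar>y - x j\<bar>" using j by simp
      finally show ?thesis using lip[of "x(j := y)" x] by simp
    qed
    have "\<bar>\<psi> (x(j := y)) * ?h y - \<psi> x\<bar> = \<bar>(\<psi> (x(j := y)) - \<psi> x) * ?h y - \<psi> x * (1 - ?h y)\<bar>"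
      by (simp add: algebra_simps)
    also have "\<dots> \<le> \<bar>\<psi> (x(j := y)) - \<psi> x\<bar> * ?h y + \<bar>\<psi> x\<bar> * (1 - ?h y)"
      using hb[of y] by (intro order_trans[OF abs_triangle_ineq4]) (simp add: abs_mult)
    also have "\<dots> \<le> L * \<bar>y - x j\<bar> * 1 + C * \<bar>y / R\<bar>"
      using l hb[of y] C[of x] C0 L one_minus_gaussian_le[of "y / R"] by (intro add_mono mult_mono) auto
    also have "\<dots> \<le> L * \<bar>y - x j\<bar> + C / R * (\<bar>y - x j\<bar> + \<bar>x j\<bar>)"
    proof -
      have "C / R * \<bar>y\<bar> \<le> C / R * (\<bar>y - x j\<bar> + \<bar>x j\<bar>)"
        using C0 pos by (intro mult_left_mono) auto
      then show ?thesis using pos by simp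
    qed
    finally have "\<bar>\<psi> (x(j := y)) * ?h y - \<psi> x\<bar> * ?n y \<le> (L * \<bar>y - x j\<bar> + C / R * (\<bar>y - x j\<bar> + \<bar>x j\<bar>)) * ?n y"
      by (intro mult_right_mono) auto
    moreover have "\<bar>\<psi> (x(j := y)) * ?h y * ?n y - \<psi> x * ?n y\<bar> = \<bar>\<psi> (x(j := y)) * ?h y - \<psi> x\<bar> * ?n y"
      by (simp add: abs_mult left_diff_distrib[symmetric])
    ultimately show "\<bar>\<psi> (x(j := y)) * ?h y * ?n y - \<psi> x * ?n y\<bar> \<le> (L + C / R) * (?n y * \<bar>y - x j\<bar>) + C / R * \<bar>x j\<bar> * ?n y"
      by (simp add: algebra_simps)
  next
    show "integrable lborel (\<lambda>y. \<bar>\<psi> (x(j := y)) * ?h y * ?n y - \<psi> x * ?n y\<bar>)"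
      using in_p in_n by auto
    show "integrable lborel (\<lambda>y. (L + C / R) * (?n y * \<bar>y - x j\<bar>) + C / R * \<bar>x j\<bar> * ?n y)"
      using in_a in_n by auto
  qed
  also have "\<dots> = (L + C / R) * integral\<^sup>L lborel (\<lambda>y. ?n y * \<bar>y - x j\<bar>) + C / R * \<bar>x j\<bar>"
    using in_a in_n i_n by simp
  also have "\<dots> \<le> (L + C / R) * \<epsilon> + C / R * \<bar>x j\<bar>"
    using i_a L C0 pos by (intro add_right_mono mult_left_mono) auto
  finally show ?thesis .
qed

text \<open>The normal density is the Fourier transform of a normal law. Hence smoothing replaces coordinate
  \<open>j\<close> by a parameter \<open>y\<close> and a factor \<open>iexp (t * (x j - y) / \<epsilon>)\<close>, averaged over normal \<open>y\<close> and \<open>t\<close>.\<close>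

lemma smoothing_fourier:
  fixes \<psi> :: "(nat \<Rightarrow> real) \<Rightarrow> real"
  assumes [measurable]: "\<psi> \<in> borel_measurable borel" and C: "\<And>x. \<bar>\<psi> x\<bar> \<le> C"
    and pos: "0 < \<epsilon>" "0 < R"
  shows "complex_of_real (smoothing \<epsilon> R j \<psi> x) = of_real (R / \<epsilon>) *
    (CLINT p|density lborel (normal_density 0 R) \<Otimes>\<^sub>M density lborel std_normal_density.
      of_real (\<psi> (x(j := fst p))) * iexp (snd p * ((x j - fst p) / \<epsilon>)))"
proof -
  let ?N = "density lborel (normal_density 0 R)" and ?G = "density lborel std_normal_density"
  interpret N: prob_space ?N by (rule prob_space_normal_density) (rule pos)
  interpret G: prob_space ?G by (rule prob_space_normal_density) simp
  interpret P: pair_prob_space ?N ?G ..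
  have [measurable]: "(\<lambda>y. \<psi> (x(j := y))) \<in> borel_measurable borel"
    by (rule measurable_section) simp
  let ?F = "\<lambda>p. of_real (\<psi> (x(j := fst p))) * iexp (snd p * ((x j - fst p) / \<epsilon>))"
  have int: "integrable (?N \<Otimes>\<^sub>M ?G) ?F"
    by (rule P.P.integrable_const_bound[of _ C]) (auto simp: norm_mult C)
  have "(CLINT p|?N \<Otimes>\<^sub>M ?G. ?F p) = (CLINT y|?N. CLINT t|?G. ?F (y, t))"
    using P.integral_fst'[OF int] by simp
  also have "\<dots> = (CLINT y|?N. of_real (\<psi> (x(j := y)) * exp (- (((x j - y) / \<epsilon>)\<^sup>2) / 2)))"
  proof (rule Bochner_Integration.integral_cong[OF refl])
    fix y
    have "(CLINT t|?G. ?F (y, t)) = of_real (\<psi> (x(j := y))) * char ?G ((x j - y) / \<epsilon>)"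
      unfolding char_def by (simp add: mult.commute)
    then show "(CLINT t|?G. ?F (y, t)) = of_real (\<psi> (x(j := y)) * exp (- (((x j - y) / \<epsilon>)\<^sup>2) / 2))"
      unfolding char_std_normal_distribution by simp
  qed
  also have "\<dots> = of_real (\<integral>y. \<psi> (x(j := y)) * exp (- (((x j - y) / \<epsilon>)\<^sup>2) / 2) \<partial>?N)"
    by (rule integral_complex_of_real)
  also have "(\<integral>y. \<psi> (x(j := y)) * exp (- (((x j - y) / \<epsilon>)\<^sup>2) / 2) \<partial>?N)
     = (\<integral>y. normal_density 0 R y * (\<psi> (x(j := y)) * exp (- (((x j - y) / \<epsilon>)\<^sup>2) / 2)) \<partial>lborel)"
    by (subst integral_density) auto
  also have "\<dots> = (\<integral>y. (\<epsilon> / R) * (\<psi> (x(j := y)) * exp (- ((y / R)\<^sup>2 / 2)) * normal_density (x j) \<epsilon> y) \<partial>lborel)"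
  proof (rule Bochner_Integration.integral_cong[OF refl])
    fix y
    have "normal_density 0 R y = exp (- ((y / R)\<^sup>2 / 2)) / (sqrt (2 * pi) * R)"
      using pos by (simp add: normal_density_def real_sqrt_mult power_divide)
    moreover have "normal_density (x j) \<epsilon> y = exp (- (((x j - y) / \<epsilon>)\<^sup>2) / 2) / (sqrt (2 * pi) * \<epsilon>)"
      using pos by (simp add: normal_density_def real_sqrt_mult power_divide power2_commute)
    ultimately show "normal_density 0 R y * (\<psi> (x(j := y)) * exp (- (((x j - y) / \<epsilon>)\<^sup>2) / 2))
      = (\<epsilon> / R) * (\<psi> (x(j := y)) * exp (- ((y / R)\<^sup>2 / 2)) * normal_density (x j) \<epsilon> y)"
      using pos by (simp add: mult_ac)
  qed
  also have "\<dots> = \<epsilon> / R * smoothing \<epsilon> R j \<psi> x" unfolding smoothing_def by simp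
  finally have eq: "(CLINT p|?N \<Otimes>\<^sub>M ?G. ?F p) = complex_of_real (\<epsilon> / R * smoothing \<epsilon> R j \<psi> x)" .
  show ?thesis unfolding eq using pos by simp
qed

text \<open>Interpolates between the characteristic function, for constant \<open>\<psi>\<close>, and the expectation of \<open>\<psi>\<close>, for
  \<open>a = 0\<close>.\<close>

definition mixed_expectation ::
    "nat \<Rightarrow> 'a measure \<Rightarrow> (nat \<Rightarrow> 'a \<Rightarrow> real) \<Rightarrow> ((nat \<Rightarrow> real) \<Rightarrow> real) \<Rightarrow> (nat \<Rightarrow> real) \<Rightarrow> complex" where
  "mixed_expectation d M V \<psi> a = (CLINT \<omega>|M. of_real (\<psi> (\<lambda>i. V i \<omega>)) * iexp (\<Sum>i<d. a i * V i \<omega>))"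

text \<open>Fubini's theorem, followed by absorbing the factor \<open>iexp (t * x j / \<epsilon>)\<close> into the coefficient \<open>a j\<close>. The
  inner expectation involves \<open>\<psi>\<close> with its \<open>j\<close>th coordinate frozen.\<close>

lemma smoothed_mixed_expectation:
  fixes \<psi> :: "(nat \<Rightarrow> real) \<Rightarrow> real" and a :: "nat \<Rightarrow> real"
  assumes M: "prob_space M" and V[measurable]: "\<And>i. V i \<in> borel_measurable M"
    and \<psi>[measurable]: "\<psi> \<in> borel_measurable borel" and C: "\<And>x. \<bar>\<psi> x\<bar> \<le> C"
    and pos: "0 < \<epsilon>" "0 < R" and j: "j < d"
  defines "P \<equiv> density lborel (normal_density 0 R) \<Otimes>\<^sub>M density lborel std_normal_density"
  defines "K \<equiv> \<lambda>p. iexp (- (snd p * fst p / \<epsilon>)) * mixed_expectation d M V (\<lambda>x. \<psi> (x(j := fst p))) (a(j := a j + snd p / \<epsilon>))"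
  shows "mixed_expectation d M V (smoothing \<epsilon> R j \<psi>) a = of_real (R / \<epsilon>) * (CLINT p|P. K p)"
    and "K \<in> borel_measurable P" and "\<And>p. norm (K p) \<le> C"
proof -
  let ?N = "density lborel (normal_density 0 R)" and ?G = "density lborel std_normal_density"
  interpret M: prob_space M by fact
  interpret N: prob_space ?N by (rule prob_space_normal_density) (rule pos)
  interpret G: prob_space ?G by (rule prob_space_normal_density) simp
  interpret NG: pair_prob_space ?N ?G ..
  have P_prob: "prob_space P" unfolding P_def by (rule NG.P.prob_space_axioms)
  interpret P: prob_space P by (rule P_prob)
  interpret MP: pair_prob_space M P ..
  have [measurable]: "fst \<in> borel_measurable P" "snd \<in> borel_measurable P" unfolding P_def by auto
  define F where "F \<omega> p = of_real (\<psi> ((\<lambda>i. V i \<omega>)(j := fst p))) * iexp (snd p * ((V j \<omega> - fst p) / \<epsilon>)) * iexp (\<Sum>i<d. a i * V i \<omega>)"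
    for \<omega> p
  have [measurable]: "(\<lambda>q. \<psi> ((\<lambda>i. V i (fst q))(j := fst (snd q)))) \<in> borel_measurable (M \<Otimes>\<^sub>M P)"
    by (rule measurable_compose[OF measurable_fun_upd_nat \<psi>]) auto
  have Fm: "(\<lambda>q. F (fst q) (snd q)) \<in> borel_measurable (M \<Otimes>\<^sub>M P)"
    unfolding F_def by measurable
  have Fn: "norm (F \<omega> p) \<le> C" for \<omega> p unfolding F_def by (simp add: norm_mult C)
  have int: "integrable (M \<Otimes>\<^sub>M P) (case_prod F)"
    by (rule MP.P.integrable_const_bound[of _ C]) (use Fm Fn in \<open>auto simp: case_prod_beta'\<close>)
  have KF: "K p = (CLINT \<omega>|M. F \<omega> p)" for p
  proof -
    have "iexp (- (snd p * fst p / \<epsilon>)) * (of_real (\<psi> ((\<lambda>i. V i \<omega>)(j := fst p))) * iexp (\<Sum>i<d. (a(j := a j + snd p / \<epsilon>)) i * V i \<omega>)) = F \<omega> p" for \<omega>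
    proof -
      have "(\<Sum>i<d. (a(j := a j + snd p / \<epsilon>)) i * V i \<omega>) = (\<Sum>i<d. a i * V i \<omega> + (if i = j then snd p / \<epsilon> * V j \<omega> else 0))"
        by (intro sum.cong) (auto simp: algebra_simps)
      also have "\<dots> = (\<Sum>i<d. a i * V i \<omega>) + snd p / \<epsilon> * V j \<omega>" using j by (simp add: sum.distrib)
      finally have s: "- (snd p * fst p / \<epsilon>) + (\<Sum>i<d. (a(j := a j + snd p / \<epsilon>)) i * V i \<omega>)
         = snd p * ((V j \<omega> - fst p) / \<epsilon>) + (\<Sum>i<d. a i * V i \<omega>)"
        by (simp add: diff_divide_distrib algebra_simps)
      have "iexp (- (snd p * fst p / \<epsilon>)) * iexp (\<Sum>i<d. (a(j := a j + snd p / \<epsilon>)) i * V i \<omega>)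
         = iexp (- (snd p * fst p / \<epsilon>) + (\<Sum>i<d. (a(j := a j + snd p / \<epsilon>)) i * V i \<omega>))"
        by (simp only: of_real_add distrib_left exp_add)
      also have "\<dots> = iexp (snd p * ((V j \<omega> - fst p) / \<epsilon>)) * iexp (\<Sum>i<d. a i * V i \<omega>)"
        unfolding s by (simp only: of_real_add distrib_left exp_add)
      finally show ?thesis unfolding F_def by (simp only: mult.left_commute mult.assoc)
    qed
    then have "(CLINT \<omega>|M. F \<omega> p) = (CLINT \<omega>|M. iexp (- (snd p * fst p / \<epsilon>)) * (of_real (\<psi> ((\<lambda>i. V i \<omega>)(j := fst p))) * iexp (\<Sum>i<d. (a(j := a j + snd p / \<epsilon>)) i * V i \<omega>)))"
      by presburger
    also have "\<dots> = K p" unfolding K_def mixed_expectation_def by (rule integral_mult_right_zero)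
    finally show ?thesis ..
  qed
  have "(\<lambda>p. CLINT \<omega>|M. F \<omega> p) \<in> borel_measurable P"
    by (rule M.borel_measurable_lebesgue_integral)
      (use measurable_compose[OF measurable_pair_swap' Fm] in \<open>simp add: case_prod_beta'\<close>)
  then show "K \<in> borel_measurable P" by (simp add: KF[abs_def])
  show "norm (K p) \<le> C" for p
  proof -
    have "norm (K p) \<le> (\<integral>\<omega>. norm (F \<omega> p) \<partial>M)" unfolding KF by (rule integral_norm_bound)
    also have "\<dots> \<le> (\<integral>\<omega>. C \<partial>M)"
    proof (rule integral_mono')
      have "0 \<le> C" using C[of undefined] by linarith
      show "integrable M (\<lambda>\<omega>. C)" by simp
    qed (use Fn order_trans[OF norm_ge_zero Fn] in auto)
    finally show ?thesis by (simp add: M.prob_space)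
  qed
  have "mixed_expectation d M V (smoothing \<epsilon> R j \<psi>) a = (CLINT \<omega>|M. of_real (R / \<epsilon>) * (CLINT p|P. F \<omega> p))"
    unfolding mixed_expectation_def
  proof (rule Bochner_Integration.integral_cong[OF refl])
    fix \<omega>
    have "(CLINT p|P. F \<omega> p) = (CLINT p|P. of_real (\<psi> ((\<lambda>i. V i \<omega>)(j := fst p))) * iexp (snd p * ((V j \<omega> - fst p) / \<epsilon>))) * iexp (\<Sum>i<d. a i * V i \<omega>)"
      unfolding F_def by simp
    then show "of_real (smoothing \<epsilon> R j \<psi> (\<lambda>i. V i \<omega>)) * iexp (\<Sum>i<d. a i * V i \<omega>) = of_real (R / \<epsilon>) * (CLINT p|P. F \<omega> p)"
      using smoothing_fourier[OF \<psi> C pos, of j "\<lambda>i. V i \<omega>"] unfolding P_def by (simp add: mult.assoc)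
  qed
  also have "\<dots> = of_real (R / \<epsilon>) * (CLINT p|P. CLINT \<omega>|M. F \<omega> p)"
    using MP.Fubini_integral[OF int] by simp
  finally show "mixed_expectation d M V (smoothing \<epsilon> R j \<psi>) a = of_real (R / \<epsilon>) * (CLINT p|P. K p)"
    unfolding KF .
qed

lemma tendsto_by_uniform_approximation:
  fixes u :: "nat \<Rightarrow> 'a::real_normed_vector"
  assumes "\<And>\<eta>. 0 < \<eta> \<Longrightarrow> \<exists>u' v'. (\<forall>n. norm (u n - u' n) \<le> \<eta>) \<and> norm (v - v') \<le> \<eta> \<and> u' \<longlonglongrightarrow> v'"
  shows "u \<longlonglongrightarrow> v"
proof (rule LIMSEQ_I)
  fix r :: real assume r: "0 < r"
  then obtain u' v' where uv: "\<And>n. norm (u n - u' n) \<le> r / 4" "norm (v - v') \<le> r / 4" "u' \<longlonglongrightarrow> v'"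
    using assms[of "r / 4"] by auto
  then obtain no where no: "\<And>n. n \<ge> no \<Longrightarrow> norm (u' n - v') < r / 4"
    using LIMSEQ_D[of u' v' "r / 4"] r by auto
  have "norm (u n - v) < r" if "n \<ge> no" for n
  proof -
    have "u n - v = (u n - u' n) + (u' n - v') - (v - v')" by simp
    then have "norm (u n - v) \<le> norm (u n - u' n) + norm (u' n - v') + norm (v - v')"
      using norm_triangle_ineq4[of "(u n - u' n) + (u' n - v')" "v - v'"] norm_triangle_ineq[of "u n - u' n" "u' n - v'"] by simp
    with uv(1)[of n] uv(2) no[OF that] r show ?thesis by linarith
  qed
  then show "\<exists>no. \<forall>n\<ge>no. norm (u n - v) < r" by blast
qed

lemma mixed_expectation_diff_le:
  fixes a :: "nat \<Rightarrow> real" and V :: "nat \<Rightarrow> 'a \<Rightarrow> real"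
  assumes M: "prob_space M" and [measurable]: "\<And>i. V i \<in> borel_measurable M"
    and [measurable]: "\<phi> \<in> borel_measurable borel" "\<psi> \<in> borel_measurable borel"
    and C: "\<And>x. \<bar>\<phi> x\<bar> \<le> C" "\<And>x. \<bar>\<psi> x\<bar> \<le> C'"
    and d: "\<And>x. \<bar>\<psi> x - \<phi> x\<bar> \<le> A + D * \<bar>x j\<bar>" and i: "integrable M (V j)" "(\<integral>\<omega>. \<bar>V j \<omega>\<bar> \<partial>M) \<le> K" and D: "0 \<le> D"
  shows "norm (mixed_expectation d M V \<phi> a - mixed_expectation d M V \<psi> a) \<le> A + D * K"
proof -
  interpret M: prob_space M by fact
  have Vm: "(\<lambda>\<omega> i. V i \<omega>) \<in> M \<rightarrow>\<^sub>M borel" by (rule measurable_coordinatewise_then_product) simp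
  let ?e = "\<lambda>\<omega>. iexp (\<Sum>i<d. a i * V i \<omega>)"
  have int: "integrable M (\<lambda>\<omega>. of_real (\<zeta> (\<lambda>i. V i \<omega>)) * ?e \<omega>)"
    if [measurable]: "\<zeta> \<in> borel_measurable borel" and B: "\<And>x. \<bar>\<zeta> x\<bar> \<le> B" for \<zeta> B
  proof (rule M.integrable_const_bound[of _ B])
    have [measurable]: "(\<lambda>\<omega>. \<zeta> (\<lambda>i. V i \<omega>)) \<in> borel_measurable M"
      by (rule measurable_compose[OF Vm]) fact
    show "(\<lambda>\<omega>. of_real (\<zeta> (\<lambda>i. V i \<omega>)) * ?e \<omega>) \<in> borel_measurable M" by measurable
  qed (simp add: norm_mult B)
  note int' = int[OF assms(4) C(2)] and int = int[OF assms(3) C(1)]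
  have "mixed_expectation d M V \<phi> a - mixed_expectation d M V \<psi> a =
      (CLINT \<omega>|M. of_real (\<phi> (\<lambda>i. V i \<omega>)) * ?e \<omega> - of_real (\<psi> (\<lambda>i. V i \<omega>)) * ?e \<omega>)"
    unfolding mixed_expectation_def by (rule Bochner_Integration.integral_diff[OF int int', symmetric])
  then have "norm (mixed_expectation d M V \<phi> a - mixed_expectation d M V \<psi> a)
      \<le> (\<integral>\<omega>. norm (of_real (\<phi> (\<lambda>i. V i \<omega>)) * ?e \<omega> - of_real (\<psi> (\<lambda>i. V i \<omega>)) * ?e \<omega>) \<partial>M)"
    by (simp only: integral_norm_bound)
  also have "\<dots> \<le> (\<integral>\<omega>. A + D * \<bar>V j \<omega>\<bar> \<partial>M)"
  proof (rule integral_mono)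
    fix \<omega>
    have "norm (of_real (\<phi> (\<lambda>i. V i \<omega>)) * ?e \<omega> - of_real (\<psi> (\<lambda>i. V i \<omega>)) * ?e \<omega>) =
       norm (complex_of_real (\<phi> (\<lambda>i. V i \<omega>) - \<psi> (\<lambda>i. V i \<omega>)) * ?e \<omega>)"
      by (simp add: algebra_simps)
    also have "\<dots> = \<bar>\<psi> (\<lambda>i. V i \<omega>) - \<phi> (\<lambda>i. V i \<omega>)\<bar>"
      unfolding norm_mult norm_of_real by (simp add: abs_minus_commute)
    also have "\<dots> \<le> A + D * \<bar>V j \<omega>\<bar>" by (rule d)
    finally show "norm (of_real (\<phi> (\<lambda>i. V i \<omega>)) * ?e \<omega> - of_real (\<psi> (\<lambda>i. V i \<omega>)) * ?e \<omega>) \<le> A + D * \<bar>V j \<omega>\<bar>" .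
  qed (use int int' i in auto)
  also have "\<dots> = A + D * (\<integral>\<omega>. \<bar>V j \<omega>\<bar> \<partial>M)" using i by (simp add: M.prob_space)
  also have "\<dots> \<le> A + D * K" using i D by (intro add_left_mono mult_left_mono)
  finally show ?thesis .
qed

text \<open>Levy's continuity theorem in several dimensions, for bounded Lipschitz functions. The induction
  runs over the number \<open>m\<close> of coordinates on which \<open>\<psi>\<close> depends; \<open>m = 0\<close> is the convergence of the
  characteristic functions. To pass from \<open>m\<close> to \<open>m + 1\<close>, coordinate \<open>m\<close> is smoothed: its smoothed
  mixed expectation is an integral over \<open>(y, t)\<close> of mixed expectations of functions of \<open>m\<close>
  coordinates, to which dominated convergence applies. The bounds \<open>K\<close> on first moments control the
  error caused by damping.\<close>

proposition char_convergence_imp_mixed_convergence: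
  fixes V :: "nat \<Rightarrow> nat \<Rightarrow> 'a \<Rightarrow> real" and W :: "nat \<Rightarrow> 'b \<Rightarrow> real"
  assumes M: "prob_space M" and N: "prob_space N"
    and V[measurable]: "\<And>n i. V n i \<in> borel_measurable M" and W[measurable]: "\<And>i. W i \<in> borel_measurable N"
    and iV: "\<And>n i. integrable M (V n i)" "\<And>n i. (\<integral>\<omega>. \<bar>V n i \<omega>\<bar> \<partial>M) \<le> K i"
    and iW: "\<And>i. integrable N (W i)" "\<And>i. (\<integral>\<omega>. \<bar>W i \<omega>\<bar> \<partial>N) \<le> K i"
    and char: "\<And>a :: nat \<Rightarrow> real. (\<lambda>n. CLINT \<omega>|M. iexp (\<Sum>i<d. a i * V n i \<omega>)) \<longlonglongrightarrow> (CLINT \<omega>|N. iexp (\<Sum>i<d. a i * W i \<omega>))"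
    and m: "m \<le> d" and L: "0 \<le> L"
    and lip: "\<And>x y. \<bar>\<psi> x - \<psi> y\<bar> \<le> L * (\<Sum>i<m. \<bar>x i - y i\<bar>)" and C: "\<And>x. \<bar>\<psi> x\<bar> \<le> C"
  shows "(\<lambda>n. mixed_expectation d M (V n) \<psi> a) \<longlonglongrightarrow> mixed_expectation d N W \<psi> a"
  using m lip C
proof (induction m arbitrary: \<psi> a)
  case 0
  then have "\<psi> x = \<psi> undefined" for x by (metis abs_le_zero_iff lessThan_0 mult_zero_right right_minus_eq sum.empty)
  then obtain c where c: "\<psi> = (\<lambda>_. c)" by blast
  show ?case unfolding c mixed_expectation_def integral_mult_right_zero by (intro tendsto_mult_left char)
next
  case (Suc j)
  then have j: "j < Suc j" "j < d" by auto
  have C0: "0 \<le> C" using Suc.prems(3)[of undefined] by linarith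
  have K: "0 \<le> K j" using iW(2)[of j] by (rule order_trans[rotated]) simp
  have \<psi>m[measurable]: "\<psi> \<in> borel_measurable borel" by (rule lipschitz_coordinates_measurable[OF Suc.prems(2)])
  show ?case
  proof (rule tendsto_by_uniform_approximation)
    fix \<eta> :: real assume \<eta>: "0 < \<eta>"
    \<comment> \<open>First the damping width is made large in terms of the first moment, then the smoothing width small.\<close>
    define R where "R = 2 * (C * K j + 1) / \<eta>"
    have CK: "0 \<le> C * K j" using C0 K by simp
    have R: "0 < R" using CK \<eta> by (simp add: R_def)
    have RC: "C / R * K j \<le> \<eta> / 2" using CK \<eta> by (simp add: R_def field_simps)
    define \<epsilon> where "\<epsilon> = \<eta> / (2 * (L + C / R + 1))"
    have LC: "0 \<le> L + C / R" using L C0 R by simp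
    have \<epsilon>: "0 < \<epsilon>" using LC \<eta> by (simp add: \<epsilon>_def)
    have "(L + C / R) * \<epsilon> = \<eta> / 2 * ((L + C / R) / (L + C / R + 1))" by (simp add: \<epsilon>_def)
    also have "\<dots> \<le> \<eta> / 2 * 1" using LC \<eta> by (intro mult_left_mono) auto
    finally have e2: "(L + C / R) * \<epsilon> \<le> \<eta> / 2" by simp
    note err = smoothing_error[OF Suc.prems(2,3) j(1) \<epsilon> R L]
    let ?S = "smoothing \<epsilon> R j \<psi>"
    let ?P = "density lborel (normal_density 0 R) \<Otimes>\<^sub>M density lborel std_normal_density"
    let ?K = "\<lambda>M' V' p. iexp (- (snd p * fst p / \<epsilon>)) * mixed_expectation d M' V' (\<lambda>x. \<psi> (x(j := fst p))) (a(j := a j + snd p / \<epsilon>))"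
    have Sm: "?S \<in> borel_measurable borel" by (rule smoothing_measurable) simp
    have Sb: "\<bar>?S x\<bar> \<le> C" for x by (rule smoothing_bounded[OF Suc.prems(3) \<epsilon>])
    have CR: "0 \<le> C / R" using C0 R by simp
    have close: "(L + C / R) * \<epsilon> + C / R * K j \<le> \<eta>" using RC e2 by linarith
    have 1: "norm (mixed_expectation d M (V n) \<psi> a - mixed_expectation d M (V n) ?S a) \<le> \<eta>" for n
      by (rule order_trans[OF mixed_expectation_diff_le[where V = "V n" and j = j and d = d and a = a, OF M V \<psi>m Sm Suc.prems(3) Sb err iV(1) iV(2) CR] close])
    have 2: "norm (mixed_expectation d N W \<psi> a - mixed_expectation d N W ?S a) \<le> \<eta>"
      by (rule order_trans[OF mixed_expectation_diff_le[where V = W and j = j and d = d and a = a, OF N W \<psi>m Sm Suc.prems(3) Sb err iW(1) iW(2) CR] close])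
    note reprV = smoothed_mixed_expectation[where a = a and V = "V n" for n, OF M V \<psi>m Suc.prems(3) \<epsilon> R j(2)]
    note reprW = smoothed_mixed_expectation[where a = a and V = W, OF N W \<psi>m Suc.prems(3) \<epsilon> R j(2)]
    interpret PN: prob_space "density lborel (normal_density 0 R)" by (rule prob_space_normal_density) (rule R)
    interpret PG: prob_space "density lborel std_normal_density" by (rule prob_space_normal_density) simp
    interpret P: pair_prob_space "density lborel (normal_density 0 R)" "density lborel std_normal_density" ..
    have "(\<lambda>n. CLINT p|?P. ?K M (V n) p) \<longlonglongrightarrow> (CLINT p|?P. ?K N W p)"
    proof (rule integral_dominated_convergence[where w = "\<lambda>_. C"])
      show "AE p in ?P. (\<lambda>n. ?K M (V n) p) \<longlonglongrightarrow> ?K N W p"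
      proof (intro AE_I2 tendsto_mult_left Suc.IH)
        fix p :: "real \<times> real" and x y :: "nat \<Rightarrow> real"
        have S: "(\<Sum>i<Suc j. \<bar>(x(j := fst p)) i - (y(j := fst p)) i\<bar>) = (\<Sum>i<j. \<bar>x i - y i\<bar>)" by simp
        show "\<bar>\<psi> (x(j := fst p)) - \<psi> (y(j := fst p))\<bar> \<le> L * (\<Sum>i<j. \<bar>x i - y i\<bar>)"
          using Suc.prems(2)[of "x(j := fst p)" "y(j := fst p)"] unfolding S .
      qed (use j in simp, rule Suc.prems(3))
      show "?K N W \<in> borel_measurable ?P" by (rule reprW(2))
      show "?K M (V n) \<in> borel_measurable ?P" for n by (rule reprV(2))
      show "integrable ?P (\<lambda>_. C)" by simp
      show "AE p in ?P. norm (?K M (V n) p) \<le> C" for n by (rule AE_I2) (rule reprV(3))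
    qed
    then have "(\<lambda>n. mixed_expectation d M (V n) ?S a) \<longlonglongrightarrow> mixed_expectation d N W ?S a"
      unfolding reprV(1) reprW(1) by (rule tendsto_mult_left)
    with 1 2 show "\<exists>u' v'. (\<forall>n. norm (mixed_expectation d M (V n) \<psi> a - u' n) \<le> \<eta>) \<and>
        norm (mixed_expectation d N W \<psi> a - v') \<le> \<eta> \<and> u' \<longlonglongrightarrow> v'"
      by (intro exI[of _ "\<lambda>n. mixed_expectation d M (V n) ?S a"] exI[of _ "mixed_expectation d N W ?S a"] conjI allI)
  qed
qed

section \<open>Convergence of the finite-dimensional distributions\<close>

context gaussian_si_process
begin

text \<open>The combination is Gaussian, and its variance is expressed by polarisation.\<close>

lemma charfun_combination:
  fixes a :: "nat \<Rightarrow> real"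
  assumes "inj_on \<tau> {..<d}"
  shows "(CLINT \<omega>|M. iexp (\<Sum>i<d. a i * X (\<tau> i) \<omega>)) =
    exp (- (\<Sum>i<d. \<Sum>j<d. a i * a j * (((\<sigma> (\<tau> i))\<^sup>2 + (\<sigma> (\<tau> j))\<^sup>2 - (\<sigma> (\<tau> i - \<tau> j))\<^sup>2) / 2)) / 2)"
proof -
  let ?Y = "\<lambda>\<omega>. \<Sum>i<d. a i * X (\<tau> i) \<omega>"
  \<comment> \<open>The Gaussian property is stated for sums over sets of times, so the coefficients are moved along \<open>\<tau>\<close>.\<close>
  define b where "b t = a (the_inv_into {..<d} \<tau> t)" for t
  have "(\<Sum>t\<in>\<tau> ` {..<d}. b t * X t \<omega>) = ?Y \<omega>" for \<omega>
    by (subst sum.reindex[OF assms]) (auto simp: b_def the_inv_into_f_f[OF assms] intro!: sum.cong)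
  then have g: "gaussian_rv M ?Y"
    using gaussian_linear_combination[of "\<tau> ` {..<d}" b] by simp
  have E0: "expectation ?Y = 0"
    by (subst Bochner_Integration.integral_sum) auto
  have "variance ?Y = expectation (\<lambda>\<omega>. \<Sum>i<d. \<Sum>j<d. a i * a j * (X (\<tau> i) \<omega> * X (\<tau> j) \<omega>))"
    unfolding E0 by (intro Bochner_Integration.integral_cong refl) (simp add: power2_eq_square sum_product mult_ac)
  also have "\<dots> = (\<Sum>i<d. \<Sum>j<d. a i * a j * expectation (\<lambda>\<omega>. X (\<tau> i) \<omega> * X (\<tau> j) \<omega>))"
    by (subst Bochner_Integration.integral_sum, force)+ simp
  also have "\<dots> = (\<Sum>i<d. \<Sum>j<d. a i * a j * (((\<sigma> (\<tau> i))\<^sup>2 + (\<sigma> (\<tau> j))\<^sup>2 - (\<sigma> (\<tau> i - \<tau> j))\<^sup>2) / 2))"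
    unfolding expectation_X_prod ..
  finally have v: "variance ?Y = (\<Sum>i<d. \<Sum>j<d. a i * a j * (((\<sigma> (\<tau> i))\<^sup>2 + (\<sigma> (\<tau> j))\<^sup>2 - (\<sigma> (\<tau> i - \<tau> j))\<^sup>2) / 2))" .
  show ?thesis using centered_gaussian_charfun[OF g E0] unfolding v by simp
qed

lemma expectation_abs_X_le: "expectation (\<lambda>\<omega>. \<bar>X t \<omega>\<bar>) \<le> 1 + (\<sigma> t)\<^sup>2"
proof -
  have "expectation (\<lambda>\<omega>. \<bar>X t \<omega>\<bar>) \<le> expectation (\<lambda>\<omega>. 1 + (X t \<omega>)\<^sup>2)"
  proof (rule integral_mono)
    fix \<omega>
    have "0 \<le> (\<bar>X t \<omega>\<bar> - 1)\<^sup>2" by simp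
    then have "2 * \<bar>X t \<omega>\<bar> \<le> 1 + (X t \<omega>)\<^sup>2" by (simp add: power2_diff)
    then show "\<bar>X t \<omega>\<bar> \<le> 1 + (X t \<omega>)\<^sup>2" by linarith
  qed auto
  also have "\<dots> = 1 + (\<sigma> t)\<^sup>2" by (simp add: \<sigma>_square prob_space)
  finally show ?thesis .
qed

end

text \<open>Fractional Brownian motion is itself covered by the estimates above, with standard deviation
  \<open>\<bar>t\<bar> powr \<alpha>\<close>.\<close>

lemma fractional_brownian_motion_process:
  assumes N: "prob_space N" and B: "fractional_brownian_motion \<alpha> N B"
  shows "rv_gaussian_process N B \<alpha>" and "\<And>t. std_dev N B t = \<bar>t\<bar> powr \<alpha>"
proof -
  interpret B: gaussian_si_process N B
    using N B by (intro gaussian_si_process.intro gaussian_si_process_axioms.intro) (auto simp: fractional_brownian_motion_def)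
  have \<alpha>: "0 < \<alpha>" "\<alpha> < 1" using B by (auto simp: fractional_brownian_motion_def)
  show sd: "std_dev N B t = \<bar>t\<bar> powr \<alpha>" for t
  proof -
    have "covariance N (B t) (B t) = (\<bar>t\<bar> powr (2 * \<alpha>) + \<bar>t\<bar> powr (2 * \<alpha>) - \<bar>t - t\<bar> powr (2 * \<alpha>)) / 2"
      using B unfolding fractional_brownian_motion_def by blast
    then have "(std_dev N B t)\<^sup>2 = \<bar>t\<bar> powr (2 * \<alpha>)"
      unfolding B.\<sigma>_square covariance_def by (simp add: power2_eq_square)
    also have "\<dots> = (\<bar>t\<bar> powr \<alpha>)\<^sup>2" by (simp add: power2_eq_square powr_add[symmetric])
    finally show ?thesis by (simp add: power2_eq_iff_nonneg)
  qed
  show "rv_gaussian_process N B \<alpha>"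
  proof (intro rv_gaussian_process.intro rv_gaussian_process_axioms.intro B.gaussian_si_process_axioms)
    show "\<exists>\<epsilon>>0. \<exists>L. ((\<lambda>t. (std_dev N B t)\<^sup>2 * \<bar>ln \<bar>t\<bar>\<bar> powr (1 + \<epsilon>)) \<longlongrightarrow> L) (at 0)"
    proof (rule exI[of _ 1], intro conjI, simp, rule exI[of _ 0])
      show "((\<lambda>t. (std_dev N B t)\<^sup>2 * \<bar>ln \<bar>t\<bar>\<bar> powr (1 + 1)) \<longlongrightarrow> 0) (at 0)"
        unfolding sd by (rule filterlim_split_at; use \<alpha> in real_asymp)
    qed
    show "regularly_varying (std_dev N B) \<alpha>"
      unfolding regularly_varying_def
    proof (intro conjI allI impI)
      have "(\<lambda>t. \<bar>t\<bar> powr \<alpha>) \<in> borel_measurable (restrict_space borel {0..})"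
        by (rule measurable_restrict_space1) measurable
      then show "std_dev N B \<in> borel_measurable (restrict_space borel {0..})" by (simp add: sd[abs_def])
      fix t :: real assume t: "0 < t"
      have "\<forall>\<^sub>F x in at_top. t powr \<alpha> = std_dev N B (t * x) / std_dev N B x"
        using eventually_gt_at_top[of 0] by eventually_elim (use t in \<open>simp add: sd abs_mult powr_mult\<close>)
      then show "((\<lambda>x. std_dev N B (t * x) / std_dev N B x) \<longlongrightarrow> t powr \<alpha>) at_top"
        by (rule Lim_transform_eventually[OF tendsto_const])
    qed (simp add: sd)
  qed (use \<alpha> in auto)
qed

text \<open>By regular variation the variances of the rescaled process, and with them its covariances and
  characteristic functions, converge to those of the limit.\<close>

proposition finite_dimensional_convergence:
  fixes \<psi> :: "(nat \<Rightarrow> real) \<Rightarrow> real"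
  assumes X: "rv_gaussian_process M X \<alpha>" and B: "gaussian_si_process N B" "\<And>t. std_dev N B t = \<bar>t\<bar> powr \<alpha>"
    and u: "filterlim u at_top sequentially" and upos: "\<And>n. 0 < u n"
    and \<tau>: "inj_on \<tau> {..<d}" and L: "0 \<le> L"
    and lip: "\<And>x y. \<bar>\<psi> x - \<psi> y\<bar> \<le> L * (\<Sum>i<d. \<bar>x i - y i\<bar>)" and C: "\<And>x. \<bar>\<psi> x\<bar> \<le> C"
  shows "(\<lambda>n. \<integral>\<omega>. \<psi> (\<lambda>i. X (u n * \<tau> i) \<omega> / std_dev M X (u n)) \<partial>M) \<longlonglongrightarrow> (\<integral>\<omega>. \<psi> (\<lambda>i. B (\<tau> i) \<omega>) \<partial>N)"
proof -
  interpret X: rv_gaussian_process M X \<alpha> by fact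
  interpret B: gaussian_si_process N B by fact
  define V where "V n i \<omega> = X (u n * \<tau> i) \<omega> / X.\<sigma> (u n)" for n i \<omega>
  have su: "0 < X.\<sigma> (u n)" for n using upos X.\<sigma>_pos by simp
  have lim1: "(\<lambda>n. X.\<sigma> (u n * t) / X.\<sigma> (u n)) \<longlonglongrightarrow> B.\<sigma> t" for t
    unfolding B(2) by (rule filterlim_compose[OF X.scaling_limit u])
  have lim2: "(\<lambda>n. (X.\<sigma> (u n * t))\<^sup>2 / (X.\<sigma> (u n))\<^sup>2) \<longlonglongrightarrow> (B.\<sigma> t)\<^sup>2" for t
    using tendsto_power[OF lim1[of t], of 2] by (simp add: power_divide)
  have Vm: "V n i \<in> borel_measurable M" for n i unfolding V_def by measurable
  have iV: "integrable M (V n i)" for n i unfolding V_def by simp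
  have "\<exists>K. \<forall>n. (X.\<sigma> (u n * \<tau> i))\<^sup>2 / (X.\<sigma> (u n))\<^sup>2 \<le> K" for i
  proof -
    have "Bseq (\<lambda>n. (X.\<sigma> (u n * \<tau> i))\<^sup>2 / (X.\<sigma> (u n))\<^sup>2)" by (rule convergent_imp_Bseq) (use lim2 in \<open>auto simp: convergent_def\<close>)
    then obtain K where "\<And>n. norm ((X.\<sigma> (u n * \<tau> i))\<^sup>2 / (X.\<sigma> (u n))\<^sup>2) \<le> K" unfolding Bseq_def by blast
    then show ?thesis by (intro exI[of _ K]) simp
  qed
  then obtain K0 where K0: "\<And>i n. (X.\<sigma> (u n * \<tau> i))\<^sup>2 / (X.\<sigma> (u n))\<^sup>2 \<le> K0 i" by metis
  define K where "K i = 1 + max (K0 i) ((B.\<sigma> (\<tau> i))\<^sup>2)" for i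
  have KV: "(\<integral>\<omega>. \<bar>V n i \<omega>\<bar> \<partial>M) \<le> K i" for n i
  proof -
    have "(\<integral>\<omega>. \<bar>V n i \<omega>\<bar> \<partial>M) \<le> (\<integral>\<omega>. 1 + (X (u n * \<tau> i) \<omega>)\<^sup>2 / (X.\<sigma> (u n))\<^sup>2 \<partial>M)"
    proof (rule integral_mono)
      fix \<omega>
      have "0 \<le> (\<bar>V n i \<omega>\<bar> - 1)\<^sup>2" by simp
      then have "2 * \<bar>V n i \<omega>\<bar> \<le> 1 + (V n i \<omega>)\<^sup>2" by (simp add: power2_diff)
      then have "\<bar>V n i \<omega>\<bar> \<le> 1 + (V n i \<omega>)\<^sup>2" by linarith
      then show "\<bar>V n i \<omega>\<bar> \<le> 1 + (X (u n * \<tau> i) \<omega>)\<^sup>2 / (X.\<sigma> (u n))\<^sup>2" by (simp add: V_def power_divide)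
    qed (use iV in auto)
    also have "\<dots> = 1 + (X.\<sigma> (u n * \<tau> i))\<^sup>2 / (X.\<sigma> (u n))\<^sup>2"
      by (simp add: X.\<sigma>_square[of "u n * \<tau> i"] X.prob_space)
    also have "\<dots> \<le> K i" using K0[of n i] by (simp add: K_def)
    finally show ?thesis .
  qed
  have KB: "(\<integral>\<omega>. \<bar>B (\<tau> i) \<omega>\<bar> \<partial>N) \<le> K i" for i
    using B.expectation_abs_X_le[of "\<tau> i"] by (simp add: K_def)
  have char: "(\<lambda>n. CLINT \<omega>|M. iexp (\<Sum>i<d. a i * V n i \<omega>)) \<longlonglongrightarrow> (CLINT \<omega>|N. iexp (\<Sum>i<d. a i * B (\<tau> i) \<omega>))"
    for a :: "nat \<Rightarrow> real"
  proof -
    have eq: "(CLINT \<omega>|M. iexp (\<Sum>i<d. a i * V n i \<omega>)) =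
      of_real (exp (- (\<Sum>i<d. \<Sum>j<d. a i * a j * (((X.\<sigma> (u n * \<tau> i))\<^sup>2 / (X.\<sigma> (u n))\<^sup>2 + (X.\<sigma> (u n * \<tau> j))\<^sup>2 / (X.\<sigma> (u n))\<^sup>2
         - (X.\<sigma> (u n * (\<tau> i - \<tau> j)))\<^sup>2 / (X.\<sigma> (u n))\<^sup>2) / 2)) / 2))" for n
    proof -
      have inj: "inj_on (\<lambda>i. u n * \<tau> i) {..<d}" using \<tau> upos[of n] by (auto simp: inj_on_def)
      have s: "(\<Sum>i<d. a i * V n i \<omega>) = (\<Sum>i<d. (a i / X.\<sigma> (u n)) * X (u n * \<tau> i) \<omega>)" for \<omega>
        by (simp add: V_def)
      have normalise: "(x / s) * (y / s) * ((p + q - w) / 2) = x * y * ((p / s\<^sup>2 + q / s\<^sup>2 - w / s\<^sup>2) / 2)" for x y s p q w :: real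
        by (simp add: power2_eq_square add_divide_distrib[symmetric] diff_divide_distrib[symmetric])
      have "(\<Sum>i<d. \<Sum>j<d. (a i / X.\<sigma> (u n)) * (a j / X.\<sigma> (u n)) * (((X.\<sigma> (u n * \<tau> i))\<^sup>2 + (X.\<sigma> (u n * \<tau> j))\<^sup>2 - (X.\<sigma> (u n * \<tau> i - u n * \<tau> j))\<^sup>2) / 2))
        = (\<Sum>i<d. \<Sum>j<d. a i * a j * (((X.\<sigma> (u n * \<tau> i))\<^sup>2 / (X.\<sigma> (u n))\<^sup>2 + (X.\<sigma> (u n * \<tau> j))\<^sup>2 / (X.\<sigma> (u n))\<^sup>2
         - (X.\<sigma> (u n * (\<tau> i - \<tau> j)))\<^sup>2 / (X.\<sigma> (u n))\<^sup>2) / 2))"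
        unfolding right_diff_distrib[symmetric] by (intro sum.cong refl normalise)
      with X.charfun_combination[OF inj, of "\<lambda>i. a i / X.\<sigma> (u n)"] show ?thesis unfolding s by simp
    qed
    have "(\<lambda>n. exp (- (\<Sum>i<d. \<Sum>j<d. a i * a j * (((X.\<sigma> (u n * \<tau> i))\<^sup>2 / (X.\<sigma> (u n))\<^sup>2 + (X.\<sigma> (u n * \<tau> j))\<^sup>2 / (X.\<sigma> (u n))\<^sup>2
         - (X.\<sigma> (u n * (\<tau> i - \<tau> j)))\<^sup>2 / (X.\<sigma> (u n))\<^sup>2) / 2)) / 2))
      \<longlonglongrightarrow> exp (- (\<Sum>i<d. \<Sum>j<d. a i * a j * (((B.\<sigma> (\<tau> i))\<^sup>2 + (B.\<sigma> (\<tau> j))\<^sup>2 - (B.\<sigma> (\<tau> i - \<tau> j))\<^sup>2) / 2)) / 2)"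
      by (intro tendsto_exp tendsto_minus tendsto_divide tendsto_sum tendsto_mult tendsto_add tendsto_diff tendsto_const lim2) auto
    then show ?thesis unfolding eq B.charfun_combination[OF \<tau>] by (rule tendsto_of_real)
  qed
  have "(\<lambda>n. mixed_expectation d M (V n) \<psi> (\<lambda>_. 0)) \<longlonglongrightarrow> mixed_expectation d N (\<lambda>i. B (\<tau> i)) \<psi> (\<lambda>_. 0)"
    by (rule char_convergence_imp_mixed_convergence[OF X.prob_space_axioms B.prob_space_axioms Vm B.measurable_X iV KV B.integrable_X KB char order_refl L lip C])
  then have "(\<lambda>n. complex_of_real (\<integral>\<omega>. \<psi> (\<lambda>i. V n i \<omega>) \<partial>M)) \<longlonglongrightarrow> complex_of_real (\<integral>\<omega>. \<psi> (\<lambda>i. B (\<tau> i) \<omega>) \<partial>N)"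
    unfolding mixed_expectation_def by (simp add: integral_complex_of_real)
  then show ?thesis unfolding V_def tendsto_of_real_iff .
qed

section \<open>Discretising the buffer functional\<close>

definition grid_path :: "nat \<Rightarrow> nat \<Rightarrow> (nat \<Rightarrow> real) \<Rightarrow> real \<Rightarrow> real" where
  "grid_path T r x s = x (nat \<lfloor>(s + real T) * 2 ^ r\<rfloor>)"

definition grid_point :: "nat \<Rightarrow> nat \<Rightarrow> nat \<Rightarrow> real" where
  "grid_point T r i = - real T + real i / 2 ^ r"

text \<open>The cell containing \<open>s\<close>. Only \<open>s = k\<close> can have the last index, and then it is the grid point
  itself.\<close>

lemma grid_index:
  fixes s :: real and T k r :: nat
  assumes "- real T \<le> s" "s \<le> real k"
  defines "i \<equiv> nat \<lfloor>(s + real T) * 2 ^ r\<rfloor>"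
  shows "i < (T + k) * 2 ^ r + 1" "grid_point T r i \<le> s" "s < grid_point T r i + 1 / 2 ^ r"
    and "i = (T + k) * 2 ^ r \<Longrightarrow> s = grid_point T r i"
proof -
  have p: "0 < (2::real) ^ r" by simp
  have y: "0 \<le> (s + real T) * 2 ^ r" using assms by simp
  have i: "real i \<le> (s + real T) * 2 ^ r" "(s + real T) * 2 ^ r < real i + 1"
    unfolding i_def using y by linarith+
  have "(s + real T) * 2 ^ r \<le> (real k + real T) * 2 ^ r" using assms by (intro mult_right_mono) auto
  then have "real i \<le> (real k + real T) * 2 ^ r" using i(1) by linarith
  also have "\<dots> = real ((T + k) * 2 ^ r)" by (simp add: algebra_simps)
  finally have "real i \<le> real ((T + k) * 2 ^ r)" .
  then have "i \<le> (T + k) * 2 ^ r" by (simp only: of_nat_le_iff)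
  then show "i < (T + k) * 2 ^ r + 1" by simp
  have "real i / 2 ^ r \<le> s + real T" using i(1) p by (simp add: pos_divide_le_eq)
  then show g: "grid_point T r i \<le> s" unfolding grid_point_def by linarith
  have "s + real T < (real i + 1) / 2 ^ r" using i(2) p by (simp add: pos_less_divide_eq)
  then show "s < grid_point T r i + 1 / 2 ^ r" unfolding grid_point_def by (simp add: add_divide_distrib)
  show "s = grid_point T r i" if "i = (T + k) * 2 ^ r"
  proof -
    have "grid_point T r i = real k" unfolding that grid_point_def by simp
    with g assms show ?thesis by simp
  qed
qed

lemma grid_point_inj: "inj_on (grid_point T r) A"
  by (auto simp: inj_on_def grid_point_def)

abbreviation queue_envelope :: "(cpath \<Rightarrow> real) \<Rightarrow> real \<Rightarrow> nat \<Rightarrow> (real \<Rightarrow> real) \<Rightarrow> real" where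
  "queue_envelope \<phi> C k f \<equiv> envelope \<phi> C k (eval_cpath (to_cpath (queue f)))"

text \<open>The envelope of \<open>\<phi>\<close> evaluated at the buffer that starts at time \<open>- T\<close> and is fed by the step
  function through the values \<open>x i\<close> at the points of the grid of mesh \<open>1 / 2 ^ r\<close>. It depends on
  \<open>(T + k) * 2 ^ r + 1\<close> coordinates only.\<close>

definition discretised_functional :: "(cpath \<Rightarrow> real) \<Rightarrow> real \<Rightarrow> nat \<Rightarrow> nat \<Rightarrow> nat \<Rightarrow> (nat \<Rightarrow> real) \<Rightarrow> real" where
  "discretised_functional \<phi> C k T r x = envelope \<phi> C k (queue_from (real T) (grid_path T r x))"

context
  fixes \<phi> :: "cpath \<Rightarrow> real" and C :: real
  assumes bound: "\<And>y. \<bar>\<phi> y\<bar> \<le> C"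
begin

lemma envelope_queue_from_lipschitz:
  assumes d: "0 \<le> \<eta>" "\<And>s. - real T \<le> s \<Longrightarrow> s \<le> real k \<Longrightarrow> \<bar>f s - g s\<bar> \<le> \<eta>"
    and b: "\<And>s. - real T \<le> s \<Longrightarrow> s \<le> real k \<Longrightarrow> \<bar>f s\<bar> \<le> D" "\<And>s. - real T \<le> s \<Longrightarrow> s \<le> real k \<Longrightarrow> \<bar>g s\<bar> \<le> D"
  shows "\<bar>envelope \<phi> C k (queue_from (real T) f) - envelope \<phi> C k (queue_from (real T) g)\<bar> \<le> real k * (2 * \<eta>)"
proof (rule envelope_lipschitz[OF bound])
  fix t assume t: "0 \<le> t" "t \<le> real k"
  show "\<bar>queue_from (real T) f t - queue_from (real T) g t\<bar> \<le> 2 * \<eta>"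
    by (rule queue_from_lipschitz[where B = D]) (use d b t in auto)
qed (use d in simp)

lemma discretised_functional_lipschitz:
  "\<bar>discretised_functional \<phi> C k T r x - discretised_functional \<phi> C k T r y\<bar>
    \<le> (2 * real k) * (\<Sum>i<(T + k) * 2 ^ r + 1. \<bar>x i - y i\<bar>)"
proof -
  let ?I = "{..<(T + k) * 2 ^ r + 1}"
  \<comment> \<open>Only coordinates with these indices are read by the buffer on \<open>[0, k]\<close>.\<close>
  have mem: "nat \<lfloor>(s + real T) * 2 ^ r\<rfloor> \<in> ?I" if "- real T \<le> s" "s \<le> real k" for s
    using grid_index(1)[OF that] by simp
  have "\<bar>discretised_functional \<phi> C k T r x - discretised_functional \<phi> C k T r y\<bar> \<le> real k * (2 * (\<Sum>i\<in>?I. \<bar>x i - y i\<bar>))"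
    unfolding discretised_functional_def
  proof (rule envelope_queue_from_lipschitz[where D = "(\<Sum>i\<in>?I. \<bar>x i\<bar>) + (\<Sum>i\<in>?I. \<bar>y i\<bar>)"])
    fix s assume s: "- real T \<le> s" "s \<le> real k"
    show "\<bar>grid_path T r x s - grid_path T r y s\<bar> \<le> (\<Sum>i\<in>?I. \<bar>x i - y i\<bar>)"
      unfolding grid_path_def by (rule member_le_sum[OF mem[OF s]]) auto
    have "\<bar>grid_path T r x s\<bar> \<le> (\<Sum>i\<in>?I. \<bar>x i\<bar>)" "\<bar>grid_path T r y s\<bar> \<le> (\<Sum>i\<in>?I. \<bar>y i\<bar>)"
      unfolding grid_path_def by (rule member_le_sum[OF mem[OF s]]; simp)+
    moreover have "0 \<le> (\<Sum>i\<in>?I. \<bar>x i\<bar>)" "0 \<le> (\<Sum>i\<in>?I. \<bar>y i\<bar>)" by (simp_all add: sum_nonneg)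
    ultimately show "\<bar>grid_path T r x s\<bar> \<le> (\<Sum>i\<in>?I. \<bar>x i\<bar>) + (\<Sum>i\<in>?I. \<bar>y i\<bar>)"
      "\<bar>grid_path T r y s\<bar> \<le> (\<Sum>i\<in>?I. \<bar>x i\<bar>) + (\<Sum>i\<in>?I. \<bar>y i\<bar>)" by linarith+
  qed (simp add: sum_nonneg)
  then show ?thesis by (simp only: mult_ac)
qed

lemma discretised_functional_bounded: "\<bar>discretised_functional \<phi> C k T r x\<bar> \<le> C"
  unfolding discretised_functional_def by (rule envelope_abs_le[OF bound])

lemma discretised_functional_close:
  assumes f: "continuous_on UNIV f" and \<eta>: "0 \<le> \<eta>"
    and osc: "\<And>i t. i < (T + k) * 2 ^ r \<Longrightarrow> grid_point T r i \<le> t \<Longrightarrow> t \<le> grid_point T r i + 1 / 2 ^ r \<Longrightarrow> \<bar>f t - f (grid_point T r i)\<bar> \<le> \<eta>"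
  shows "\<bar>discretised_functional \<phi> C k T r (\<lambda>i. f (grid_point T r i)) - envelope \<phi> C k (queue_from (real T) f)\<bar> \<le> real k * (2 * \<eta>)"
proof -
  have "bounded (f ` {- real T..real k})"
    by (intro compact_imp_bounded compact_continuous_image continuous_on_subset[OF f]) auto
  then obtain D where "\<forall>y\<in>f ` {- real T..real k}. norm y \<le> D"
    unfolding bounded_iff ..
  then have D: "\<bar>f s\<bar> \<le> D" if "s \<in> {- real T..real k}" for s
    using that by simp
  let ?g = "grid_path T r (\<lambda>i. f (grid_point T r i))"
  have d: "\<bar>?g s - f s\<bar> \<le> \<eta>" if s: "- real T \<le> s" "s \<le> real k" for s
  proof -
    define i where "i = nat \<lfloor>(s + real T) * 2 ^ r\<rfloor>"
    note g = grid_index[OF s, of r, folded i_def]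
    show ?thesis
    proof (cases "i = (T + k) * 2 ^ r")
      case True
      then show ?thesis using g(4) \<eta> unfolding grid_path_def i_def[symmetric] by simp
    next
      case False
      then have "\<bar>f s - f (grid_point T r i)\<bar> \<le> \<eta>" using g by (intro osc) auto
      then show ?thesis unfolding grid_path_def i_def[symmetric] by (simp add: abs_minus_commute)
    qed
  qed
  show ?thesis unfolding discretised_functional_def
  proof (rule envelope_queue_from_lipschitz[OF \<eta> d, where D = "D + \<eta>"])
    fix s assume s: "- real T \<le> s" "s \<le> real k"
    show "\<bar>?g s\<bar> \<le> D + \<eta>" "\<bar>f s\<bar> \<le> D + \<eta>" using d[OF s] D[of s] s \<eta> by auto
  qed
qed

lemma discretised_functional_tendsto:
  assumes f: "continuous_on UNIV f"
  shows "(\<lambda>r. discretised_functional \<phi> C k T r (\<lambda>i. f (grid_point T r i))) \<longlonglongrightarrow> envelope \<phi> C k (queue_from (real T) f)"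
proof (rule LIMSEQ_I)
  fix e :: real assume e: "0 < e"
  define \<eta> where "\<eta> = e / (4 * (real k + 1))"
  have \<eta>: "0 < \<eta>" using e by (simp add: \<eta>_def)
  have "real k * (2 * \<eta>) = e / 2 * (real k / (real k + 1))" by (simp add: \<eta>_def field_simps)
  also have "\<dots> \<le> e / 2 * 1" using e by (intro mult_left_mono) auto
  finally have ke: "real k * (2 * \<eta>) < e" using e by simp
  have "uniformly_continuous_on {- real T..real k + 1} f"
    by (intro compact_uniformly_continuous continuous_on_subset[OF f]) auto
  then obtain d where d: "d > 0" "\<And>x y. x \<in> {- real T..real k + 1} \<Longrightarrow> y \<in> {- real T..real k + 1} \<Longrightarrow> dist y x < d \<Longrightarrow> dist (f y) (f x) < \<eta>"
    unfolding uniformly_continuous_on_def using \<eta> by metis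
  obtain n where n: "(1 / 2 :: real) ^ n < d" using real_arch_pow_inv[OF d(1), of "1 / 2"] by auto
  have "norm (discretised_functional \<phi> C k T r (\<lambda>i. f (grid_point T r i)) - envelope \<phi> C k (queue_from (real T) f)) < e" if r: "r \<ge> n" for r
  proof -
    have "(1 / 2 :: real) ^ r \<le> (1 / 2) ^ n" using r by (intro power_decreasing) auto
    then have rd: "1 / 2 ^ r < d" using n by (simp add: power_divide)
    have "\<bar>discretised_functional \<phi> C k T r (\<lambda>i. f (grid_point T r i)) - envelope \<phi> C k (queue_from (real T) f)\<bar> \<le> real k * (2 * \<eta>)"
    proof (rule discretised_functional_close[OF f])
      fix i t assume i: "i < (T + k) * 2 ^ r" and t: "grid_point T r i \<le> t" "t \<le> grid_point T r i + 1 / 2 ^ r"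
      have "real i \<le> real ((T + k) * 2 ^ r)" using i by (simp only: of_nat_le_iff)
      then have "real i / 2 ^ r \<le> real T + real k" by (simp add: pos_divide_le_eq)
      then have g: "grid_point T r i \<in> {- real T..real k}" unfolding grid_point_def by simp
      have "1 / 2 ^ r \<le> (1::real)" by simp
      with g t have "t \<in> {- real T..real k + 1}" unfolding atLeastAtMost_iff by linarith
      with g have "dist (f t) (f (grid_point T r i)) < \<eta>" using t rd
        by (intro d(2)) (auto simp: dist_real_def)
      then show "\<bar>f t - f (grid_point T r i)\<bar> \<le> \<eta>" by (simp add: dist_real_def)
    qed (use \<eta> in simp)
    with ke show ?thesis by simp
  qed
  then show "\<exists>no. \<forall>r\<ge>no. norm (discretised_functional \<phi> C k T r (\<lambda>i. f (grid_point T r i)) - envelope \<phi> C k (queue_from (real T) f)) < e" by blast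
qed

text \<open>Below linear growth to the left of \<open>- T\<close>, the buffer started at \<open>- T\<close> has the stationary content at all
  times \<open>t \<ge> 0\<close>.\<close>

lemma envelope_queue_eq:
  assumes f: "continuous_on UNIV f" "f 0 = 0" and T: "\<And>s. s \<le> - real T \<Longrightarrow> \<bar>f s\<bar> \<le> \<bar>s\<bar>"
  shows "envelope \<phi> C k (eval_cpath (to_cpath (queue f))) = envelope \<phi> C k (queue_from (real T) f)"
proof (rule envelope_cong[OF bound])
  fix t :: real assume t: "0 \<le> t"
  have T': "- f s \<le> - s" if "s \<le> - real T" for s
  proof -
    have "s \<le> 0" using that by (rule order_trans) simp
    with T[OF that] show ?thesis by linarith
  qed
  have q: "queue f t = ereal (queue_from (real T) f t)" if "0 \<le> t" for t
    by (rule queue_eq_queue_from[OF f _ T' that]) auto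
  have "is_cpath (queue f)" unfolding is_cpath_queue_iff[OF f] q[OF order_refl] by simp
  then show "eval_cpath (to_cpath (queue f)) t = queue_from (real T) f t"
    unfolding to_cpath_eval[OF t] q[OF t] by simp
qed

lemma discretised_functional_measurable:
  assumes [measurable]: "\<And>s. Y s \<in> borel_measurable M"
  shows "(\<lambda>\<omega>. discretised_functional \<phi> C k T r (\<lambda>i. Y (grid_point T r i) \<omega>)) \<in> borel_measurable M"
proof -
  have "(\<lambda>\<omega> i. Y (grid_point T r i) \<omega>) \<in> M \<rightarrow>\<^sub>M borel"
    by (rule measurable_coordinatewise_then_product) simp
  from measurable_compose[OF this lipschitz_coordinates_measurable[OF discretised_functional_lipschitz]]
  show ?thesis .
qed

text \<open>For almost every path of the limit process the discretisation converges, first as the mesh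
  tends to 0 and then as the starting time tends to minus infinity; the expectations follow by
  dominated convergence.\<close>

lemma limit_process_approximation:
  assumes N: "prob_space N" and Y[measurable]: "\<And>s. Y s \<in> borel_measurable N"
    and c: "\<And>\<omega>. \<omega> \<in> space N \<Longrightarrow> continuous_on UNIV (\<lambda>s. Y s \<omega>)" and z: "\<And>\<omega>. \<omega> \<in> space N \<Longrightarrow> Y 0 \<omega> = 0"
    and growth: "AE \<omega> in N. \<exists>R>0. \<forall>s\<le>-R. \<bar>Y s \<omega>\<bar> \<le> \<bar>s\<bar>"
    and G: "(\<lambda>\<omega>. to_cpath (queue (\<lambda>s. Y s \<omega>))) \<in> N \<rightarrow>\<^sub>M borel"
    and e: "0 < e"
  shows "\<forall>\<^sub>F T in sequentially. \<forall>\<^sub>F r in sequentially.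
    \<bar>(\<integral>\<omega>. discretised_functional \<phi> C k T r (\<lambda>i. Y (grid_point T r i) \<omega>) \<partial>N) -
     (\<integral>\<omega>. queue_envelope \<phi> C k (\<lambda>s. Y s \<omega>) \<partial>N)\<bar> < e"
proof -
  interpret N: prob_space N by fact
  let ?E = "\<lambda>T \<omega>. envelope \<phi> C k (queue_from (real T) (\<lambda>s. Y s \<omega>))"
  let ?Q = "\<lambda>\<omega>. queue_envelope \<phi> C k (\<lambda>s. Y s \<omega>)"
  let ?D = "\<lambda>T r \<omega>. discretised_functional \<phi> C k T r (\<lambda>i. Y (grid_point T r i) \<omega>)"
  have Dm: "?D T r \<in> borel_measurable N" for T r by (rule discretised_functional_measurable) simp
  have lim: "(\<lambda>r. ?D T r \<omega>) \<longlonglongrightarrow> ?E T \<omega>" if "\<omega> \<in> space N" for T \<omega>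
    by (rule discretised_functional_tendsto[OF c[OF that]])
  have Em: "?E T \<in> borel_measurable N" for T
    by (rule borel_measurable_LIMSEQ_metric[OF Dm lim])
  have Qm: "?Q \<in> borel_measurable N" by (rule envelope_measurable[OF bound G])
  have lim_r: "(\<lambda>r. \<integral>\<omega>. ?D T r \<omega> \<partial>N) \<longlonglongrightarrow> (\<integral>\<omega>. ?E T \<omega> \<partial>N)" for T
  proof (rule integral_dominated_convergence[where w = "\<lambda>_. C", OF Em Dm])
    show "AE \<omega> in N. (\<lambda>r. ?D T r \<omega>) \<longlonglongrightarrow> ?E T \<omega>" by (rule AE_I2) (rule lim)
    show "AE \<omega> in N. norm (?D T r \<omega>) \<le> C" for r
      by (rule AE_I2) (simp add: discretised_functional_bounded)
  qed simp
  have "(\<lambda>T. \<integral>\<omega>. ?E T \<omega> \<partial>N) \<longlonglongrightarrow> (\<integral>\<omega>. ?Q \<omega> \<partial>N)"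
  proof (rule integral_dominated_convergence[where w = "\<lambda>_. C", OF Qm Em])
    show "AE \<omega> in N. (\<lambda>T. ?E T \<omega>) \<longlonglongrightarrow> ?Q \<omega>"
      using growth
    proof (rule AE_mp, intro AE_I2 impI)
      fix \<omega> assume w: "\<omega> \<in> space N" and "\<exists>R>0. \<forall>s\<le>-R. \<bar>Y s \<omega>\<bar> \<le> \<bar>s\<bar>"
      then obtain R where R: "\<And>s. s \<le> -R \<Longrightarrow> \<bar>Y s \<omega>\<bar> \<le> \<bar>s\<bar>" by blast
      obtain n :: nat where n: "R < real n" using reals_Archimedean2 by blast
      have "?E T \<omega> = ?Q \<omega>" if "T \<ge> n" for T
        by (rule envelope_queue_eq[OF c[OF w] z[OF w], symmetric], rule R) (use n that in linarith)
      then have "\<forall>\<^sub>F T in sequentially. ?Q \<omega> = ?E T \<omega>"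
        unfolding eventually_sequentially by (intro exI[of _ n]) simp
      then show "(\<lambda>T. ?E T \<omega>) \<longlonglongrightarrow> ?Q \<omega>" by (rule Lim_transform_eventually[OF tendsto_const])
    qed
    show "AE \<omega> in N. norm (?E T \<omega>) \<le> C" for T
      by (rule AE_I2) (simp add: envelope_abs_le[OF bound])
  qed simp
  then have "\<forall>\<^sub>F T in sequentially. dist (\<integral>\<omega>. ?E T \<omega> \<partial>N) (\<integral>\<omega>. ?Q \<omega> \<partial>N) < e / 2"
    by (rule tendstoD) (use e in simp)
  then show ?thesis
  proof eventually_elim
    case (elim T)
    have "\<forall>\<^sub>F r in sequentially. dist (\<integral>\<omega>. ?D T r \<omega> \<partial>N) (\<integral>\<omega>. ?E T \<omega> \<partial>N) < e / 2"
      by (rule tendstoD[OF lim_r]) (use e in simp)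
    then show ?case
    proof eventually_elim
      case (elim r)
      then show ?case using \<open>dist (\<integral>\<omega>. ?E T \<omega> \<partial>N) (\<integral>\<omega>. ?Q \<omega> \<partial>N) < e / 2\<close> unfolding dist_real_def by linarith
    qed
  qed
qed

end

section \<open>Convergence of the rescaled buffers\<close>

text \<open>Substituting \<open>s = d * s'\<close> in the supremum turns the drift \<open>c * (d * t - s)\<close> into
  \<open>\<kappa> * (t - s')\<close>.\<close>

lemma buffer_rescale:
  assumes d: "0 < d" and k: "0 < \<kappa>" and c: "c * d = \<kappa>"
  shows "buffer X c (d * t) \<omega> / ereal \<kappa> = queue (\<lambda>s. X (d * s) \<omega> / \<kappa>) t"
proof (rule antisym)
  let ?q = "queue (\<lambda>s. X (d * s) \<omega> / \<kappa>) t"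
  have scale: "ereal (X (d * t) \<omega> - X (d * s) \<omega> - c * (d * t - d * s)) =
      ereal \<kappa> * ereal (X (d * t) \<omega> / \<kappa> - X (d * s) \<omega> / \<kappa> - (t - s))" for s
  proof -
    have "c * (d * t - d * s) = \<kappa> * (t - s)" unfolding c[symmetric] by (simp add: algebra_simps)
    then show ?thesis using k by (simp add: right_diff_distrib)
  qed
  have "buffer X c (d * t) \<omega> \<le> ereal \<kappa> * ?q"
    unfolding buffer_def
  proof (rule SUP_least)
    fix s assume s: "s \<in> {..d * t}"
    have "s / d \<in> {..t}" using s d by (simp add: pos_divide_le_eq mult.commute)
    then have "ereal (X (d * t) \<omega> / \<kappa> - X (d * (s / d)) \<omega> / \<kappa> - (t - s / d)) \<le> ?q"
      unfolding queue_def by (rule SUP_upper)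
    then have "ereal \<kappa> * ereal (X (d * t) \<omega> / \<kappa> - X (d * (s / d)) \<omega> / \<kappa> - (t - s / d)) \<le> ereal \<kappa> * ?q"
      by (rule ereal_mult_left_mono) (use k in simp)
    then show "ereal (X (d * t) \<omega> - X s \<omega> - c * (d * t - s)) \<le> ereal \<kappa> * ?q"
      using scale[of "s / d"] d by simp
  qed
  then show "buffer X c (d * t) \<omega> / ereal \<kappa> \<le> ?q"
    by (subst ereal_divide_le_pos) (use k in auto)
  show "?q \<le> buffer X c (d * t) \<omega> / ereal \<kappa>"
    unfolding queue_def
  proof (rule SUP_least)
    fix s assume s: "s \<in> {..t}"
    have "d * s \<in> {..d * t}" using s d by simp
    then have "ereal (X (d * t) \<omega> - X (d * s) \<omega> - c * (d * t - d * s)) \<le> buffer X c (d * t) \<omega>"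
      unfolding buffer_def by (rule SUP_upper)
    then have "ereal \<kappa> * ereal (X (d * t) \<omega> / \<kappa> - X (d * s) \<omega> / \<kappa> - (t - s)) \<le> buffer X c (d * t) \<omega>"
      unfolding scale .
    then show "ereal (X (d * t) \<omega> / \<kappa> - X (d * s) \<omega> / \<kappa> - (t - s)) \<le> buffer X c (d * t) \<omega> / ereal \<kappa>"
      by (subst ereal_le_divide_pos) (use k in auto)
  qed
qed

context rv_gaussian_process
begin

lemma continuous_scaled: "\<omega> \<in> space M \<Longrightarrow> continuous_on UNIV (\<lambda>s. scaled u s \<omega>)"
  unfolding divide_inverse
  by (intro continuous_on_mult_right continuous_on_compose2[OF continuous_path[of _ UNIV]] continuous_intros) auto

lemma random_cpath_scaled:
  assumes u: "0 < u"
  shows "random_cpath M (\<lambda>t \<omega>. queue (\<lambda>s. scaled u s \<omega>) t)"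
proof (rule random_cpath_queue)
  have su: "0 < \<sigma> u" using \<sigma>_pos u .
  have "AE \<omega> in M. \<exists>R>0. \<forall>s\<le>-R. \<bar>X s \<omega>\<bar> \<le> (\<sigma> u / u) * \<bar>s\<bar>"
    by (rule linear_growth) (use su u in simp)
  then show "AE \<omega> in M. \<exists>R>0. \<forall>s\<le>-R. \<bar>scaled u s \<omega>\<bar> \<le> \<bar>s\<bar>"
  proof (rule AE_mp, intro AE_I2 impI)
    fix \<omega> assume "\<exists>R>0. \<forall>s\<le>-R. \<bar>X s \<omega>\<bar> \<le> (\<sigma> u / u) * \<bar>s\<bar>"
    then obtain R where R: "R > 0" "\<And>s. s \<le> -R \<Longrightarrow> \<bar>X s \<omega>\<bar> \<le> (\<sigma> u / u) * \<bar>s\<bar>" by blast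
    have "\<bar>scaled u s \<omega>\<bar> \<le> \<bar>s\<bar>" if s: "s \<le> - (R / u)" for s
    proof -
      have "u * s \<le> u * (- (R / u))" using s u by (intro mult_left_mono) auto
      then have "\<bar>X (u * s) \<omega>\<bar> \<le> (\<sigma> u / u) * \<bar>u * s\<bar>" using u by (intro R(2)) simp
      also have "\<dots> = \<bar>s\<bar> * \<sigma> u" using u by (simp add: abs_mult)
      finally show ?thesis using su by (simp add: pos_divide_le_eq)
    qed
    then show "\<exists>R>0. \<forall>s\<le>-R. \<bar>scaled u s \<omega>\<bar> \<le> \<bar>s\<bar>"
      using R(1) u by (intro exI[of _ "R / u"]) auto
  qed
qed (auto intro: continuous_scaled)

text \<open>Unless \<open>X\<close>, seen at scale \<open>u\<close>, grows too fast to the left of \<open>- T\<close> or oscillates by more than \<open>\<eta>\<close> in a cell, the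
  discretisation changes the functional by at most \<open>2 * k * \<eta>\<close>. The constants \<open>p\<close> and \<open>\<eta>\<close> split \<open>e\<close>
  between the probability of the exceptional event and the error off it.\<close>

lemma prelimit_approximation:
  fixes \<phi> :: "cpath \<Rightarrow> real"
  assumes bound: "\<And>y. \<bar>\<phi> y\<bar> \<le> C" and e: "0 < e"
  shows "\<forall>\<^sub>F T in sequentially. \<forall>\<^sub>F r in sequentially. \<forall>\<^sub>F u in at_top.
    \<bar>expectation (\<lambda>\<omega>. discretised_functional \<phi> C k T r (\<lambda>i. scaled u (grid_point T r i) \<omega>)) -
     expectation (\<lambda>\<omega>. queue_envelope \<phi> C k (\<lambda>s. scaled u s \<omega>))\<bar> < e"
proof -
  have C0: "0 \<le> C" using bound[of undefined] by linarith
  define p where "p = e / (8 * (C + 1))"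
  have p: "0 < p" using e C0 by (simp add: p_def)
  have Cp: "4 * C * p < e"
  proof -
    have "4 * C * p = e / 2 * (C / (C + 1))" using C0 by (simp add: p_def field_simps)
    also have "\<dots> \<le> e / 2 * 1" using C0 e by (intro mult_left_mono) auto
    finally show ?thesis using e by simp
  qed
  define \<eta> where "\<eta> = (e - 4 * C * p) / (4 * (real k + 1))"
  have \<eta>: "0 < \<eta>" using Cp by (simp add: \<eta>_def)
  have k\<eta>: "real k * (2 * \<eta>) < e - 4 * C * p"
  proof -
    have "real k * (2 * \<eta>) = (e - 4 * C * p) / 2 * (real k / (real k + 1))" by (simp add: \<eta>_def field_simps)
    also have "\<dots> \<le> (e - 4 * C * p) / 2 * 1" using Cp by (intro mult_left_mono) auto
    finally show ?thesis using Cp by simp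
  qed
  obtain T0 u0 where T0: "T0 > 0" "u0 > 0" and tail: "\<And>u T. u \<ge> u0 \<Longrightarrow> T \<ge> T0 \<Longrightarrow>
      outer_prob_le M (\<lambda>\<omega>. \<exists>s\<le>-T. \<bar>s\<bar> < \<bar>scaled u s \<omega>\<bar>) p"
    using scaled_linear_growth[OF p] by blast
  obtain n0 :: nat where n0: "T0 < real n0" using reals_Archimedean2 by blast
  have main: "\<forall>\<^sub>F u in at_top. \<bar>expectation (\<lambda>\<omega>. discretised_functional \<phi> C k T r (\<lambda>i. scaled u (grid_point T r i) \<omega>)) -
     expectation (\<lambda>\<omega>. queue_envelope \<phi> C k (\<lambda>s. scaled u s \<omega>))\<bar> < e"
    if T: "T \<ge> n0" and r: "\<exists>u0>0. \<forall>u\<ge>u0. \<forall>h. outer_prob_le M (cell_oscillation u h (r + (T + k)) r \<eta>) p" for T r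
  proof -
    obtain u1 where u1: "u1 > 0" "\<And>u h. u \<ge> u1 \<Longrightarrow> outer_prob_le M (cell_oscillation u h (r + (T + k)) r \<eta>) p" using r by blast
    have "\<bar>expectation (\<lambda>\<omega>. discretised_functional \<phi> C k T r (\<lambda>i. scaled u (grid_point T r i) \<omega>)) -
     expectation (\<lambda>\<omega>. queue_envelope \<phi> C k (\<lambda>s. scaled u s \<omega>))\<bar> < e"
      if u: "u \<ge> max u0 u1" for u
    proof -
      have up: "0 < u" using u T0 by simp
      \<comment> \<open>Each of the two disjuncts is exceptional with outer probability at most \<open>p\<close>.\<close>
      have bad: "outer_prob_le M (\<lambda>\<omega>. (\<exists>s\<le>-real T. \<bar>s\<bar> < \<bar>scaled u s \<omega>\<bar>) \<or>
          (cell_oscillation u (- real T) (r + (T + k)) r \<eta> \<omega>)) (p + p)"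
        by (intro outer_prob_le_disj tail u1) (use u T n0 in auto)
      have "\<bar>expectation (\<lambda>\<omega>. discretised_functional \<phi> C k T r (\<lambda>i. scaled u (grid_point T r i) \<omega>)) -
       expectation (\<lambda>\<omega>. queue_envelope \<phi> C k (\<lambda>s. scaled u s \<omega>))\<bar> \<le> real k * (2 * \<eta>) + 2 * C * (p + p)"
      proof (rule abs_expectation_diff_le[OF _ _ _ _ bad])
        show "(\<lambda>\<omega>. discretised_functional \<phi> C k T r (\<lambda>i. scaled u (grid_point T r i) \<omega>)) \<in> borel_measurable M"
          by (rule discretised_functional_measurable[OF bound]) measurable
        show "(\<lambda>\<omega>. queue_envelope \<phi> C k (\<lambda>s. scaled u s \<omega>)) \<in> borel_measurable M"
          by (rule envelope_measurable[OF bound]) (use random_cpath_scaled[OF up] in \<open>simp add: random_cpath_def\<close>)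
        show "\<bar>discretised_functional \<phi> C k T r (\<lambda>i. scaled u (grid_point T r i) \<omega>)\<bar> \<le> C" for \<omega>
          by (rule discretised_functional_bounded[OF bound])
        show "\<bar>queue_envelope \<phi> C k (\<lambda>s. scaled u s \<omega>)\<bar> \<le> C" for \<omega>
          by (rule envelope_abs_le[OF bound])
        fix \<omega> assume w: "\<omega> \<in> space M"
          and good: "\<not> ((\<exists>s\<le>-real T. \<bar>s\<bar> < \<bar>scaled u s \<omega>\<bar>) \<or>
          (cell_oscillation u (- real T) (r + (T + k)) r \<eta> \<omega>))"
        have eq: "queue_envelope \<phi> C k (\<lambda>s. scaled u s \<omega>) = envelope \<phi> C k (queue_from (real T) (\<lambda>s. scaled u s \<omega>))"
          by (rule envelope_queue_eq[OF bound continuous_scaled[OF w]]) (use w good in \<open>auto simp: not_less\<close>)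
        show "\<bar>discretised_functional \<phi> C k T r (\<lambda>i. scaled u (grid_point T r i) \<omega>) -
           queue_envelope \<phi> C k (\<lambda>s. scaled u s \<omega>)\<bar> \<le> real k * (2 * \<eta>)"
          unfolding eq
        proof (rule discretised_functional_close[OF bound continuous_scaled[OF w]])
          fix i t assume i: "i < (T + k) * 2 ^ r" and t: "grid_point T r i \<le> t" "t \<le> grid_point T r i + 1 / 2 ^ r"
          have "(T + k) * 2 ^ r \<le> (r + (T + k)) * 2 ^ r" by (intro mult_right_mono) auto
          with i have "i < (r + (T + k)) * 2 ^ r" by linarith
          moreover have "t \<in> {- real T + real i / 2 ^ r..- real T + (real i + 1) / 2 ^ r}"
            using t unfolding grid_point_def by (simp add: add_divide_distrib)
          ultimately have "\<not> \<eta> < \<bar>X (u * t) \<omega> / \<sigma> u - X (u * (- real T + real i / 2 ^ r)) \<omega> / \<sigma> u\<bar>"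
            using good by blast
          then show "\<bar>scaled u t \<omega> - scaled u (grid_point T r i) \<omega>\<bar> \<le> \<eta>"
            unfolding grid_point_def by (simp only: not_less)
        qed (use \<eta> in simp)
      qed (use \<eta> in simp)
      also have "\<dots> < e" using k\<eta> by simp
      finally show ?thesis .
    qed
    then show ?thesis unfolding eventually_at_top_linorder by (intro exI[of _ "max u0 u1"]) auto
  qed
  show ?thesis unfolding eventually_sequentially[of "\<lambda>T. \<forall>\<^sub>F r in sequentially. _ T r"]
  proof (intro exI[of _ n0] allI impI)
    fix T assume T: "n0 \<le> T"
    show "\<forall>\<^sub>F r in sequentially. \<forall>\<^sub>F u in at_top.
    \<bar>expectation (\<lambda>\<omega>. discretised_functional \<phi> C k T r (\<lambda>i. scaled u (grid_point T r i) \<omega>)) -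
     expectation (\<lambda>\<omega>. queue_envelope \<phi> C k (\<lambda>s. scaled u s \<omega>))\<bar> < e"
      using scaled_modulus[OF p \<eta>, of "T + k"] by eventually_elim (rule main[OF T])
  qed
qed

end

text \<open>The window \<open>T\<close> and the mesh exponent \<open>r\<close> are fixed so that discretisation costs less than
  \<open>e / 3\<close> both for the limit and for all large scales; between the two discretised functionals
  finite-dimensional convergence applies.\<close>

proposition queue_convergence:
  assumes X: "rv_gaussian_process M X \<alpha>" and B: "rv_gaussian_process N B \<alpha>" and sB: "\<And>t. std_dev N B t = \<bar>t\<bar> powr \<alpha>"
    and u: "filterlim u at_top sequentially" and upos: "\<And>n. 0 < u n"
    and c: "continuous_on UNIV \<phi>" and b: "bounded (range (\<phi> :: cpath \<Rightarrow> real))"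
  shows "(\<lambda>n. \<integral>\<omega>. \<phi> (to_cpath (queue (\<lambda>s. X (u n * s) \<omega> / std_dev M X (u n)))) \<partial>M) \<longlonglongrightarrow>
    (\<integral>\<omega>. \<phi> (to_cpath (queue (\<lambda>s. B s \<omega>))) \<partial>N)"
proof -
  interpret X: rv_gaussian_process M X \<alpha> by fact
  interpret B: rv_gaussian_process N B \<alpha> by fact
  have rX: "(\<lambda>\<omega>. to_cpath (queue (\<lambda>s. X.scaled (u n) s \<omega>))) \<in> M \<rightarrow>\<^sub>M borel" for n
    using X.random_cpath_scaled[OF upos] unfolding random_cpath_def by blast
  have gB: "AE \<omega> in N. \<exists>R>0. \<forall>s\<le>-R. \<bar>B s \<omega>\<bar> \<le> \<bar>s\<bar>" using B.linear_growth[of 1] by simp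
  have "random_cpath N (\<lambda>t \<omega>. queue (\<lambda>s. B s \<omega>) t)"
    by (rule random_cpath_queue) (use gB B.continuous_path in auto)
  then have rB: "(\<lambda>\<omega>. to_cpath (queue (\<lambda>s. B s \<omega>))) \<in> N \<rightarrow>\<^sub>M borel" unfolding random_cpath_def by blast
  show ?thesis
  proof (rule portmanteau_envelope[OF X.prob_space_axioms B.prob_space_axioms rX rB _ c b])
    fix \<phi> :: "cpath \<Rightarrow> real" and C k assume bound: "\<And>y. \<bar>\<phi> y\<bar> \<le> C"
    let ?QX = "\<lambda>n. \<integral>\<omega>. queue_envelope \<phi> C k (\<lambda>s. X.scaled (u n) s \<omega>) \<partial>M"
    let ?QB = "\<integral>\<omega>. queue_envelope \<phi> C k (\<lambda>s. B s \<omega>) \<partial>N"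
    show "?QX \<longlonglongrightarrow> ?QB"
    proof (rule LIMSEQ_I)
      fix e :: real assume e: "0 < e"
      let ?DX = "\<lambda>T r v. \<integral>\<omega>. discretised_functional \<phi> C k T r (\<lambda>i. X.scaled v (grid_point T r i) \<omega>) \<partial>M"
      let ?DB = "\<lambda>T r. \<integral>\<omega>. discretised_functional \<phi> C k T r (\<lambda>i. B (grid_point T r i) \<omega>) \<partial>N"
      have e3: "0 < e / 3" using e by simp
      have "\<forall>\<^sub>F T in sequentially. (\<forall>\<^sub>F r in sequentially. \<forall>\<^sub>F v in at_top.
          \<bar>?DX T r v - (\<integral>\<omega>. queue_envelope \<phi> C k (\<lambda>s. X.scaled v s \<omega>) \<partial>M)\<bar> < e / 3) \<and>
          (\<forall>\<^sub>F r in sequentially. \<bar>?DB T r - ?QB\<bar> < e / 3)"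
        by (intro eventually_conj X.prelimit_approximation bound e3
            limit_process_approximation[OF bound B.prob_space_axioms B.measurable_X B.continuous_path B.X_0 gB rB])
      then obtain T where "\<forall>\<^sub>F r in sequentially. \<forall>\<^sub>F v in at_top.
          \<bar>?DX T r v - (\<integral>\<omega>. queue_envelope \<phi> C k (\<lambda>s. X.scaled v s \<omega>) \<partial>M)\<bar> < e / 3"
          "\<forall>\<^sub>F r in sequentially. \<bar>?DB T r - ?QB\<bar> < e / 3"
        using eventually_happens'[OF sequentially_bot] by blast
      then have "\<forall>\<^sub>F r in sequentially. (\<forall>\<^sub>F v in at_top.
          \<bar>?DX T r v - (\<integral>\<omega>. queue_envelope \<phi> C k (\<lambda>s. X.scaled v s \<omega>) \<partial>M)\<bar> < e / 3) \<and> \<bar>?DB T r - ?QB\<bar> < e / 3"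
        by (rule eventually_conj)
      then obtain r where r: "\<forall>\<^sub>F v in at_top.
          \<bar>?DX T r v - (\<integral>\<omega>. queue_envelope \<phi> C k (\<lambda>s. X.scaled v s \<omega>) \<partial>M)\<bar> < e / 3" "\<bar>?DB T r - ?QB\<bar> < e / 3"
        using eventually_happens'[OF sequentially_bot] by blast
      have 1: "\<forall>\<^sub>F n in sequentially. \<bar>?DX T r (u n) - ?QX n\<bar> < e / 3"
        by (rule eventually_compose_filterlim[OF r(1) u])
      have "(\<lambda>n. ?DX T r (u n)) \<longlonglongrightarrow> ?DB T r"
        by (rule finite_dimensional_convergence[OF X B.gaussian_si_process_axioms sB u upos grid_point_inj _
              discretised_functional_lipschitz[OF bound] discretised_functional_bounded[OF bound]]) simp
      from tendstoD[OF this e3]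
      have 2: "\<forall>\<^sub>F n in sequentially. \<bar>?DX T r (u n) - ?DB T r\<bar> < e / 3"
        unfolding dist_real_def .
      from 1 2 have "\<forall>\<^sub>F n in sequentially. norm (?QX n - ?QB) < e"
      proof eventually_elim
        case (elim n)
        then show ?case using r(2) unfolding real_norm_def by linarith
      qed
      then show "\<exists>no. \<forall>n\<ge>no. norm (?QX n - ?QB) < e" unfolding eventually_sequentially .
    qed
  qed
qed

theorem theorem1:
  fixes M :: "'a measure" and X :: "real \<Rightarrow> 'a \<Rightarrow> real"
    and N :: "'b measure" and B :: "real \<Rightarrow> 'b \<Rightarrow> real"
    and \<sigma> \<delta> :: "real \<Rightarrow> real" and \<alpha> :: real
  defines "\<sigma> \<equiv> std_dev M X"
    and "\<delta> \<equiv> time_scale \<sigma>"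
  assumes "prob_space M" and "centered_gaussian_si M X"
    and "\<exists>\<epsilon>>0. \<exists>L. ((\<lambda>t. (\<sigma> t)\<^sup>2 * \<bar>ln \<bar>t\<bar>\<bar> powr (1 + \<epsilon>)) \<longlongrightarrow> L) (at 0)"
    and "0 < \<alpha>" and "\<alpha> < 1" and "regularly_varying \<sigma> \<alpha>"
    and "prob_space N" and "fractional_brownian_motion \<alpha> N B"
  shows "conv_in_distr_cpath
           M (\<lambda>c t \<omega>. buffer X c (\<delta> c * t) \<omega> / ereal (\<sigma> (\<delta> c)))
           N (buffer B 1)
           (at_right 0)"
proof -
  have X: "rv_gaussian_process M X \<alpha>"
    using assms(3-8) unfolding \<sigma>_def
    by (intro rv_gaussian_process.intro rv_gaussian_process_axioms.intro gaussian_si_process.intro gaussian_si_process_axioms.intro)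
  note B = fractional_brownian_motion_process[OF assms(9,10)]
  interpret X: rv_gaussian_process M X \<alpha> by (rule X)
  interpret B: rv_gaussian_process N B \<alpha> by (rule B(1))
  have large: "\<exists>c0>0. \<forall>c. 0 < c \<longrightarrow> c < c0 \<longrightarrow> A \<le> \<delta> c \<and> c * \<delta> c = \<sigma> (\<delta> c)" if "0 < A" for A
    using X.time_scale_properties[OF that] unfolding \<delta>_def \<sigma>_def .
  obtain c0 where c0: "c0 > 0" "\<And>c. 0 < c \<Longrightarrow> c < c0 \<Longrightarrow> 1 \<le> \<delta> c" "\<And>c. 0 < c \<Longrightarrow> c < c0 \<Longrightarrow> c * \<delta> c = \<sigma> (\<delta> c)"
    using large[of 1] by auto
  have rescale: "buffer X c (\<delta> c * t) \<omega> / ereal (\<sigma> (\<delta> c)) = queue (\<lambda>s. X (\<delta> c * s) \<omega> / \<sigma> (\<delta> c)) t"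
    if "0 < c" "c < c0" for c t \<omega>
  proof (rule buffer_rescale)
    show "0 < \<delta> c" using c0(2)[OF that] by linarith
    then show "0 < \<sigma> (\<delta> c)" unfolding \<sigma>_def by (rule X.\<sigma>_pos)
  qed (rule c0(3)[OF that])
  have "\<forall>\<^sub>F c in at_right 0. 0 < c \<and> c < c0"
    unfolding eventually_at_right_field using c0(1) by auto
  then have "\<forall>\<^sub>F c in at_right 0. random_cpath M (\<lambda>t \<omega>. buffer X c (\<delta> c * t) \<omega> / ereal (\<sigma> (\<delta> c)))"
  proof eventually_elim
    case (elim c)
    have eq: "(\<lambda>t \<omega>. buffer X c (\<delta> c * t) \<omega> / ereal (\<sigma> (\<delta> c))) = (\<lambda>t \<omega>. queue (\<lambda>s. X (\<delta> c * s) \<omega> / \<sigma> (\<delta> c)) t)"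
      by (intro ext rescale) (use elim in auto)
    have "0 < \<delta> c" using elim c0(2)[of c] by linarith
    from X.random_cpath_scaled[OF this] show ?case unfolding eq unfolding \<sigma>_def .
  qed
  moreover have "random_cpath N (buffer B 1)"
  proof -
    have "random_cpath N (\<lambda>t \<omega>. queue (\<lambda>s. B s \<omega>) t)"
      by (rule random_cpath_queue) (use B.linear_growth[of 1] B.continuous_path in auto)
    then show ?thesis by (simp add: buffer_eq_queue[symmetric])
  qed
  moreover have "((\<lambda>c. prob_space.expectation M (\<lambda>\<omega>. \<phi> (to_cpath (\<lambda>t. buffer X c (\<delta> c * t) \<omega> / ereal (\<sigma> (\<delta> c)))))) \<longlongrightarrow>
      prob_space.expectation N (\<lambda>\<omega>. \<phi> (to_cpath (\<lambda>t. buffer B 1 t \<omega>)))) (at_right 0)"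
    if \<phi>: "continuous_on UNIV \<phi>" "bounded (range \<phi>)" for \<phi> :: "cpath \<Rightarrow> real"
    unfolding tendsto_at_iff_sequentially
  proof (intro allI impI)
    fix cs :: "nat \<Rightarrow> real" assume pos: "\<forall>i. cs i \<in> {0<..} - {0}" and lim: "cs \<longlonglongrightarrow> 0"
    obtain m where m: "\<And>n. n \<ge> m \<Longrightarrow> cs n < c0"
      using order_tendstoD(2)[OF lim c0(1)] unfolding eventually_sequentially by blast
    \<comment> \<open>Dropping finitely many terms makes the rescaling identity available for all indices.\<close>
    define c where "c n = cs (n + m)" for n
    have c: "0 < c n" "c n < c0" for n using pos m unfolding c_def by auto
    have clim: "c \<longlonglongrightarrow> 0" unfolding c_def by (rule LIMSEQ_ignore_initial_segment[OF lim])
    have u: "filterlim (\<lambda>n. \<delta> (c n)) at_top sequentially"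
      unfolding filterlim_at_top_gt[of _ _ 0]
    proof (intro allI impI)
      fix A :: real assume "0 < A"
      from large[OF this] obtain c1 where "c1 > 0" and "\<forall>c. 0 < c \<longrightarrow> c < c1 \<longrightarrow> A \<le> \<delta> c \<and> c * \<delta> c = \<sigma> (\<delta> c)"
        by (elim exE conjE)
      then have c1: "c1 > 0" "\<And>c. 0 < c \<Longrightarrow> c < c1 \<Longrightarrow> A \<le> \<delta> c" by simp_all
      show "\<forall>\<^sub>F n in sequentially. A \<le> \<delta> (c n)"
        using order_tendstoD(2)[OF clim c1(1)] by eventually_elim (use c c1 in auto)
    qed
    have upos: "0 < \<delta> (c n)" for n using c0(2)[OF c] by (rule less_le_trans[rotated]) simp
    have "(\<lambda>n. prob_space.expectation M (\<lambda>\<omega>. \<phi> (to_cpath (\<lambda>t. buffer X (c n) (\<delta> (c n) * t) \<omega> / ereal (\<sigma> (\<delta> (c n))))))) \<longlonglongrightarrow>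
      prob_space.expectation N (\<lambda>\<omega>. \<phi> (to_cpath (\<lambda>t. buffer B 1 t \<omega>)))"
      unfolding rescale[OF c] buffer_eq_queue
      using queue_convergence[OF X B(1) B(2) u upos \<phi>] unfolding \<sigma>_def .
    then show "((\<lambda>c. prob_space.expectation M (\<lambda>\<omega>. \<phi> (to_cpath (\<lambda>t. buffer X c (\<delta> c * t) \<omega> / ereal (\<sigma> (\<delta> c)))))) \<circ> cs) \<longlonglongrightarrow>
      prob_space.expectation N (\<lambda>\<omega>. \<phi> (to_cpath (\<lambda>t. buffer B 1 t \<omega>)))"
      unfolding c_def comp_def by (rule LIMSEQ_offset)
  qed
  ultimately show ?thesis unfolding conv_in_distr_cpath_def by blast
qed

end
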